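(* For any modality $\bigcirc$ on $\mathcal{U}$ and any type $X:\mathcal{U}$, the operation $$\mathsf{etmap}:\Big(\sum_{A:\mathcal{U}_{\bigcirc}}(A\to\bigcirc X)\Big)\to\Big(\sum_{Y:\mathcal{U}}\sum_{g:Y\to X}\mathsf{is\_etale}(g)\Big)$$ is an equivalence.
   Context: Setting: Martin-Löf dependent type theory with the usual type formers and a univalent universe $\mathcal{U}$ (function extensionality holds). A modality on $\mathcal{U}$ is given by a function $\bigcirc:\mathcal{U}\to\mathcal{U}$ and functions $\eta_A:A\to\bigcirc A$ ($A:\mathcal{U}$) such that for every $A:\mathcal{U}$ and $P:\bigcirc A\to\mathcal{U}$ the map $\big(\prod_{x:\bigcirc A}\bigcirc(P(x))\big)\to\big(\prod_{a:A}\bigcirc(P(\eta_A(a)))\big)$, $f\mapsto f\circ\eta_A$, is an equivalence. (Equivalently, a reflective subuniverse closed under $\Sigma$.) A type $X$ is modal if $\eta_X$ is an equivalence, and $\mathcal{U}_{\bigcirc}$ is the subuniverse of modal types. For $f:A\to B$, $\bigcirc f:\bigcirc A\to\bigcirc B$ is the unique map with $\bigcirc f\circ\eta_A\sim\eta_B\circ f$. A map $f:A\to B$ is $\bigcirc$-étale, written $\mathsf{is\_etale}(f)$, if the naturality square with top map $\eta_A:A\to\bigcirc A$, left map $f$, right map $\bigcirc f$ and bottom map $\eta_B:B\to\bigcirc B$ is a pullback square (i.e. the induced map $A\to B\times_{\bigcirc B}\bigcirc A$ is an equivalence). The operation $\mathsf{etmap}$ sends a map $f:A\to\bigcirc X$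 with $A$ modal to the first projection $\pi_1:X\times_{\bigcirc X}A\to X$ of the pullback $X\times_{\bigcirc X}A=\sum_{x:X}\sum_{a:A}\eta_X(x)=f(a)$ (this projection is $\bigcirc$-étale, being a pullback of a map between modal types). *)

theory Defs
  imports Main
begin

text \<open>
  Martin-Loef type theory with a cumulative hierarchy of univalent universes a la Russell and
  function extensionality, as an object language.  This is the theory of the HoTT book, appendix
  A.2, except that dependent pairs have projections with surjective pairing instead of an
  induction principle, and path induction is based (the left endpoint is fixed).
  Variables are de Bruijn indices.  Binding positions:
  the second argument of \<open>Pi\<close>, \<open>Lam\<close>, \<open>Sig\<close> and the motive (first argument) of
  \<open>EmptyRec\<close>, \<open>UnitRec\<close>, \<open>SumRec\<close>, \<open>NatRec\<close> bind one variable, and so do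
  both branches of \<open>SumRec\<close>; the step of \<open>NatRec\<close> and the motive (second argument)
  of \<open>J\<close> bind two.
\<close>

datatype tm =
    Var nat
  | Univ nat
  | Pi tm tm | Lam tm tm | App tm tm
  | Sig tm tm | Tup tm tm | Fst tm | Snd tm
  | Path tm tm tm | Refl tm | J tm tm tm tm tm
  | Empty | EmptyRec tm tm
  | Unit | Star | UnitRec tm tm tm
  | Sum tm tm | InL tm | InR tm | SumRec tm tm tm tm
  | Nat | Zero | Succ tm | NatRec tm tm tm tm
  | Ua nat tm tm
  | Funext tm tm tm tm

definition upr :: "(nat \<Rightarrow> nat) \<Rightarrow> nat \<Rightarrow> nat" where
  "upr r = case_nat 0 (\<lambda>n. Suc (r n))"

primrec ren :: "(nat \<Rightarrow> nat) \<Rightarrow> tm \<Rightarrow> tm" where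
  "ren r (Var n) = Var (r n)"
| "ren r (Univ i) = Univ i"
| "ren r (Pi A B) = Pi (ren r A) (ren (upr r) B)"
| "ren r (Lam A b) = Lam (ren r A) (ren (upr r) b)"
| "ren r (App f a) = App (ren r f) (ren r a)"
| "ren r (Sig A B) = Sig (ren r A) (ren (upr r) B)"
| "ren r (Tup a b) = Tup (ren r a) (ren r b)"
| "ren r (Fst p) = Fst (ren r p)"
| "ren r (Snd p) = Snd (ren r p)"
| "ren r (Path A a b) = Path (ren r A) (ren r a) (ren r b)"
| "ren r (Refl a) = Refl (ren r a)"
| "ren r (J a C c b p) = J (ren r a) (ren (upr (upr r)) C) (ren r c) (ren r b) (ren r p)"
| "ren r Empty = Empty"
| "ren r (EmptyRec C a) = EmptyRec (ren (upr r) C) (ren r a)"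
| "ren r Unit = Unit"
| "ren r Star = Star"
| "ren r (UnitRec C c a) = UnitRec (ren (upr r) C) (ren r c) (ren r a)"
| "ren r (Sum A B) = Sum (ren r A) (ren r B)"
| "ren r (InL a) = InL (ren r a)"
| "ren r (InR b) = InR (ren r b)"
| "ren r (SumRec C c d e) = SumRec (ren (upr r) C) (ren (upr r) c) (ren (upr r) d) (ren r e)"
| "ren r Nat = Nat"
| "ren r Zero = Zero"
| "ren r (Succ n) = Succ (ren r n)"
| "ren r (NatRec C c s n) = NatRec (ren (upr r) C) (ren r c) (ren (upr (upr r)) s) (ren r n)"
| "ren r (Ua i A B) = Ua i (ren r A) (ren r B)"
| "ren r (Funext A B f g) = Funext (ren r A) (ren (upr r) B) (ren r f) (ren r g)"

definition ups :: "(nat \<Rightarrow> tm) \<Rightarrow> nat \<Rightarrow> tm" where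
  "ups s = case_nat (Var 0) (\<lambda>n. ren Suc (s n))"

primrec sub :: "(nat \<Rightarrow> tm) \<Rightarrow> tm \<Rightarrow> tm" where
  "sub s (Var n) = s n"
| "sub s (Univ i) = Univ i"
| "sub s (Pi A B) = Pi (sub s A) (sub (ups s) B)"
| "sub s (Lam A b) = Lam (sub s A) (sub (ups s) b)"
| "sub s (App f a) = App (sub s f) (sub s a)"
| "sub s (Sig A B) = Sig (sub s A) (sub (ups s) B)"
| "sub s (Tup a b) = Tup (sub s a) (sub s b)"
| "sub s (Fst p) = Fst (sub s p)"
| "sub s (Snd p) = Snd (sub s p)"
| "sub s (Path A a b) = Path (sub s A) (sub s a) (sub s b)"
| "sub s (Refl a) = Refl (sub s a)"
| "sub s (J a C c b p) = J (sub s a) (sub (ups (ups s)) C) (sub s c) (sub s b) (sub s p)"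
| "sub s Empty = Empty"
| "sub s (EmptyRec C a) = EmptyRec (sub (ups s) C) (sub s a)"
| "sub s Unit = Unit"
| "sub s Star = Star"
| "sub s (UnitRec C c a) = UnitRec (sub (ups s) C) (sub s c) (sub s a)"
| "sub s (Sum A B) = Sum (sub s A) (sub s B)"
| "sub s (InL a) = InL (sub s a)"
| "sub s (InR b) = InR (sub s b)"
| "sub s (SumRec C c d e) = SumRec (sub (ups s) C) (sub (ups s) c) (sub (ups s) d) (sub s e)"
| "sub s Nat = Nat"
| "sub s Zero = Zero"
| "sub s (Succ n) = Succ (sub s n)"
| "sub s (NatRec C c t n) = NatRec (sub (ups s) C) (sub s c) (sub (ups (ups s)) t) (sub s n)"
| "sub s (Ua i A B) = Ua i (sub s A) (sub s B)"
| "sub s (Funext A B f g) = Funext (sub s A) (sub (ups s) B) (sub s f) (sub s g)"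

text \<open>
  \<open>lift k t\<close> weakens \<open>t\<close> by \<open>k\<close> fresh variables, \<open>lift1 k B\<close> does so
  for a term under one binder, which is left alone.
\<close>

definition lift :: "nat \<Rightarrow> tm \<Rightarrow> tm" where
  "lift k = ren (\<lambda>n. n + k)"

definition lift1 :: "nat \<Rightarrow> tm \<Rightarrow> tm" where
  "lift1 k = ren (upr (\<lambda>n. n + k))"

definition inst :: "tm \<Rightarrow> tm \<Rightarrow> tm" where
  "inst B a = sub (case_nat a Var) B"

text \<open>In \<open>inst2 C a b\<close> the term \<open>b\<close> replaces the innermost variable (index 0).\<close>

definition inst2 :: "tm \<Rightarrow> tm \<Rightarrow> tm \<Rightarrow> tm" where
  "inst2 C a b = sub (case_nat b (case_nat a Var)) C"

definition Fn :: "tm \<Rightarrow> tm \<Rightarrow> tm" where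
  "Fn A B = Pi A (lift 1 B)"

definition Prod :: "tm \<Rightarrow> tm \<Rightarrow> tm" where
  "Prod A B = Sig A (lift 1 B)"

text \<open>Equivalences are bi-invertible maps: a section and a retraction.\<close>

definition sec :: "tm \<Rightarrow> tm \<Rightarrow> tm \<Rightarrow> tm" where
  "sec A B f =
     Sig (Fn B A) (Pi (lift 1 B) (Path (lift 2 B) (App (lift 2 f) (App (Var 1) (Var 0))) (Var 0)))"

definition retr :: "tm \<Rightarrow> tm \<Rightarrow> tm \<Rightarrow> tm" where
  "retr A B f =
     Sig (Fn B A) (Pi (lift 1 A) (Path (lift 2 A) (App (Var 1) (App (lift 2 f) (Var 0))) (Var 0)))"

definition is_equiv :: "tm \<Rightarrow> tm \<Rightarrow> tm \<Rightarrow> tm" where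
  "is_equiv A B f = Prod (sec A B f) (retr A B f)"

definition Equiv :: "tm \<Rightarrow> tm \<Rightarrow> tm" where
  "Equiv A B = Sig (Fn A B) (is_equiv (lift 1 A) (lift 1 B) (Var 0))"

definition id_equiv :: "tm \<Rightarrow> tm" where
  "id_equiv A =
     (let i = Lam A (Var 0); h = Lam A (Refl (Var 0)) in Tup i (Tup (Tup i h) (Tup i h)))"

definition idtoeqv :: "nat \<Rightarrow> tm \<Rightarrow> tm \<Rightarrow> tm" where
  "idtoeqv i A B =
     Lam (Path (Univ i) A B)
       (J (lift 1 A) (Equiv (lift 3 A) (Var 1)) (id_equiv (lift 1 A)) (lift 1 B) (Var 0))"

definition Htpy :: "tm \<Rightarrow> tm \<Rightarrow> tm \<Rightarrow> tm \<Rightarrow> tm" where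
  "Htpy A B f g = Pi A (Path B (App (lift 1 f) (Var 0)) (App (lift 1 g) (Var 0)))"

definition happly :: "tm \<Rightarrow> tm \<Rightarrow> tm \<Rightarrow> tm \<Rightarrow> tm" where
  "happly A B f g =
     Lam (Path (Pi A B) f g)
       (J (lift 1 f)
          (Htpy (lift 3 A) (lift1 3 B) (lift 3 f) (Var 1))
          (Lam (lift 1 A) (Refl (App (lift 2 f) (Var 0))))
          (lift 1 g) (Var 0))"

text \<open>The head of a context is the type of the most recently declared variable.\<close>

inductive
  ctx :: "tm list \<Rightarrow> bool" and
  has_type :: "tm list \<Rightarrow> tm \<Rightarrow> tm \<Rightarrow> bool" ("(_ \<turnstile> _ \<Ztypecolon> _)" [51, 51, 51] 50) and
  jeq :: "tm list \<Rightarrow> tm \<Rightarrow> tm \<Rightarrow> tm \<Rightarrow> bool" ("(_ \<turnstile> _ \<doteq> _ \<Ztypecolon> _)" [51, 51, 51, 51] 50)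
where
  ctx_Nil: "ctx []"
| ctx_Cons: "\<Gamma> \<turnstile> A \<Ztypecolon> Univ i \<Longrightarrow> ctx (A # \<Gamma>)"

| ty_Var: "ctx \<Gamma> \<Longrightarrow> n < length \<Gamma> \<Longrightarrow> \<Gamma> \<turnstile> Var n \<Ztypecolon> lift (Suc n) (\<Gamma> ! n)"
| ty_Conv: "\<Gamma> \<turnstile> a \<Ztypecolon> A \<Longrightarrow> \<Gamma> \<turnstile> A \<doteq> B \<Ztypecolon> Univ i \<Longrightarrow> \<Gamma> \<turnstile> a \<Ztypecolon> B"
| eq_Refl: "\<Gamma> \<turnstile> a \<Ztypecolon> A \<Longrightarrow> \<Gamma> \<turnstile> a \<doteq> a \<Ztypecolon> A"
| eq_Sym: "\<Gamma> \<turnstile> a \<doteq> b \<Ztypecolon> A \<Longrightarrow> \<Gamma> \<turnstile> b \<doteq> a \<Ztypecolon> A"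
| eq_Trans: "\<Gamma> \<turnstile> a \<doteq> b \<Ztypecolon> A \<Longrightarrow> \<Gamma> \<turnstile> b \<doteq> c \<Ztypecolon> A \<Longrightarrow> \<Gamma> \<turnstile> a \<doteq> c \<Ztypecolon> A"
| eq_Conv: "\<Gamma> \<turnstile> a \<doteq> b \<Ztypecolon> A \<Longrightarrow> \<Gamma> \<turnstile> A \<doteq> B \<Ztypecolon> Univ i \<Longrightarrow> \<Gamma> \<turnstile> a \<doteq> b \<Ztypecolon> B"

| ty_Univ: "ctx \<Gamma> \<Longrightarrow> \<Gamma> \<turnstile> Univ i \<Ztypecolon> Univ (Suc i)"
| ty_Cumul: "\<Gamma> \<turnstile> A \<Ztypecolon> Univ i \<Longrightarrow> \<Gamma> \<turnstile> A \<Ztypecolon> Univ (Suc i)"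
| eq_Cumul: "\<Gamma> \<turnstile> A \<doteq> B \<Ztypecolon> Univ i \<Longrightarrow> \<Gamma> \<turnstile> A \<doteq> B \<Ztypecolon> Univ (Suc i)"

| ty_Pi: "\<Gamma> \<turnstile> A \<Ztypecolon> Univ i \<Longrightarrow> A # \<Gamma> \<turnstile> B \<Ztypecolon> Univ i \<Longrightarrow> \<Gamma> \<turnstile> Pi A B \<Ztypecolon> Univ i"
| ty_Lam: "A # \<Gamma> \<turnstile> b \<Ztypecolon> B \<Longrightarrow> \<Gamma> \<turnstile> Lam A b \<Ztypecolon> Pi A B"
| ty_App: "\<Gamma> \<turnstile> f \<Ztypecolon> Pi A B \<Longrightarrow> \<Gamma> \<turnstile> a \<Ztypecolon> A \<Longrightarrow> \<Gamma> \<turnstile> App f a \<Ztypecolon> inst B a"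
| Pi_beta: "A # \<Gamma> \<turnstile> b \<Ztypecolon> B \<Longrightarrow> \<Gamma> \<turnstile> a \<Ztypecolon> A \<Longrightarrow>
    \<Gamma> \<turnstile> App (Lam A b) a \<doteq> inst b a \<Ztypecolon> inst B a"
| Pi_eta: "\<Gamma> \<turnstile> f \<Ztypecolon> Pi A B \<Longrightarrow> \<Gamma> \<turnstile> f \<doteq> Lam A (App (lift 1 f) (Var 0)) \<Ztypecolon> Pi A B"
| eq_Pi: "\<Gamma> \<turnstile> A \<doteq> A' \<Ztypecolon> Univ i \<Longrightarrow> A # \<Gamma> \<turnstile> B \<doteq> B' \<Ztypecolon> Univ i \<Longrightarrow>
    \<Gamma> \<turnstile> Pi A B \<doteq> Pi A' B' \<Ztypecolon> Univ i"
| eq_Lam: "\<Gamma> \<turnstile> A \<doteq> A' \<Ztypecolon> Univ i \<Longrightarrow> A # \<Gamma> \<turnstile> b \<doteq> b' \<Ztypecolon> B \<Longrightarrow>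
    \<Gamma> \<turnstile> Lam A b \<doteq> Lam A' b' \<Ztypecolon> Pi A B"
| eq_App: "\<Gamma> \<turnstile> f \<doteq> f' \<Ztypecolon> Pi A B \<Longrightarrow> \<Gamma> \<turnstile> a \<doteq> a' \<Ztypecolon> A \<Longrightarrow>
    \<Gamma> \<turnstile> App f a \<doteq> App f' a' \<Ztypecolon> inst B a"

| ty_Sig: "\<Gamma> \<turnstile> A \<Ztypecolon> Univ i \<Longrightarrow> A # \<Gamma> \<turnstile> B \<Ztypecolon> Univ i \<Longrightarrow> \<Gamma> \<turnstile> Sig A B \<Ztypecolon> Univ i"
| ty_Tup: "A # \<Gamma> \<turnstile> B \<Ztypecolon> Univ i \<Longrightarrow> \<Gamma> \<turnstile> a \<Ztypecolon> A \<Longrightarrow> \<Gamma> \<turnstile> b \<Ztypecolon> inst B a \<Longrightarrow>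
    \<Gamma> \<turnstile> Tup a b \<Ztypecolon> Sig A B"
| ty_Fst: "\<Gamma> \<turnstile> p \<Ztypecolon> Sig A B \<Longrightarrow> \<Gamma> \<turnstile> Fst p \<Ztypecolon> A"
| ty_Snd: "\<Gamma> \<turnstile> p \<Ztypecolon> Sig A B \<Longrightarrow> \<Gamma> \<turnstile> Snd p \<Ztypecolon> inst B (Fst p)"
| Sig_beta1: "A # \<Gamma> \<turnstile> B \<Ztypecolon> Univ i \<Longrightarrow> \<Gamma> \<turnstile> a \<Ztypecolon> A \<Longrightarrow> \<Gamma> \<turnstile> b \<Ztypecolon> inst B a \<Longrightarrow>
    \<Gamma> \<turnstile> Fst (Tup a b) \<doteq> a \<Ztypecolon> A"
| Sig_beta2: "A # \<Gamma> \<turnstile> B \<Ztypecolon> Univ i \<Longrightarrow> \<Gamma> \<turnstile> a \<Ztypecolon> A \<Longrightarrow> \<Gamma> \<turnstile> b \<Ztypecolon> inst B a \<Longrightarrow>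
    \<Gamma> \<turnstile> Snd (Tup a b) \<doteq> b \<Ztypecolon> inst B a"
| Sig_eta: "\<Gamma> \<turnstile> p \<Ztypecolon> Sig A B \<Longrightarrow> \<Gamma> \<turnstile> p \<doteq> Tup (Fst p) (Snd p) \<Ztypecolon> Sig A B"
| eq_Sig: "\<Gamma> \<turnstile> A \<doteq> A' \<Ztypecolon> Univ i \<Longrightarrow> A # \<Gamma> \<turnstile> B \<doteq> B' \<Ztypecolon> Univ i \<Longrightarrow>
    \<Gamma> \<turnstile> Sig A B \<doteq> Sig A' B' \<Ztypecolon> Univ i"
| eq_Tup: "A # \<Gamma> \<turnstile> B \<Ztypecolon> Univ i \<Longrightarrow> \<Gamma> \<turnstile> a \<doteq> a' \<Ztypecolon> A \<Longrightarrow> \<Gamma> \<turnstile> b \<doteq> b' \<Ztypecolon> inst B a \<Longrightarrow>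
    \<Gamma> \<turnstile> Tup a b \<doteq> Tup a' b' \<Ztypecolon> Sig A B"
| eq_Fst: "\<Gamma> \<turnstile> p \<doteq> p' \<Ztypecolon> Sig A B \<Longrightarrow> \<Gamma> \<turnstile> Fst p \<doteq> Fst p' \<Ztypecolon> A"
| eq_Snd: "\<Gamma> \<turnstile> p \<doteq> p' \<Ztypecolon> Sig A B \<Longrightarrow> \<Gamma> \<turnstile> Snd p \<doteq> Snd p' \<Ztypecolon> inst B (Fst p)"

| ty_Path: "\<Gamma> \<turnstile> A \<Ztypecolon> Univ i \<Longrightarrow> \<Gamma> \<turnstile> a \<Ztypecolon> A \<Longrightarrow> \<Gamma> \<turnstile> b \<Ztypecolon> A \<Longrightarrow> \<Gamma> \<turnstile> Path A a b \<Ztypecolon> Univ i"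
| ty_Refl: "\<Gamma> \<turnstile> A \<Ztypecolon> Univ i \<Longrightarrow> \<Gamma> \<turnstile> a \<Ztypecolon> A \<Longrightarrow> \<Gamma> \<turnstile> Refl a \<Ztypecolon> Path A a a"
| ty_J: "Path (lift 1 A) (lift 1 a) (Var 0) # A # \<Gamma> \<turnstile> C \<Ztypecolon> Univ i \<Longrightarrow>
    \<Gamma> \<turnstile> a \<Ztypecolon> A \<Longrightarrow> \<Gamma> \<turnstile> c \<Ztypecolon> inst2 C a (Refl a) \<Longrightarrow> \<Gamma> \<turnstile> b \<Ztypecolon> A \<Longrightarrow> \<Gamma> \<turnstile> p \<Ztypecolon> Path A a b \<Longrightarrow>
    \<Gamma> \<turnstile> J a C c b p \<Ztypecolon> inst2 C b p"
| J_beta: "Path (lift 1 A) (lift 1 a) (Var 0) # A # \<Gamma> \<turnstile> C \<Ztypecolon> Univ i \<Longrightarrow>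
    \<Gamma> \<turnstile> a \<Ztypecolon> A \<Longrightarrow> \<Gamma> \<turnstile> c \<Ztypecolon> inst2 C a (Refl a) \<Longrightarrow>
    \<Gamma> \<turnstile> J a C c a (Refl a) \<doteq> c \<Ztypecolon> inst2 C a (Refl a)"
| eq_Path: "\<Gamma> \<turnstile> A \<doteq> A' \<Ztypecolon> Univ i \<Longrightarrow> \<Gamma> \<turnstile> a \<doteq> a' \<Ztypecolon> A \<Longrightarrow> \<Gamma> \<turnstile> b \<doteq> b' \<Ztypecolon> A \<Longrightarrow>
    \<Gamma> \<turnstile> Path A a b \<doteq> Path A' a' b' \<Ztypecolon> Univ i"
| eq_ReflI: "\<Gamma> \<turnstile> A \<Ztypecolon> Univ i \<Longrightarrow> \<Gamma> \<turnstile> a \<doteq> a' \<Ztypecolon> A \<Longrightarrow> \<Gamma> \<turnstile> Refl a \<doteq> Refl a' \<Ztypecolon> Path A a a"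
| eq_J: "Path (lift 1 A) (lift 1 a) (Var 0) # A # \<Gamma> \<turnstile> C \<doteq> C' \<Ztypecolon> Univ i \<Longrightarrow>
    \<Gamma> \<turnstile> a \<doteq> a' \<Ztypecolon> A \<Longrightarrow> \<Gamma> \<turnstile> c \<doteq> c' \<Ztypecolon> inst2 C a (Refl a) \<Longrightarrow> \<Gamma> \<turnstile> b \<doteq> b' \<Ztypecolon> A \<Longrightarrow>
    \<Gamma> \<turnstile> p \<doteq> p' \<Ztypecolon> Path A a b \<Longrightarrow> \<Gamma> \<turnstile> J a C c b p \<doteq> J a' C' c' b' p' \<Ztypecolon> inst2 C b p"

| ty_Empty: "ctx \<Gamma> \<Longrightarrow> \<Gamma> \<turnstile> Empty \<Ztypecolon> Univ i"
| ty_EmptyRec: "Empty # \<Gamma> \<turnstile> C \<Ztypecolon> Univ i \<Longrightarrow> \<Gamma> \<turnstile> a \<Ztypecolon> Empty \<Longrightarrow> \<Gamma> \<turnstile> EmptyRec C a \<Ztypecolon> inst C a"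
| eq_EmptyRec: "Empty # \<Gamma> \<turnstile> C \<doteq> C' \<Ztypecolon> Univ i \<Longrightarrow> \<Gamma> \<turnstile> a \<doteq> a' \<Ztypecolon> Empty \<Longrightarrow>
    \<Gamma> \<turnstile> EmptyRec C a \<doteq> EmptyRec C' a' \<Ztypecolon> inst C a"

| ty_Unit: "ctx \<Gamma> \<Longrightarrow> \<Gamma> \<turnstile> Unit \<Ztypecolon> Univ i"
| ty_Star: "ctx \<Gamma> \<Longrightarrow> \<Gamma> \<turnstile> Star \<Ztypecolon> Unit"
| ty_UnitRec: "Unit # \<Gamma> \<turnstile> C \<Ztypecolon> Univ i \<Longrightarrow> \<Gamma> \<turnstile> c \<Ztypecolon> inst C Star \<Longrightarrow> \<Gamma> \<turnstile> a \<Ztypecolon> Unit \<Longrightarrow>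
    \<Gamma> \<turnstile> UnitRec C c a \<Ztypecolon> inst C a"
| Unit_beta: "Unit # \<Gamma> \<turnstile> C \<Ztypecolon> Univ i \<Longrightarrow> \<Gamma> \<turnstile> c \<Ztypecolon> inst C Star \<Longrightarrow>
    \<Gamma> \<turnstile> UnitRec C c Star \<doteq> c \<Ztypecolon> inst C Star"
| eq_UnitRec: "Unit # \<Gamma> \<turnstile> C \<doteq> C' \<Ztypecolon> Univ i \<Longrightarrow> \<Gamma> \<turnstile> c \<doteq> c' \<Ztypecolon> inst C Star \<Longrightarrow> \<Gamma> \<turnstile> a \<doteq> a' \<Ztypecolon> Unit \<Longrightarrow>
    \<Gamma> \<turnstile> UnitRec C c a \<doteq> UnitRec C' c' a' \<Ztypecolon> inst C a"

| ty_Sum: "\<Gamma> \<turnstile> A \<Ztypecolon> Univ i \<Longrightarrow> \<Gamma> \<turnstile> B \<Ztypecolon> Univ i \<Longrightarrow> \<Gamma> \<turnstile> Sum A B \<Ztypecolon> Univ i"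
| ty_InL: "\<Gamma> \<turnstile> A \<Ztypecolon> Univ i \<Longrightarrow> \<Gamma> \<turnstile> B \<Ztypecolon> Univ i \<Longrightarrow> \<Gamma> \<turnstile> a \<Ztypecolon> A \<Longrightarrow> \<Gamma> \<turnstile> InL a \<Ztypecolon> Sum A B"
| ty_InR: "\<Gamma> \<turnstile> A \<Ztypecolon> Univ i \<Longrightarrow> \<Gamma> \<turnstile> B \<Ztypecolon> Univ i \<Longrightarrow> \<Gamma> \<turnstile> b \<Ztypecolon> B \<Longrightarrow> \<Gamma> \<turnstile> InR b \<Ztypecolon> Sum A B"
| ty_SumRec: "Sum A B # \<Gamma> \<turnstile> C \<Ztypecolon> Univ i \<Longrightarrow>
    A # \<Gamma> \<turnstile> c \<Ztypecolon> inst (lift1 1 C) (InL (Var 0)) \<Longrightarrow> B # \<Gamma> \<turnstile> d \<Ztypecolon> inst (lift1 1 C) (InR (Var 0)) \<Longrightarrow>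
    \<Gamma> \<turnstile> e \<Ztypecolon> Sum A B \<Longrightarrow> \<Gamma> \<turnstile> SumRec C c d e \<Ztypecolon> inst C e"
| Sum_beta1: "Sum A B # \<Gamma> \<turnstile> C \<Ztypecolon> Univ i \<Longrightarrow>
    A # \<Gamma> \<turnstile> c \<Ztypecolon> inst (lift1 1 C) (InL (Var 0)) \<Longrightarrow> B # \<Gamma> \<turnstile> d \<Ztypecolon> inst (lift1 1 C) (InR (Var 0)) \<Longrightarrow>
    \<Gamma> \<turnstile> a \<Ztypecolon> A \<Longrightarrow> \<Gamma> \<turnstile> SumRec C c d (InL a) \<doteq> inst c a \<Ztypecolon> inst C (InL a)"
| Sum_beta2: "Sum A B # \<Gamma> \<turnstile> C \<Ztypecolon> Univ i \<Longrightarrow>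
    A # \<Gamma> \<turnstile> c \<Ztypecolon> inst (lift1 1 C) (InL (Var 0)) \<Longrightarrow> B # \<Gamma> \<turnstile> d \<Ztypecolon> inst (lift1 1 C) (InR (Var 0)) \<Longrightarrow>
    \<Gamma> \<turnstile> b \<Ztypecolon> B \<Longrightarrow> \<Gamma> \<turnstile> SumRec C c d (InR b) \<doteq> inst d b \<Ztypecolon> inst C (InR b)"
| eq_Sum: "\<Gamma> \<turnstile> A \<doteq> A' \<Ztypecolon> Univ i \<Longrightarrow> \<Gamma> \<turnstile> B \<doteq> B' \<Ztypecolon> Univ i \<Longrightarrow> \<Gamma> \<turnstile> Sum A B \<doteq> Sum A' B' \<Ztypecolon> Univ i"
| eq_InL: "\<Gamma> \<turnstile> A \<Ztypecolon> Univ i \<Longrightarrow> \<Gamma> \<turnstile> B \<Ztypecolon> Univ i \<Longrightarrow> \<Gamma> \<turnstile> a \<doteq> a' \<Ztypecolon> A \<Longrightarrow>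
    \<Gamma> \<turnstile> InL a \<doteq> InL a' \<Ztypecolon> Sum A B"
| eq_InR: "\<Gamma> \<turnstile> A \<Ztypecolon> Univ i \<Longrightarrow> \<Gamma> \<turnstile> B \<Ztypecolon> Univ i \<Longrightarrow> \<Gamma> \<turnstile> b \<doteq> b' \<Ztypecolon> B \<Longrightarrow>
    \<Gamma> \<turnstile> InR b \<doteq> InR b' \<Ztypecolon> Sum A B"
| eq_SumRec: "Sum A B # \<Gamma> \<turnstile> C \<doteq> C' \<Ztypecolon> Univ i \<Longrightarrow>
    A # \<Gamma> \<turnstile> c \<doteq> c' \<Ztypecolon> inst (lift1 1 C) (InL (Var 0)) \<Longrightarrow>
    B # \<Gamma> \<turnstile> d \<doteq> d' \<Ztypecolon> inst (lift1 1 C) (InR (Var 0)) \<Longrightarrow>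
    \<Gamma> \<turnstile> e \<doteq> e' \<Ztypecolon> Sum A B \<Longrightarrow> \<Gamma> \<turnstile> SumRec C c d e \<doteq> SumRec C' c' d' e' \<Ztypecolon> inst C e"

| ty_Nat: "ctx \<Gamma> \<Longrightarrow> \<Gamma> \<turnstile> Nat \<Ztypecolon> Univ i"
| ty_Zero: "ctx \<Gamma> \<Longrightarrow> \<Gamma> \<turnstile> Zero \<Ztypecolon> Nat"
| ty_Succ: "\<Gamma> \<turnstile> n \<Ztypecolon> Nat \<Longrightarrow> \<Gamma> \<turnstile> Succ n \<Ztypecolon> Nat"
| ty_NatRec: "Nat # \<Gamma> \<turnstile> C \<Ztypecolon> Univ i \<Longrightarrow> \<Gamma> \<turnstile> c \<Ztypecolon> inst C Zero \<Longrightarrow>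
    C # Nat # \<Gamma> \<turnstile> s \<Ztypecolon> inst (lift1 2 C) (Succ (Var 1)) \<Longrightarrow> \<Gamma> \<turnstile> n \<Ztypecolon> Nat \<Longrightarrow>
    \<Gamma> \<turnstile> NatRec C c s n \<Ztypecolon> inst C n"
| Nat_beta1: "Nat # \<Gamma> \<turnstile> C \<Ztypecolon> Univ i \<Longrightarrow> \<Gamma> \<turnstile> c \<Ztypecolon> inst C Zero \<Longrightarrow>
    C # Nat # \<Gamma> \<turnstile> s \<Ztypecolon> inst (lift1 2 C) (Succ (Var 1)) \<Longrightarrow>
    \<Gamma> \<turnstile> NatRec C c s Zero \<doteq> c \<Ztypecolon> inst C Zero"
| Nat_beta2: "Nat # \<Gamma> \<turnstile> C \<Ztypecolon> Univ i \<Longrightarrow> \<Gamma> \<turnstile> c \<Ztypecolon> inst C Zero \<Longrightarrow>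
    C # Nat # \<Gamma> \<turnstile> s \<Ztypecolon> inst (lift1 2 C) (Succ (Var 1)) \<Longrightarrow> \<Gamma> \<turnstile> n \<Ztypecolon> Nat \<Longrightarrow>
    \<Gamma> \<turnstile> NatRec C c s (Succ n) \<doteq> inst2 s n (NatRec C c s n) \<Ztypecolon> inst C (Succ n)"
| eq_Succ: "\<Gamma> \<turnstile> n \<doteq> n' \<Ztypecolon> Nat \<Longrightarrow> \<Gamma> \<turnstile> Succ n \<doteq> Succ n' \<Ztypecolon> Nat"
| eq_NatRec: "Nat # \<Gamma> \<turnstile> C \<doteq> C' \<Ztypecolon> Univ i \<Longrightarrow> \<Gamma> \<turnstile> c \<doteq> c' \<Ztypecolon> inst C Zero \<Longrightarrow>
    C # Nat # \<Gamma> \<turnstile> s \<doteq> s' \<Ztypecolon> inst (lift1 2 C) (Succ (Var 1)) \<Longrightarrow> \<Gamma> \<turnstile> n \<doteq> n' \<Ztypecolon> Nat \<Longrightarrow>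
    \<Gamma> \<turnstile> NatRec C c s n \<doteq> NatRec C' c' s' n' \<Ztypecolon> inst C n"

| ty_Ua: "\<Gamma> \<turnstile> A \<Ztypecolon> Univ i \<Longrightarrow> \<Gamma> \<turnstile> B \<Ztypecolon> Univ i \<Longrightarrow>
    \<Gamma> \<turnstile> Ua i A B \<Ztypecolon> is_equiv (Path (Univ i) A B) (Equiv A B) (idtoeqv i A B)"
| eq_Ua: "\<Gamma> \<turnstile> A \<doteq> A' \<Ztypecolon> Univ i \<Longrightarrow> \<Gamma> \<turnstile> B \<doteq> B' \<Ztypecolon> Univ i \<Longrightarrow>
    \<Gamma> \<turnstile> Ua i A B \<doteq> Ua i A' B' \<Ztypecolon> is_equiv (Path (Univ i) A B) (Equiv A B) (idtoeqv i A B)"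
| ty_Funext: "\<Gamma> \<turnstile> A \<Ztypecolon> Univ i \<Longrightarrow> A # \<Gamma> \<turnstile> B \<Ztypecolon> Univ i \<Longrightarrow> \<Gamma> \<turnstile> f \<Ztypecolon> Pi A B \<Longrightarrow> \<Gamma> \<turnstile> g \<Ztypecolon> Pi A B \<Longrightarrow>
    \<Gamma> \<turnstile> Funext A B f g \<Ztypecolon> is_equiv (Path (Pi A B) f g) (Htpy A B f g) (happly A B f g)"
| eq_Funext: "\<Gamma> \<turnstile> A \<doteq> A' \<Ztypecolon> Univ i \<Longrightarrow> A # \<Gamma> \<turnstile> B \<doteq> B' \<Ztypecolon> Univ i \<Longrightarrow>
    \<Gamma> \<turnstile> f \<doteq> f' \<Ztypecolon> Pi A B \<Longrightarrow> \<Gamma> \<turnstile> g \<doteq> g' \<Ztypecolon> Pi A B \<Longrightarrow>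
    \<Gamma> \<turnstile> Funext A B f g \<doteq> Funext A' B' f' g'
      \<Ztypecolon> is_equiv (Path (Pi A B) f g) (Htpy A B f g) (happly A B f g)"

text \<open>
  A modality on the universe \<open>Univ i\<close> consists of terms \<open>Om : Univ i \<rightarrow> Univ i\<close>,
  \<open>eta\<close> of type \<open>unit_type i Om\<close> and \<open>m\<close> of type \<open>is_modality i Om eta\<close>.
\<close>

definition unit_type :: "nat \<Rightarrow> tm \<Rightarrow> tm" where
  "unit_type i Om = Pi (Univ i) (Fn (Var 0) (App (lift 1 Om) (Var 0)))"

definition mod_dom :: "tm \<Rightarrow> tm \<Rightarrow> tm \<Rightarrow> tm" where
  "mod_dom Om A P = Pi (App Om A) (App (lift 1 Om) (App (lift 1 P) (Var 0)))"

definition mod_cod :: "tm \<Rightarrow> tm \<Rightarrow> tm \<Rightarrow> tm \<Rightarrow> tm" where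
  "mod_cod Om eta A P =
     Pi A (App (lift 1 Om) (App (lift 1 P) (App (App (lift 1 eta) (lift 1 A)) (Var 0))))"

definition mod_precomp :: "tm \<Rightarrow> tm \<Rightarrow> tm \<Rightarrow> tm \<Rightarrow> tm" where
  "mod_precomp Om eta A P =
     Lam (mod_dom Om A P)
       (Lam (lift 1 A) (App (Var 1) (App (App (lift 2 eta) (lift 2 A)) (Var 0))))"

definition is_modality :: "nat \<Rightarrow> tm \<Rightarrow> tm \<Rightarrow> tm" where
  "is_modality i Om eta =
     Pi (Univ i) (Pi (Fn (App (lift 1 Om) (Var 0)) (Univ i))
       (is_equiv
         (mod_dom (lift 2 Om) (Var 1) (Var 0))
         (mod_cod (lift 2 Om) (lift 2 eta) (Var 1) (Var 0))
         (mod_precomp (lift 2 Om) (lift 2 eta) (Var 1) (Var 0))))"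

definition is_modal :: "tm \<Rightarrow> tm \<Rightarrow> tm \<Rightarrow> tm" where
  "is_modal Om eta A = is_equiv A (App Om A) (App eta A)"

definition Modal_Univ :: "nat \<Rightarrow> tm \<Rightarrow> tm \<Rightarrow> tm" where
  "Modal_Univ i Om eta = Sig (Univ i) (is_modal (lift 1 Om) (lift 1 eta) (Var 0))"

text \<open>
  The functorial action on \<open>f : A \<rightarrow> B\<close>: the section of precomposition with \<open>eta A\<close>
  for the constant family \<open>B\<close>, applied to \<open>eta B \<circ> f\<close>.
  \<open>mod_natural a\<close> is a path from \<open>eta B (f a)\<close> to \<open>mod_map (eta A a)\<close>.
\<close>

definition mod_comp :: "tm \<Rightarrow> tm \<Rightarrow> tm \<Rightarrow> tm \<Rightarrow> tm" where
  "mod_comp eta A B f = Lam A (App (App (lift 1 eta) (lift 1 B)) (App (lift 1 f) (Var 0)))"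

definition mod_section :: "tm \<Rightarrow> tm \<Rightarrow> tm \<Rightarrow> tm \<Rightarrow> tm" where
  "mod_section Om m A B = Fst (App (App m A) (Lam (App Om A) (lift 1 B)))"

definition mod_map :: "tm \<Rightarrow> tm \<Rightarrow> tm \<Rightarrow> tm \<Rightarrow> tm \<Rightarrow> tm \<Rightarrow> tm" where
  "mod_map Om eta m A B f = App (Fst (mod_section Om m A B)) (mod_comp eta A B f)"

definition sym_path :: "tm \<Rightarrow> tm \<Rightarrow> tm \<Rightarrow> tm \<Rightarrow> tm" where
  "sym_path A a b p = J a (Path (lift 2 A) (Var 1) (lift 2 a)) (Refl a) b p"

definition mod_natural :: "tm \<Rightarrow> tm \<Rightarrow> tm \<Rightarrow> tm \<Rightarrow> tm \<Rightarrow> tm \<Rightarrow> tm \<Rightarrow> tm" where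
  "mod_natural Om eta m A B f a =
     (let k = Lam A (App (lift 1 (mod_map Om eta m A B f)) (App (App (lift 1 eta) (lift 1 A)) (Var 0)));
          h = mod_comp eta A B f
      in sym_path (App Om B) (App k a) (App h a)
           (App (App (happly A (lift 1 (App Om B)) k h) (App (Snd (mod_section Om m A B)) h)) a))"

definition Pullback :: "tm \<Rightarrow> tm \<Rightarrow> tm \<Rightarrow> tm \<Rightarrow> tm \<Rightarrow> tm" where
  "Pullback A B C f g =
     Sig A (Sig (lift 1 B) (Path (lift 2 C) (App (lift 2 f) (Var 1)) (App (lift 2 g) (Var 0))))"

definition gap_map :: "tm \<Rightarrow> tm \<Rightarrow> tm \<Rightarrow> tm \<Rightarrow> tm \<Rightarrow> tm \<Rightarrow> tm" where
  "gap_map Om eta m A B f =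
     Lam A (Tup (App (lift 1 f) (Var 0)) (Tup (App (App (lift 1 eta) (lift 1 A)) (Var 0))
       (mod_natural (lift 1 Om) (lift 1 eta) (lift 1 m) (lift 1 A) (lift 1 B) (lift 1 f) (Var 0))))"

definition is_etale :: "tm \<Rightarrow> tm \<Rightarrow> tm \<Rightarrow> tm \<Rightarrow> tm \<Rightarrow> tm \<Rightarrow> tm" where
  "is_etale Om eta m A B f =
     is_equiv A
       (Pullback B (App Om A) (App Om B) (App eta B) (mod_map Om eta m A B f))
       (gap_map Om eta m A B f)"

definition Modal_Over :: "nat \<Rightarrow> tm \<Rightarrow> tm \<Rightarrow> tm \<Rightarrow> tm" where
  "Modal_Over i Om eta X = Sig (Modal_Univ i Om eta) (Fn (Fst (Var 0)) (lift 1 (App Om X)))"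

definition Etale_Over :: "nat \<Rightarrow> tm \<Rightarrow> tm \<Rightarrow> tm \<Rightarrow> tm \<Rightarrow> tm" where
  "Etale_Over i Om eta m X =
     Sig (Univ i) (Sig (Fn (Var 0) (lift 1 X))
       (is_etale (lift 2 Om) (lift 2 eta) (lift 2 m) (Var 1) (lift 2 X) (Var 0)))"

text \<open>For \<open>t : Modal_Over i Om eta X\<close>, i.e. \<open>t = ((A, _), f)\<close>.\<close>

definition etmap_space :: "tm \<Rightarrow> tm \<Rightarrow> tm \<Rightarrow> tm \<Rightarrow> tm" where
  "etmap_space Om eta X t = Pullback X (Fst (Fst t)) (App Om X) (App eta X) (Snd t)"

definition etmap_proj :: "tm \<Rightarrow> tm \<Rightarrow> tm \<Rightarrow> tm \<Rightarrow> tm" where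
  "etmap_proj Om eta X t = Lam (etmap_space Om eta X t) (Fst (Var 0))"

text \<open>
  The third component of \<open>etmap\<close> is a proof that the projection is etale; \<open>etmap\<close> takes
  a family \<open>e\<close> of such proofs, of type \<open>etmap_etale\<close>, as a parameter.  Being etale is
  a proposition, so \<open>e\<close> is unique up to a path.
\<close>

definition etmap_etale :: "nat \<Rightarrow> tm \<Rightarrow> tm \<Rightarrow> tm \<Rightarrow> tm \<Rightarrow> tm" where
  "etmap_etale i Om eta m X =
     Pi (Modal_Over i Om eta X)
       (is_etale (lift 1 Om) (lift 1 eta) (lift 1 m)
         (etmap_space (lift 1 Om) (lift 1 eta) (lift 1 X) (Var 0)) (lift 1 X)
         (etmap_proj (lift 1 Om) (lift 1 eta) (lift 1 X) (Var 0)))"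

definition etmap :: "nat \<Rightarrow> tm \<Rightarrow> tm \<Rightarrow> tm \<Rightarrow> tm \<Rightarrow> tm" where
  "etmap i Om eta X e =
     Lam (Modal_Over i Om eta X)
       (Tup (etmap_space (lift 1 Om) (lift 1 eta) (lift 1 X) (Var 0))
         (Tup (etmap_proj (lift 1 Om) (lift 1 eta) (lift 1 X) (Var 0))
           (App (lift 1 e) (Var 0))))"

end

(* The inverse of etmap sends an etale map g : Y -> X to the modal type OY with Og : OY -> OX.  That g is
   etale says exactly that Y is the pullback of Og along the unit, which gives one round trip by univalence.
   For the other, let P be the pullback of f : A -> OX along the unit, A modal.  The unit is connected, so the
   reflection of the fibre of the unit over f(a) has a point; its image in OP gives an inverse to the map
   OP -> A induced by the projection P -> A.  Hence OP = A, and O of the projection P -> X corresponds to f.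
   The same equivalence shows that P -> X is etale.

   These arguments are long terms of the object theory.  Their derivations are not written down: a bidirectional
   type checker is defined in HOL and proved sound for the judgments, and rewriting evaluates it on the terms,
   which are closed. *)

theory Submission
  imports Defs
begin

section \<open>Substitution\<close>

text \<open>Two obstacles shape the checker. In place of inversion and uniqueness of typing, it
  rechecks what a rule demands each time the rule is applied. And \<open>is_equiv\<close>,
  \<open>mod_map\<close> and \<open>mod_natural\<close>, once unfolded, would swamp the evaluation:
  they stay folded, with typing rules (\<open>derived\<close>) that come from a run in which these
  rules are switched off. Likewise a finished result is referred to by a number and known only by
  its type, and bulky objects are variables until the last instantiation.

  In the object theory, two principles carry the work: univalence replaces an equivalence by an
  identity, function extensionality replaces a homotopy by reflexivity. That the projection from
  \<open>P\<close> is etale is not computed from the concrete naturality path. A map on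
  \<open>Om P\<close> with its naturality is a point in a fibre of precomposition with the unit;
  this precomposition is an equivalence, so the fibre is a proposition. Hence the naturality square
  may be exchanged for the pullback square defining \<open>P\<close>, whose gap map is the
  identity.\<close>

lemma upr_0 [simp]: "upr r 0 = 0" and upr_Suc [simp]: "upr r (Suc n) = Suc (r n)"
  by (simp_all add: upr_def)
lemma ups_0 [simp]: "ups s 0 = Var 0" and ups_Suc [simp]: "ups s (Suc n) = ren Suc (s n)"
  by (simp_all add: ups_def)

lemma upr_comp: "upr r \<circ> upr r' = upr (r \<circ> r')"
  by (rule ext) (simp add: upr_def split: nat.split)

lemma ren_ren: "ren r (ren r' t) = ren (r \<circ> r') t"
  by (induction t arbitrary: r r') (simp_all add: upr_comp)

lemma ups_upr: "(%n. ups s (upr r n)) = ups (%n. s (r n))"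
  by (rule ext) (simp add: upr_def ups_def split: nat.split)

lemma sub_ren: "sub s (ren r t) = sub (%n. s (r n)) t"
  by (induction t arbitrary: r s) (simp_all add: ups_upr)

lemma ren_ups: "(%n. ren (upr r) (ups s n)) = ups (%n. ren r (s n))"
  by (rule ext) (simp add: ups_def ren_ren comp_def split: nat.split)

lemma ren_sub: "ren r (sub s t) = sub (%n. ren r (s n)) t"
  by (induction t arbitrary: r s) (simp_all add: ren_ups)

lemma sub_ups: "(%n. sub (ups s) (ups s' n)) = ups (%n. sub s (s' n))"
  by (rule ext) (simp add: ups_def sub_ren ren_sub split: nat.split)

lemma sub_sub: "sub s (sub s' t) = sub (%n. sub s (s' n)) t"
  by (induction t arbitrary: s s') (simp_all add: sub_ups)

lemma ups_Var [simp]: "ups Var = Var"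
  by (rule ext) (simp add: ups_def split: nat.split)

lemma sub_Var [simp]: "sub Var t = t"
  by (induction t) simp_all

lemma inst_lift [simp]: "inst (lift 1 T) a = T"
  by (simp add: inst_def lift_def sub_ren)

text \<open>The checker substitutes one variable at a time. When the innermost one is replaced, the
  variable for \<open>a\<close> is still in scope, and \<open>b\<close> has to be weakened past
  it.\<close>

lemma inst2_inst: "inst2 C a b = inst (inst C (lift 1 b)) a"
proof -
  have "(%n. sub (case_nat a Var) (case_nat (lift 1 b) Var n)) = case_nat b (case_nat a Var)"
    by (rule ext) (simp add: lift_def sub_ren split: nat.split)
  then show ?thesis by (simp only: inst_def inst2_def sub_sub)
qed

lemma ren_id [simp]: "ren (%n. n) t = t"
proof -
  have "upr (%n. n) = (%n. n)" by (rule ext) (simp add: upr_def split: nat.split)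
  then show ?thesis by (induction t) simp_all
qed

lemma ren_as_sub: "ren r t = sub (%n. Var (r n)) t"
  using sub_ren[of Var r t] by simp

lemma funpow_ups_add: "(ups ^^ k) s (n + k) = lift k (s n)"
  by (induction k) (simp_all add: lift_def ren_ren comp_def)
lemma funpow_upr_add: "(upr ^^ k) r (n + k) = r n + k"
  by (induction k) simp_all

lemma sub_lift_pow: "sub ((ups ^^ k) s) (lift k t) = lift k (sub s t)"
  by (simp only: lift_def sub_ren funpow_ups_add ren_sub)
lemma ren_lift_pow: "ren ((upr ^^ k) r) (lift k t) = lift k (ren r t)"
  by (simp only: lift_def ren_ren comp_def funpow_upr_add)

lemma sub_lift:
  "sub (ups s) (lift 1 t) = lift 1 (sub s t)"
  "sub (ups (ups s)) (lift 2 t) = lift 2 (sub s t)"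
  "sub (ups (ups (ups s))) (lift 3 t) = lift 3 (sub s t)"
  using sub_lift_pow[of 1 s t] sub_lift_pow[of 2 s t] sub_lift_pow[of 3 s t]
  by (simp_all add: numeral_2_eq_2 numeral_3_eq_3)
lemma ren_lift:
  "ren (upr r) (lift 1 t) = lift 1 (ren r t)"
  "ren (upr (upr r)) (lift 2 t) = lift 2 (ren r t)"
  "ren (upr (upr (upr r))) (lift 3 t) = lift 3 (ren r t)"
  using ren_lift_pow[of 1 r t] ren_lift_pow[of 2 r t] ren_lift_pow[of 3 r t]
  by (simp_all add: numeral_2_eq_2 numeral_3_eq_3)

lemma sub_lift1:
  "sub (ups (ups s)) (lift1 1 t) = lift1 1 (sub (ups s) t)"
  "sub (ups (ups (ups s))) (lift1 2 t) = lift1 2 (sub (ups s) t)"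
  "sub (ups (ups (ups (ups s)))) (lift1 3 t) = lift1 3 (sub (ups s) t)"
  by (auto simp: lift1_def sub_ren ren_sub ups_def upr_def ren_ren comp_def numeral_2_eq_2 numeral_3_eq_3
      intro!: arg_cong[of _ _ "%s. sub s t"] split: nat.split)
lemma ren_lift1:
  "ren (upr (upr r)) (lift1 1 t) = lift1 1 (ren (upr r) t)"
  "ren (upr (upr (upr r))) (lift1 2 t) = lift1 2 (ren (upr r) t)"
  "ren (upr (upr (upr (upr r)))) (lift1 3 t) = lift1 3 (ren (upr r) t)"
  by (auto simp: lift1_def ren_ren upr_def comp_def numeral_2_eq_2 numeral_3_eq_3
      intro!: arg_cong[of _ _ "%s. ren s t"] split: nat.split)

lemma sub_inst: "sub s (inst B a) = inst (sub (ups s) B) (sub s a)"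
  by (auto simp: inst_def sub_sub ups_def sub_ren intro!: arg_cong[of _ _ "%s. sub s B"] split: nat.split)
lemma ren_inst: "ren r (inst B a) = inst (ren (upr r) B) (ren r a)"
  by (auto simp: inst_def sub_ren ren_sub upr_def intro!: arg_cong[of _ _ "%s. sub s B"] split: nat.split)
lemma sub_inst2: "sub s (inst2 C a b) = inst2 (sub (ups (ups s)) C) (sub s a) (sub s b)"
  by (auto simp: inst2_def sub_sub ups_def sub_ren ren_ren comp_def intro!: arg_cong[of _ _ "%s. sub s C"] split: nat.split)
lemma ren_inst2: "ren r (inst2 C a b) = inst2 (ren (upr (upr r)) C) (ren r a) (ren r b)"
  by (auto simp: inst2_def sub_ren ren_sub upr_def intro!: arg_cong[of _ _ "%s. sub s C"] split: nat.split)

lemma upr_1: "upr (upr r) 1 = 1" and ups_1: "ups (ups s) 1 = Var 1"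
  by simp_all

text \<open>The rules for \<open>Ua\<close> and \<open>Funext\<close> mention
  \<open>is_equiv\<close>, \<open>idtoeqv\<close> and \<open>happly\<close>, so substitution must
  pass through these as through constructors. The notions of the modality are there for
  instantiating closed results with the given \<open>Om\<close>, \<open>eta\<close>,
  \<open>m\<close> and \<open>X\<close>.\<close>

lemma sub_obj:
  "sub s (Fn A B) = Fn (sub s A) (sub s B)"
  "sub s (Prod A B) = Prod (sub s A) (sub s B)"
  "sub s (sec A B f) = sec (sub s A) (sub s B) (sub s f)"
  "sub s (retr A B f) = retr (sub s A) (sub s B) (sub s f)"
  "sub s (is_equiv A B f) = is_equiv (sub s A) (sub s B) (sub s f)"
  "sub s (Equiv A B) = Equiv (sub s A) (sub s B)"
  "sub s (id_equiv A) = id_equiv (sub s A)"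
  "sub s (idtoeqv i A B) = idtoeqv i (sub s A) (sub s B)"
  "sub s (Htpy A C f g) = Htpy (sub s A) (sub (ups s) C) (sub s f) (sub s g)"
  "sub s (happly A C f g) = happly (sub s A) (sub (ups s) C) (sub s f) (sub s g)"
  "sub s (unit_type i Om) = unit_type i (sub s Om)"
  "sub s (mod_dom Om A P) = mod_dom (sub s Om) (sub s A) (sub s P)"
  "sub s (mod_cod Om e A P) = mod_cod (sub s Om) (sub s e) (sub s A) (sub s P)"
  "sub s (mod_precomp Om e A P) = mod_precomp (sub s Om) (sub s e) (sub s A) (sub s P)"
  "sub s (is_modality i Om e) = is_modality i (sub s Om) (sub s e)"
  "sub s (is_modal Om e A) = is_modal (sub s Om) (sub s e) (sub s A)"
  "sub s (Modal_Univ i Om e) = Modal_Univ i (sub s Om) (sub s e)"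
  "sub s (mod_comp e A B f) = mod_comp (sub s e) (sub s A) (sub s B) (sub s f)"
  "sub s (mod_section Om m A B) = mod_section (sub s Om) (sub s m) (sub s A) (sub s B)"
  "sub s (mod_map Om e m A B f) = mod_map (sub s Om) (sub s e) (sub s m) (sub s A) (sub s B) (sub s f)"
  "sub s (sym_path A a b p) = sym_path (sub s A) (sub s a) (sub s b) (sub s p)"
  "sub s (mod_natural Om e m A B f a) = mod_natural (sub s Om) (sub s e) (sub s m) (sub s A) (sub s B) (sub s f) (sub s a)"
  "sub s (Pullback A B D f g) = Pullback (sub s A) (sub s B) (sub s D) (sub s f) (sub s g)"
  "sub s (gap_map Om e m A B f) = gap_map (sub s Om) (sub s e) (sub s m) (sub s A) (sub s B) (sub s f)"
  "sub s (is_etale Om e m A B f) = is_etale (sub s Om) (sub s e) (sub s m) (sub s A) (sub s B) (sub s f)"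
  "sub s (Modal_Over i Om e A) = Modal_Over i (sub s Om) (sub s e) (sub s A)"
  "sub s (Etale_Over i Om e m A) = Etale_Over i (sub s Om) (sub s e) (sub s m) (sub s A)"
  "sub s (etmap_space Om e A a) = etmap_space (sub s Om) (sub s e) (sub s A) (sub s a)"
  "sub s (etmap_proj Om e A a) = etmap_proj (sub s Om) (sub s e) (sub s A) (sub s a)"
  "sub s (etmap_etale i Om e m A) = etmap_etale i (sub s Om) (sub s e) (sub s m) (sub s A)"
  "sub s (etmap i Om e A a) = etmap i (sub s Om) (sub s e) (sub s A) (sub s a)"
  by (simp_all del: One_nat_def add: Let_def sub_lift sub_lift1 ups_1
      Fn_def Prod_def sec_def retr_def is_equiv_def Equiv_def id_equiv_def idtoeqv_def Htpy_def happly_def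
      unit_type_def mod_dom_def mod_cod_def mod_precomp_def is_modality_def is_modal_def Modal_Univ_def
      mod_comp_def mod_section_def mod_map_def sym_path_def mod_natural_def Pullback_def gap_map_def
      is_etale_def Modal_Over_def Etale_Over_def etmap_space_def etmap_proj_def etmap_etale_def etmap_def)

lemma ren_obj:
  "ren r (Fn A B) = Fn (ren r A) (ren r B)"
  "ren r (Prod A B) = Prod (ren r A) (ren r B)"
  "ren r (sec A B f) = sec (ren r A) (ren r B) (ren r f)"
  "ren r (retr A B f) = retr (ren r A) (ren r B) (ren r f)"
  "ren r (is_equiv A B f) = is_equiv (ren r A) (ren r B) (ren r f)"
  "ren r (Equiv A B) = Equiv (ren r A) (ren r B)"
  "ren r (id_equiv A) = id_equiv (ren r A)"
  "ren r (idtoeqv i A B) = idtoeqv i (ren r A) (ren r B)"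
  "ren r (Htpy A C f g) = Htpy (ren r A) (ren (upr r) C) (ren r f) (ren r g)"
  "ren r (happly A C f g) = happly (ren r A) (ren (upr r) C) (ren r f) (ren r g)"
  "ren r (mod_comp e A B f) = mod_comp (ren r e) (ren r A) (ren r B) (ren r f)"
  "ren r (mod_section Om m A B) = mod_section (ren r Om) (ren r m) (ren r A) (ren r B)"
  "ren r (mod_map Om e m A B f) = mod_map (ren r Om) (ren r e) (ren r m) (ren r A) (ren r B) (ren r f)"
  "ren r (sym_path A a b p) = sym_path (ren r A) (ren r a) (ren r b) (ren r p)"
  "ren r (mod_natural Om e m A B f a) = mod_natural (ren r Om) (ren r e) (ren r m) (ren r A) (ren r B) (ren r f) (ren r a)"
  by (simp_all del: One_nat_def add: Let_def ren_lift ren_lift1 upr_1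
      Fn_def Prod_def sec_def retr_def is_equiv_def Equiv_def id_equiv_def idtoeqv_def Htpy_def happly_def
      mod_comp_def mod_section_def mod_map_def sym_path_def mod_natural_def)

section \<open>Derivations under substitution\<close>

text \<open>The rules that build or compute with a constructor: after substitution has been pushed
  inward, each is simply applied again.\<close>

lemmas structural =
  ty_Univ ty_Pi ty_Lam ty_App Pi_beta Pi_eta eq_Pi eq_Lam eq_App ty_Sig ty_Tup ty_Fst ty_Snd 
  Sig_beta1 Sig_beta2 Sig_eta eq_Sig eq_Tup eq_Fst eq_Snd ty_Path ty_Refl ty_J J_beta eq_Path 
  eq_ReflI eq_J ty_Empty ty_EmptyRec eq_EmptyRec ty_Unit ty_Star ty_UnitRec Unit_beta eq_UnitRec 
  ty_Sum ty_InL ty_InR ty_SumRec Sum_beta1 Sum_beta2 eq_Sum eq_InL eq_InR eq_SumRec ty_Nat ty_Zero 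
  ty_Succ ty_NatRec Nat_beta1 Nat_beta2 eq_Succ eq_NatRec ty_Ua eq_Ua ty_Funext eq_Funext

section \<open>Stability of derivations under renaming\<close>

definition wf_ren :: "tm list => (nat => nat) => tm list => bool" where
  "wf_ren D r G \<longleftrightarrow> ctx D \<and> (\<forall>n < length G. r n < length D \<and>
     lift (Suc (r n)) (D ! r n) = ren r (lift (Suc n) (G ! n)))"

lemma lift_Suc: "lift (Suc n) t = ren Suc (lift n t)"
  by (simp add: lift_def ren_ren comp_def)
lemma ren_upr_Suc: "ren (upr r) (ren Suc t) = ren Suc (ren r t)"
  by (simp add: ren_ren comp_def)
lemma sub_ups_Suc: "sub (ups s) (ren Suc t) = ren Suc (sub s t)"
  by (simp add: sub_ren ren_sub)
lemma lift_0 [simp]: "lift 0 t = t"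
  by (simp add: lift_def)

lemma wf_ren_upr: "wf_ren D r G ==> D \<turnstile> ren r A \<Ztypecolon> Univ i ==> wf_ren (ren r A # D) (upr r) (A # G)"
  unfolding wf_ren_def
proof (intro conjI allI impI)
  assume *: "ctx D \<and> (\<forall>n < length G. r n < length D \<and> lift (Suc (r n)) (D ! r n) = ren r (lift (Suc n) (G ! n)))"
    and A: "D \<turnstile> ren r A \<Ztypecolon> Univ i"
  show "ctx (ren r A # D)" using A by (rule ctx_Cons)
  fix n assume n: "n < length (A # G)"
  show "upr r n < length (ren r A # D)" using n * by (cases n) auto
  show "lift (Suc (upr r n)) ((ren r A # D) ! upr r n) = ren (upr r) (lift (Suc n) ((A # G) ! n))"
  proof (cases n)
    case 0
    then show ?thesis by (simp add: lift_Suc ren_upr_Suc)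
  next
    case (Suc m)
    then have "lift (Suc (r m)) (D ! r m) = ren r (lift (Suc m) (G ! m))" using n * by simp
    then show ?thesis by (simp only: Suc upr_Suc nth_Cons_Suc lift_Suc ren_upr_Suc)
  qed
qed

text \<open>The types in a context stay well formed under renaming; carried through the induction because
  the rules for binders do not list the well-formedness of the bound type among their premises.\<close>

definition ctx_ren :: "tm list => bool" where
  "ctx_ren G \<longleftrightarrow> (\<forall>k A G'. drop k G = A # G' \<longrightarrow> (\<forall>D r. wf_ren D r G' \<longrightarrow> (\<exists>i. D \<turnstile> ren r A \<Ztypecolon> Univ i)))"

lemma ctx_ren_Nil: "ctx_ren []" by (simp add: ctx_ren_def)
lemma ctx_ren_tl: "ctx_ren (A # G) ==> ctx_ren G"
  unfolding ctx_ren_def by (metis drop_Suc_Cons)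
lemma ctx_ren_hd: "ctx_ren (A # G) ==> wf_ren D r G ==> wf_ren (ren r A # D) (upr r) (A # G)"
  unfolding ctx_ren_def by (metis drop_0 wf_ren_upr)
lemma ctx_ren_Cons: "ctx_ren G ==> (\<And>D r. wf_ren D r G ==> \<exists>i. D \<turnstile> ren r A \<Ztypecolon> Univ i) ==> ctx_ren (A # G)"
  unfolding ctx_ren_def by (metis drop_Cons' list.inject)

lemma wf_ren_ctx: "wf_ren D r G ==> ctx D"
  by (simp add: wf_ren_def)
lemma ren_here: "ctx_ren G \<and> (\<forall>D r. wf_ren D r G \<longrightarrow> P D r) ==> wf_ren D r G ==> P D r"
  by blast
lemma ren_bind: "ctx_ren (A # G) \<and> (\<forall>D r. wf_ren D r (A # G) \<longrightarrow> P D r) ==> wf_ren D r G ==>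
    P (ren r A # D) (upr r)"
  by (blast dest: ctx_ren_hd)
lemma ren_bind2: "ctx_ren (B # A # G) \<and> (\<forall>D r. wf_ren D r (B # A # G) \<longrightarrow> P D r) ==> wf_ren D r G ==>
    P (ren (upr r) B # ren r A # D) (upr (upr r))"
  by (blast dest: ctx_ren_hd ctx_ren_tl)

lemmas ren_push = ren.simps ren_inst ren_inst2 ren_lift ren_lift1 ren_obj upr_0 upr_1

text \<open>One pattern serves nearly all rules: each induction hypothesis is taken at the renamed
  context, extended by the zero, one or two variables that the premise binds; the renaming is pushed
  inward and the same rule applies. The last alternative covers conversion, cumulativity and the
  laws of equality, where no constructor is crossed.\<close>

lemma ren_typing:
  "ctx G ==> ctx_ren G"
  "G \<turnstile> t \<Ztypecolon> T ==> ctx_ren G \<and> (\<forall>D r. wf_ren D r G \<longrightarrow> D \<turnstile> ren r t \<Ztypecolon> ren r T)"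
  "G \<turnstile> t \<doteq> u \<Ztypecolon> T ==> ctx_ren G \<and> (\<forall>D r. wf_ren D r G \<longrightarrow> D \<turnstile> ren r t \<doteq> ren r u \<Ztypecolon> ren r T)"
proof (induction rule: ctx_has_type_jeq.inducts)
  case ctx_Nil
  show ?case by (rule ctx_ren_Nil)
next
  case (ctx_Cons G A i)
  then show ?case by (auto intro: ctx_ren_Cons)
next
  case (ty_Var G n)
  then show ?case by (auto simp: wf_ren_def) (metis ctx_has_type_jeq.ty_Var)
qed ((rule conjI, blast dest: ctx_ren_tl, intro allI impI,
  ((drule (1) ren_here | drule (1) ren_bind | drule (1) ren_bind2)+)?, simp only: ren_push;
  rule structural; (assumption | erule wf_ren_ctx)) |
  (simp, blast intro: ty_Conv eq_Refl eq_Sym eq_Trans eq_Conv ty_Cumul eq_Cumul))+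

section \<open>Stability of derivations under substitution\<close>

definition wf_sub :: "tm list => (nat => tm) => tm list => bool" where
  "wf_sub D s G \<longleftrightarrow> ctx D \<and> (\<forall>n < length G. D \<turnstile> s n \<Ztypecolon> sub s (lift (Suc n) (G ! n)))"

lemma wf_ren_Suc: "ctx (A # D) ==> wf_ren (A # D) Suc D"
  by (simp add: wf_ren_def lift_Suc[of "Suc n" for n])

lemma weaken: "ctx (A # D) ==> D \<turnstile> t \<Ztypecolon> T ==> A # D \<turnstile> ren Suc t \<Ztypecolon> ren Suc T"
  and weaken_eq: "ctx (A # D) ==> D \<turnstile> t \<doteq> u \<Ztypecolon> T ==> A # D \<turnstile> ren Suc t \<doteq> ren Suc u \<Ztypecolon> ren Suc T"
  by (blast dest: ren_typing wf_ren_Suc)+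

lemma wf_sub_ups:
  assumes s: "wf_sub D s G" and A: "D \<turnstile> sub s A \<Ztypecolon> Univ i"
  shows "wf_sub (sub s A # D) (ups s) (A # G)"
  unfolding wf_sub_def
proof (intro conjI allI impI)
  show c: "ctx (sub s A # D)" using A by (rule ctx_Cons)
  fix n assume n: "n < length (A # G)"
  show "sub s A # D \<turnstile> ups s n \<Ztypecolon> sub (ups s) (lift (Suc n) ((A # G) ! n))"
  proof (cases n)
    case 0
    have "sub s A # D \<turnstile> Var 0 \<Ztypecolon> lift (Suc 0) ((sub s A # D) ! 0)" by (rule ty_Var[OF c]) simp
    then show ?thesis by (simp add: 0 lift_Suc sub_ups_Suc)
  next
    case (Suc m)
    then have "D \<turnstile> s m \<Ztypecolon> sub s (lift (Suc m) (G ! m))" using n s by (simp add: wf_sub_def)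
    from weaken[OF c this] show ?thesis by (simp only: Suc ups_Suc nth_Cons_Suc lift_Suc sub_ups_Suc)
  qed
qed

definition ctx_sub :: "tm list => bool" where
  "ctx_sub G \<longleftrightarrow> (\<forall>k A G'. drop k G = A # G' \<longrightarrow> (\<forall>D s. wf_sub D s G' \<longrightarrow> (\<exists>i. D \<turnstile> sub s A \<Ztypecolon> Univ i)))"

lemma ctx_sub_Nil: "ctx_sub []" by (simp add: ctx_sub_def)
lemma ctx_sub_tl: "ctx_sub (A # G) ==> ctx_sub G"
  unfolding ctx_sub_def by (metis drop_Suc_Cons)
lemma ctx_sub_hd: "ctx_sub (A # G) ==> wf_sub D s G ==> wf_sub (sub s A # D) (ups s) (A # G)"
  unfolding ctx_sub_def by (metis drop_0 wf_sub_ups)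
lemma ctx_sub_Cons: "ctx_sub G ==> (\<And>D s. wf_sub D s G ==> \<exists>i. D \<turnstile> sub s A \<Ztypecolon> Univ i) ==> ctx_sub (A # G)"
  unfolding ctx_sub_def by (metis drop_Cons' list.inject)

lemma wf_sub_ctx: "wf_sub D s G ==> ctx D"
  by (simp add: wf_sub_def)
lemma sub_here: "ctx_sub G \<and> (\<forall>D s. wf_sub D s G \<longrightarrow> P D s) ==> wf_sub D s G ==> P D s"
  by blast
lemma sub_bind: "ctx_sub (A # G) \<and> (\<forall>D s. wf_sub D s (A # G) \<longrightarrow> P D s) ==> wf_sub D s G ==>
    P (sub s A # D) (ups s)"
  by (blast dest: ctx_sub_hd)
lemma sub_bind2: "ctx_sub (B # A # G) \<and> (\<forall>D s. wf_sub D s (B # A # G) \<longrightarrow> P D s) ==> wf_sub D s G ==>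
    P (sub (ups s) B # sub s A # D) (ups (ups s))"
  by (blast dest: ctx_sub_hd ctx_sub_tl)

lemmas sub_push = sub.simps sub_inst sub_inst2 sub_lift sub_lift1 sub_obj ups_0 ups_1

lemma sub_typing:
  "ctx G ==> ctx_sub G"
  "G \<turnstile> t \<Ztypecolon> T ==> ctx_sub G \<and> (\<forall>D s. wf_sub D s G \<longrightarrow> D \<turnstile> sub s t \<Ztypecolon> sub s T)"
  "G \<turnstile> t \<doteq> u \<Ztypecolon> T ==> ctx_sub G \<and> (\<forall>D s. wf_sub D s G \<longrightarrow> D \<turnstile> sub s t \<doteq> sub s u \<Ztypecolon> sub s T)"
proof (induction rule: ctx_has_type_jeq.inducts)
  case ctx_Nil
  show ?case by (rule ctx_sub_Nil)
next
  case (ctx_Cons G A i)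
  then show ?case by (auto intro: ctx_sub_Cons)
next
  case (ty_Var G n)
  then show ?case by (auto simp: wf_sub_def)
qed ((rule conjI, blast dest: ctx_sub_tl, intro allI impI,
  ((drule (1) sub_here | drule (1) sub_bind | drule (1) sub_bind2)+)?, simp only: sub_push;
  rule structural; (assumption | erule wf_sub_ctx)) |
  (simp, blast intro: ty_Conv eq_Refl eq_Sym eq_Trans eq_Conv ty_Cumul eq_Cumul))+

section \<open>Judgmentally equal substitutions\<close>

definition wf_eq :: "tm list => (nat => tm) => (nat => tm) => tm list => bool" where
  "wf_eq D s s' G \<longleftrightarrow> wf_sub D s G \<and> (\<forall>n < length G. D \<turnstile> s n \<doteq> s' n \<Ztypecolon> sub s (lift (Suc n) (G ! n)))"

lemma wf_eq_ups:
  assumes s: "wf_eq D s s' G" and A: "D \<turnstile> sub s A \<Ztypecolon> Univ i"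
  shows "wf_eq (sub s A # D) (ups s) (ups s') (A # G)"
proof -
  have w: "wf_sub (sub s A # D) (ups s) (A # G)" using s A by (simp add: wf_eq_def wf_sub_ups)
  then have c: "ctx (sub s A # D)" by (simp add: wf_sub_def)
  have "sub s A # D \<turnstile> ups s n \<doteq> ups s' n \<Ztypecolon> sub (ups s) (lift (Suc n) ((A # G) ! n))" if n: "n < length (A # G)" for n
  proof (cases n)
    case 0
    have "sub s A # D \<turnstile> ups s n \<Ztypecolon> sub (ups s) (lift (Suc n) ((A # G) ! n))" using w n by (simp add: wf_sub_def)
    from eq_Refl[OF this] show ?thesis by (simp add: 0)
  next
    case (Suc m)
    then have "D \<turnstile> s m \<doteq> s' m \<Ztypecolon> sub s (lift (Suc m) (G ! m))" using n s by (simp add: wf_eq_def)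
    from weaken_eq[OF c this] show ?thesis by (simp only: Suc ups_Suc nth_Cons_Suc lift_Suc sub_ups_Suc)
  qed
  with w show ?thesis by (simp add: wf_eq_def)
qed

definition ctx_eq :: "tm list => bool" where
  "ctx_eq G \<longleftrightarrow> (\<forall>k A G'. drop k G = A # G' \<longrightarrow> (\<forall>D s s'. wf_eq D s s' G' \<longrightarrow>
     (\<exists>i. D \<turnstile> sub s A \<Ztypecolon> Univ i \<and> D \<turnstile> sub s A \<doteq> sub s' A \<Ztypecolon> Univ i)))"

lemma ctx_eq_Nil: "ctx_eq []" by (simp add: ctx_eq_def)
lemma ctx_eq_tl: "ctx_eq (A # G) ==> ctx_eq G"
  unfolding ctx_eq_def by (metis drop_Suc_Cons)
lemma ctx_eq_ty: "ctx_eq (A # G) ==> wf_eq D s s' G ==> \<exists>i. D \<turnstile> sub s A \<Ztypecolon> Univ i \<and> D \<turnstile> sub s A \<doteq> sub s' A \<Ztypecolon> Univ i"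
  unfolding ctx_eq_def by (metis drop_0)
lemma ctx_eq_hd: "ctx_eq (A # G) ==> wf_eq D s s' G ==> wf_eq (sub s A # D) (ups s) (ups s') (A # G)"
  by (blast dest: ctx_eq_ty intro: wf_eq_ups)
lemma ctx_eq_Cons: "ctx_eq G ==> (\<And>D s s'. wf_eq D s s' G ==> \<exists>i. D \<turnstile> sub s A \<Ztypecolon> Univ i \<and> D \<turnstile> sub s A \<doteq> sub s' A \<Ztypecolon> Univ i) ==>
    ctx_eq (A # G)"
  unfolding ctx_eq_def by (metis drop_Cons' list.inject)

lemma wf_eq_ctx: "wf_eq D s s' G ==> ctx D"
  by (simp add: wf_eq_def wf_sub_def)
lemma eq_here: "ctx_eq G \<and> (\<forall>D s s'. wf_eq D s s' G \<longrightarrow> P D s s' \<and> Q D s s') ==> wf_eq D s s' G ==> P D s s' \<and> Q D s s'"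
  by blast
lemma eq_bind: "ctx_eq (A # G) \<and> (\<forall>D s s'. wf_eq D s s' (A # G) \<longrightarrow> P D s s' \<and> Q D s s') ==> wf_eq D s s' G ==>
    P (sub s A # D) (ups s) (ups s') \<and> Q (sub s A # D) (ups s) (ups s')"
  by (blast dest: ctx_eq_hd)
lemma eq_bind2: "ctx_eq (B # A # G) \<and> (\<forall>D s s'. wf_eq D s s' (B # A # G) \<longrightarrow> P D s s' \<and> Q D s s') ==> wf_eq D s s' G ==>
    P (sub (ups s) B # sub s A # D) (ups (ups s)) (ups (ups s')) \<and> Q (sub (ups s) B # sub s A # D) (ups (ups s)) (ups (ups s'))"
  by (blast dest: ctx_eq_hd ctx_eq_tl)

text \<open>This yields the congruence rule for the folded \<open>is_equiv\<close>: one derivation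
  over variables is instantiated in two judgmentally equal ways. Typing is asked of \<open>s\<close>
  alone, since the congruence rules extend contexts by the types on the left.\<close>

lemma eq_typing:
  "ctx G ==> ctx_eq G"
  "G \<turnstile> t \<Ztypecolon> T ==> ctx_eq G \<and> (\<forall>D s s'. wf_eq D s s' G \<longrightarrow> D \<turnstile> sub s t \<Ztypecolon> sub s T \<and> D \<turnstile> sub s t \<doteq> sub s' t \<Ztypecolon> sub s T)"
  "G \<turnstile> t \<doteq> u \<Ztypecolon> T ==> True"
proof (induction rule: ctx_has_type_jeq.inducts)
  case ctx_Nil
  show ?case by (rule ctx_eq_Nil)
next
  case (ctx_Cons G A i)
  then show ?case by - (rule ctx_eq_Cons, blast, simp, blast)
next
  case (ty_Var G n)
  then show ?case by (auto simp: wf_eq_def wf_sub_def)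
next
  case (ty_Conv G a A B i)
  \<comment> \<open>The induction says nothing about equality premises, so this one is carried along
    \<open>s\<close> by \<open>sub_typing\<close>.\<close>
  then have "D \<turnstile> sub s A \<doteq> sub s B \<Ztypecolon> Univ i" if "wf_eq D s s' G" for D s s'
    using sub_typing(3)[OF ty_Conv.hyps(2)] that by (simp add: wf_eq_def)
  with ty_Conv.IH(1) show ?case by (blast intro: ctx_has_type_jeq.ty_Conv ctx_has_type_jeq.eq_Conv)
next
  case (ty_Cumul G A i)
  then show ?case by simp (blast intro: ctx_has_type_jeq.ty_Cumul ctx_has_type_jeq.eq_Cumul)
next
  case (ty_Lam A G b B)
  show ?case
  proof (intro conjI allI impI)
    show "ctx_eq G" using ty_Lam.IH by (blast dest: ctx_eq_tl)
    fix D s s' assume w: "wf_eq D s s' G"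
    \<comment> \<open>\<open>eq_Lam\<close> asks for equal domains, while \<open>ty_Lam\<close> has
      no premise about its domain; the invariant on contexts supplies the equality.\<close>
    from ctx_eq_ty[OF conjunct1[OF ty_Lam.IH] w] obtain i where A: "D \<turnstile> sub s A \<doteq> sub s' A \<Ztypecolon> Univ i" by blast
    note b = eq_bind[OF ty_Lam.IH w]
    show "D \<turnstile> sub s (Lam A b) \<Ztypecolon> sub s (Pi A B)" "D \<turnstile> sub s (Lam A b) \<doteq> sub s' (Lam A b) \<Ztypecolon> sub s (Pi A B)"
      using b A by (simp_all add: ctx_has_type_jeq.ty_Lam ctx_has_type_jeq.eq_Lam)
  qed
next
  case (ty_Pi G A i B)
  show ?case
    using ty_Pi.IH by - (rule conjI, blast, intro allI impI, drule (1) eq_here, drule (1) eq_bind,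
      simp add: ctx_has_type_jeq.ty_Pi ctx_has_type_jeq.eq_Pi)
next
  case ty_Univ
  then show ?case by (auto intro!: ctx_has_type_jeq.eq_Refl ctx_has_type_jeq.ty_Univ dest: wf_eq_ctx)
next
  case ty_Empty
  then show ?case by (auto intro!: ctx_has_type_jeq.eq_Refl ctx_has_type_jeq.ty_Empty dest: wf_eq_ctx)
next
  case ty_Unit
  then show ?case by (auto intro!: ctx_has_type_jeq.eq_Refl ctx_has_type_jeq.ty_Unit dest: wf_eq_ctx)
next
  case ty_Star
  then show ?case by (auto intro!: ctx_has_type_jeq.eq_Refl ctx_has_type_jeq.ty_Star dest: wf_eq_ctx)
next
  case ty_Nat
  then show ?case by (auto intro!: ctx_has_type_jeq.eq_Refl ctx_has_type_jeq.ty_Nat dest: wf_eq_ctx)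
next
  case ty_Zero
  then show ?case by (auto intro!: ctx_has_type_jeq.eq_Refl ctx_has_type_jeq.ty_Zero dest: wf_eq_ctx)
qed ((rule TrueI) | (rule conjI, blast dest: ctx_eq_tl, intro allI impI,
  (drule (1) eq_here | drule (1) eq_bind | drule (1) eq_bind2)+, simp only: sub_push, elim conjE, rule conjI;
  rule structural; (assumption | erule wf_eq_ctx)))+

section \<open>Closed terms\<close>

definition ctx_agree :: "tm list => bool" where
  "ctx_agree G \<longleftrightarrow> (\<forall>k A G'. drop k G = A # G' \<longrightarrow> (\<forall>s s'. (\<forall>n < length G'. s n = s' n) \<longrightarrow> sub s A = sub s' A))"

lemma ctx_agree_tl: "ctx_agree (A # G) ==> ctx_agree G"
  unfolding ctx_agree_def by (metis drop_Suc_Cons)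
lemma ctx_agree_hd: "ctx_agree (A # G) ==> \<forall>n < length G. s n = s' n ==> sub s A = sub s' A"
  unfolding ctx_agree_def by (metis drop_0)
lemma ctx_agree_Cons: "ctx_agree G ==> (\<And>s s'. \<forall>n < length G. s n = s' n ==> sub s A = sub s' A) ==> ctx_agree (A # G)"
  unfolding ctx_agree_def by (metis drop_Cons' list.inject)
lemma ups_agree: "\<forall>n < k. s n = s' n ==> \<forall>n < Suc k. ups s n = ups s' n"
  by (auto simp: ups_def split: nat.split)

lemma agree_here: "ctx_agree G \<and> (\<forall>s s'. (\<forall>n < length G. s n = s' n) \<longrightarrow> P s s') ==> \<forall>n < length G. s n = s' n ==> P s s'"
  by blast
lemma agree_bind: "ctx_agree (A # G) \<and> (\<forall>s s'. (\<forall>n < length (A # G). s n = s' n) \<longrightarrow> P s s') ==>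
    \<forall>n < length G. s n = s' n ==> P (ups s) (ups s')"
  by (drule ups_agree) simp
lemma agree_bind2: "ctx_agree (B # A # G) \<and> (\<forall>s s'. (\<forall>n < length (B # A # G). s n = s' n) \<longrightarrow> P s s') ==>
    \<forall>n < length G. s n = s' n ==> P (ups (ups s)) (ups (ups s'))"
  by (drule ups_agree, drule ups_agree) simp

text \<open>Typing bounds the free variables, which replaces a scoping predicate: only the values of
  a substitution on the variables of the context matter. For the empty context every substitution
  acts trivially.\<close>

lemma agree:
  "ctx G ==> ctx_agree G"
  "G \<turnstile> t \<Ztypecolon> T ==> ctx_agree G \<and> (\<forall>s s'. (\<forall>n < length G. s n = s' n) \<longrightarrow> sub s t = sub s' t)"
  "G \<turnstile> t \<doteq> u \<Ztypecolon> T ==> True"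
proof (induction rule: ctx_has_type_jeq.inducts)
  case ctx_Nil
  show ?case by (simp add: ctx_agree_def)
next
  case (ctx_Cons G A i)
  then show ?case by (auto intro: ctx_agree_Cons)
next
  case (ty_Lam A G b B)
  show ?case
  proof (intro conjI allI impI)
    show "ctx_agree G" using ty_Lam.IH by (blast dest: ctx_agree_tl)
    fix s s' :: "nat => tm" assume w: "\<forall>n < length G. s n = s' n"
    from ctx_agree_hd[OF conjunct1[OF ty_Lam.IH] w] agree_bind[OF ty_Lam.IH w]
    show "sub s (Lam A b) = sub s' (Lam A b)" by simp
  qed
qed ((rule TrueI) | (simp; fail) | (rule conjI, blast dest: ctx_agree_tl, intro allI impI,
    (drule (1) agree_here | drule (1) agree_bind | drule (1) agree_bind2)+, simp only: sub.simps))+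

lemma closed_sub: "[] \<turnstile> t \<Ztypecolon> T ==> sub s t = t"
  using agree(2)[of "[]" t T] sub_Var[of t] by (metis length_0_conv less_zeroE)
lemma closed_ren: "[] \<turnstile> t \<Ztypecolon> T ==> ren r t = t"
  by (simp add: ren_as_sub closed_sub)

section \<open>A type checker for the object theory\<close>

abbreviation obind :: "'a option => ('a => 'b option) => 'b option" where
  "obind m f \<equiv> (case m of None => None | Some x => f x)"

text \<open>The syntax of the checker leaves out the types that the proofs below do not use, and has an
  \<open>is_equiv\<close> (\<open>XEq\<close>), a \<open>mod_map\<close> and a \<open>mod_natural\<close> that are not unfolded.  \<open>XLm j\<close> refers to
  the \<open>j\<close>-th closed term that has already been checked.\<close>

datatype xt =
    XVar nat | XU nat | XPi xt xt | XLam xt xt | XApp xt xt | XSig xt xt | XTup xt xt | XFst xt | XSnd xt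
  | XPath xt xt xt | XRefl xt | XJ xt xt xt xt xt | XUa nat xt xt | XFx xt xt xt xt
  | XEq xt xt xt | XMap xt xt xt xt xt xt | XNat xt xt xt xt xt xt xt | XLm nat

text \<open>A shift by \<open>k\<close> above a cutoff, recursive in unary numbers so that rewriting
  evaluates it without comparing indices.\<close>

primrec shv :: "nat => nat => nat => nat" where
  "shv k 0 n = k + n"
| "shv k (Suc c) n = (case n of 0 => 0 | Suc n => Suc (shv k c n))"

primrec sh :: "nat => nat => xt => xt" where
  "sh k r (XVar n) = XVar (shv k r n)"
| "sh k r (XU i) = XU i"
| "sh k r (XPi A B) = XPi (sh k r A) (sh k (Suc r) B)"
| "sh k r (XLam A b) = XLam (sh k r A) (sh k (Suc r) b)"
| "sh k r (XApp f a) = XApp (sh k r f) (sh k r a)"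
| "sh k r (XSig A B) = XSig (sh k r A) (sh k (Suc r) B)"
| "sh k r (XTup a b) = XTup (sh k r a) (sh k r b)"
| "sh k r (XFst p) = XFst (sh k r p)"
| "sh k r (XSnd p) = XSnd (sh k r p)"
| "sh k r (XPath A a b) = XPath (sh k r A) (sh k r a) (sh k r b)"
| "sh k r (XRefl a) = XRefl (sh k r a)"
| "sh k r (XJ a C c b p) = XJ (sh k r a) (sh k (Suc (Suc r)) C) (sh k r c) (sh k r b) (sh k r p)"
| "sh k r (XUa i A B) = XUa i (sh k r A) (sh k r B)"
| "sh k r (XFx A B f g) = XFx (sh k r A) (sh k (Suc r) B) (sh k r f) (sh k r g)"
| "sh k r (XEq A B f) = XEq (sh k r A) (sh k r B) (sh k r f)"
| "sh k r (XMap Om e m A B f) = XMap (sh k r Om) (sh k r e) (sh k r m) (sh k r A) (sh k r B) (sh k r f)"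
| "sh k r (XNat Om e m A B f a) = XNat (sh k r Om) (sh k r e) (sh k r m) (sh k r A) (sh k r B) (sh k r f) (sh k r a)"
| "sh k r (XLm j) = XLm j"

text \<open>\<open>k\<close> counts the binders already crossed, so the replacement is shifted once,
  when the variable is reached. The inner \<open>case\<close> on \<open>k\<close> saves an identity
  shift.\<close>

primrec sbv :: "nat => nat => xt => nat => xt" where
  "sbv k 0 a n = (case n of 0 => (case k of 0 => a | Suc _ => sh k 0 a) | Suc n => XVar (k + n))"
| "sbv k (Suc c) a n = (case n of 0 => XVar k | Suc n => sbv (Suc k) c a n)"

primrec sb :: "nat => xt => xt => xt" where
  "sb r x (XVar n) = sbv 0 r x n"
| "sb r x (XU i) = XU i"
| "sb r x (XPi A B) = XPi (sb r x A) (sb (Suc r) x B)"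
| "sb r x (XLam A b) = XLam (sb r x A) (sb (Suc r) x b)"
| "sb r x (XApp f a) = XApp (sb r x f) (sb r x a)"
| "sb r x (XSig A B) = XSig (sb r x A) (sb (Suc r) x B)"
| "sb r x (XTup a b) = XTup (sb r x a) (sb r x b)"
| "sb r x (XFst p) = XFst (sb r x p)"
| "sb r x (XSnd p) = XSnd (sb r x p)"
| "sb r x (XPath A a b) = XPath (sb r x A) (sb r x a) (sb r x b)"
| "sb r x (XRefl a) = XRefl (sb r x a)"
| "sb r x (XJ a C c b p) = XJ (sb r x a) (sb (Suc (Suc r)) x C) (sb r x c) (sb r x b) (sb r x p)"
| "sb r x (XUa i A B) = XUa i (sb r x A) (sb r x B)"
| "sb r x (XFx A B f g) = XFx (sb r x A) (sb (Suc r) x B) (sb r x f) (sb r x g)"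
| "sb r x (XEq A B f) = XEq (sb r x A) (sb r x B) (sb r x f)"
| "sb r x (XMap Om e m A B f) = XMap (sb r x Om) (sb r x e) (sb r x m) (sb r x A) (sb r x B) (sb r x f)"
| "sb r x (XNat Om e m A B f a) = XNat (sb r x Om) (sb r x e) (sb r x m) (sb r x A) (sb r x B) (sb r x f) (sb r x a)"
| "sb r x (XLm j) = XLm j"

section \<open>The notions occurring in the rules, in the syntax of the checker\<close>

definition lft :: "nat => xt => xt" where "lft k = sh k 0"
definition ins :: "xt => xt => xt" where "ins b a = sb 0 a b"
definition ins2 :: "xt => xt => xt => xt" where "ins2 C a b = sb 0 a (sb 0 (lft 1 b) C)"
definition fn :: "xt => xt => xt" where "fn A B = XPi A (lft 1 B)"
definition xsec :: "xt => xt => xt => xt" where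
  "xsec A B f = XSig (fn B A) (XPi (lft 1 B) (XPath (lft 2 B) (XApp (lft 2 f) (XApp (XVar 1) (XVar 0))) (XVar 0)))"
definition xretr :: "xt => xt => xt => xt" where
  "xretr A B f = XSig (fn B A) (XPi (lft 1 A) (XPath (lft 2 A) (XApp (XVar 1) (XApp (lft 2 f) (XVar 0))) (XVar 0)))"
definition xequiv :: "xt => xt => xt" where
  "xequiv A B = XSig (fn A B) (XEq (lft 1 A) (lft 1 B) (XVar 0))"
definition xid :: "xt => xt" where
  "xid A = XTup (XLam A (XVar 0)) (XTup (XTup (XLam A (XVar 0)) (XLam A (XRefl (XVar 0)))) (XTup (XLam A (XVar 0)) (XLam A (XRefl (XVar 0)))))"
definition xidtoeqv :: "nat => xt => xt => xt" where
  "xidtoeqv i A B = XLam (XPath (XU i) A B)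
     (XJ (lft 1 A) (xequiv (lft 3 A) (XVar 1)) (xid (lft 1 A)) (lft 1 B) (XVar 0))"
definition xhtpy :: "xt => xt => xt => xt => xt" where
  "xhtpy A B f g = XPi A (XPath B (XApp (lft 1 f) (XVar 0)) (XApp (lft 1 g) (XVar 0)))"
definition xhapply :: "xt => xt => xt => xt => xt" where
  "xhapply A B f g = XLam (XPath (XPi A B) f g)
       (XJ (lft 1 f) (xhtpy (lft 3 A) (sh 3 (Suc 0) B) (lft 3 f) (XVar 1))
          (XLam (lft 1 A) (XRefl (XApp (lft 2 f) (XVar 0)))) (lft 1 g) (XVar 0))"
definition xunit :: "xt => xt" where
  "xunit Om = XPi (XU 0) (fn (XVar 0) (XApp (lft 1 Om) (XVar 0)))"
definition xdom :: "xt => xt => xt => xt" where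
  "xdom Om A P = XPi (XApp Om A) (XApp (lft 1 Om) (XApp (lft 1 P) (XVar 0)))"
definition xcod :: "xt => xt => xt => xt => xt" where
  "xcod Om eta A P = XPi A (XApp (lft 1 Om) (XApp (lft 1 P) (XApp (XApp (lft 1 eta) (lft 1 A)) (XVar 0))))"
definition xpre :: "xt => xt => xt => xt => xt" where
  "xpre Om eta A P = XLam (xdom Om A P) (XLam (lft 1 A) (XApp (XVar 1) (XApp (XApp (lft 2 eta) (lft 2 A)) (XVar 0))))"
definition xmod :: "xt => xt => xt" where
  "xmod Om eta = XPi (XU 0) (XPi (fn (XApp (lft 1 Om) (XVar 0)) (XU 0))
       (XEq (xdom (lft 2 Om) (XVar 1) (XVar 0)) (xcod (lft 2 Om) (lft 2 eta) (XVar 1) (XVar 0))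
         (xpre (lft 2 Om) (lft 2 eta) (XVar 1) (XVar 0))))"

fun asU :: "xt => nat option" where
  "asU (XU i) = Some i" | "asU t = None"
fun asPi :: "xt => (xt \<times> xt) option" where
  "asPi (XPi A B) = Some (A, B)" | "asPi t = None"
text \<open>A folded \<open>is_equiv\<close> is also seen as a sum type, so its components can be
  paired and projected while it stays folded. Soundness is immediate because both forms denote the
  same term.\<close>

fun asSig :: "xt => (xt \<times> xt) option" where
  "asSig (XSig A B) = Some (A, B)" | "asSig (XEq A B f) = Some (xsec A B f, lft 1 (xretr A B f))" | "asSig t = None"
fun asPath :: "xt => (xt \<times> xt \<times> xt) option" where
  "asPath (XPath A a b) = Some (A, a, b)" | "asPath t = None"
fun asEq :: "xt => (xt \<times> xt \<times> xt) option" where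
  "asEq (XEq A B f) = Some (A, B, f)" | "asEq t = None"
fun asJ :: "xt => (xt \<times> xt \<times> xt \<times> xt \<times> xt) option" where
  "asJ (XJ a C c b p) = Some (a, C, c, b, p)" | "asJ t = None"
fun asLam :: "xt => (xt \<times> xt) option" where
  "asLam (XLam A b) = Some (A, b)" | "asLam t = None"
fun asTup :: "xt => (xt \<times> xt) option" where
  "asTup (XTup A b) = Some (A, b)" | "asTup t = None"
fun asRefl :: "xt => xt option" where
  "asRefl (XRefl a) = Some a" | "asRefl t = None"
fun asFst :: "xt => xt option" where
  "asFst (XFst p) = Some p" | "asFst t = None"
fun asSnd :: "xt => xt option" where
  "asSnd (XSnd p) = Some p" | "asSnd t = None"
fun asApp :: "xt => (xt \<times> xt) option" where
  "asApp (XApp f a) = Some (f, a)" | "asApp t = None"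
fun hdf :: "xt => bool" where
  "hdf (XU _) = True" | "hdf (XPi _ _) = True" | "hdf (XSig _ _) = True"
| "hdf (XPath _ _ _) = True" | "hdf (XEq _ _ _) = True" | "hdf t = False"
text \<open>For a tuple, inference can only guess a non-dependent product. A beta-redex ending in a
  tuple is therefore treated in checking mode, where the expected type is known.\<close>

fun tup_body :: "xt => bool" where
  "tup_body (XLam A b) = tup_body b" | "tup_body (XTup a b) = True" | "tup_body t = False"
fun tup_redex :: "xt => bool" where
  "tup_redex (XLam A b) = tup_body b" | "tup_redex (XApp f a) = tup_redex f" | "tup_redex t = False"
text \<open>Heads at which no computation starts; weak head evaluation of such a term only finds its
  type.\<close>

fun neutral :: "xt => bool" where
  "neutral (XVar n) = True" | "neutral (XApp f a) = neutral f" | "neutral (XFst p) = neutral p"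
| "neutral (XSnd p) = neutral p" | "neutral (XLm j) = True" | "neutral (XMap Om e m A B f) = True" | "neutral (XNat Om e m A B f a) = True" | "neutral (XFx A B f g) = True" | "neutral (XUa i A B) = True" | "neutral t = False"
fun hdv :: "xt => xt option" where
  "hdv (XApp f a) = hdv f" | "hdv (XFst p) = hdv p" | "hdv (XSnd p) = hdv p"
| "hdv (XVar n) = Some (XVar n)" | "hdv (XLm j) = Some (XLm j)"
| "hdv (XMap Om e m A B f) = Some (XMap Om e m A B f)" | "hdv t = None"
text \<open>Terms with a common head are compared argument by argument before anything is reduced.
  The choice is final: a failing comparison is not retried after reduction, which costs completeness
  but not soundness.\<close>

definition same_head :: "xt => xt => bool" where
  "same_head u v = (case hdv u of None => False | Some k => (case hdv v of None => False | Some l => if k = l then True else False))"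

primrec look :: "xt list => nat => xt option" where
  "look [] n = None"
| "look (A # G) n = (case n of 0 => Some A | Suc n => look G n)"

text \<open>Every judgment is decided with the help of a runner for smaller fuel, in one of these modes: infer
  a type (\<open>MI\<close>), check against a type (\<open>MC\<close>), weak head normal form together with its type (\<open>MW\<close>) or
  at a given type (\<open>MK\<close>), equality of types (\<open>MT\<close>), of terms at a type (\<open>MM\<close>) and of neutral terms
  (\<open>MS\<close>).  \<open>MF\<close> tells whether the rules for the folded constants are available, \<open>MX\<close> looks up the
  type of an \<open>XLm\<close>.  Conditions are nested ifs because the simplifier evaluates these strictly in order.\<close>

datatype mode = MI | MC | MW | MK | MT | MM | MS | MF | MX

type_synonym runner = "mode => xt list => xt => xt => xt => (xt \<times> xt) option"

definition inf :: "runner => xt list => xt => xt option" where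
  "inf R G t = obind (R MI G t t t) (%(T, _). Some T)"
definition chk :: "runner => xt list => xt => xt => bool" where
  "chk R G t T = (case R MC G t t T of None => False | Some _ => True)"
definition whd :: "runner => xt list => xt => (xt \<times> xt) option" where
  "whd R G t = R MW G t t t"
definition whc :: "runner => xt list => xt => xt => xt option" where
  "whc R G t T = obind (R MK G t t T) (%(t', _). Some t')"
definition eqT :: "runner => xt list => xt => xt => nat option" where
  "eqT R G T T' = obind (R MT G T T' T) (%(K, _). asU K)"
definition eqM :: "runner => xt list => xt => xt => xt => bool" where
  "eqM R G u v A = (case R MM G u v A of None => False | Some _ => True)"
definition flag :: "runner => bool" where
  "flag R = (case R MF [] (XU 0) (XU 0) (XU 0) of None => False | Some _ => True)"
definition libr :: "runner => nat => xt option" where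
  "libr R j = obind (R MX [] (XLm j) (XLm j) (XLm j)) (%(T, _). Some T)"
definition eqS :: "runner => xt list => xt => xt => xt option" where
  "eqS R G u v = obind (R MS G u v u) (%(T, _). Some T)"

definition whn :: "runner => xt list => xt => xt option" where
  "whn R G T = (if hdf T then Some T else obind (whd R G T) (%(T', K). obind (asU K) (%_. Some T')))"
definition toU :: "runner => xt list => xt => nat option" where
  "toU R G T = obind (whn R G T) asU"
definition toPi :: "runner => xt list => xt => (xt \<times> xt) option" where
  "toPi R G T = obind (whn R G T) asPi"
definition toSig :: "runner => xt list => xt => (xt \<times> xt) option" where
  "toSig R G T = obind (whn R G T) asSig"
definition toPath :: "runner => xt list => xt => (xt \<times> xt \<times> xt) option" where
  "toPath R G T = obind (whn R G T) asPath"
definition infU :: "runner => xt list => xt => nat option" where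
  "infU R G t = obind (inf R G t) (%T. toU R G T)"
text \<open>Cumulativity is applied only between literal universes; everywhere else subtyping means
  equality of types.\<close>

definition subt :: "runner => xt list => xt => xt => bool" where
  "subt R G T T' = (if T = T' then True else
     (case asU T of
       Some i => (case asU T' of Some j => i \<le> j | None => (case eqT R G T T' of None => False | Some _ => True))
     | None => (case eqT R G T T' of None => False | Some _ => True)))"
text \<open>The rules for pairs and for \<open>J\<close> need the formation of \<open>B\<close> over
  \<open>A\<close>. It is rechecked here rather than extracted from an earlier derivation.\<close>

definition pair_ok :: "runner => xt list => xt => xt => bool" where
  "pair_ok R G A B = (case infU R G A of None => False | Some _ =>
     (case infU R (A # G) B of None => False | Some _ => True))"

text \<open>For \<open>XJ\<close>, the ambient type \<open>A\<close> is read off the type of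
  \<open>p\<close>; the endpoints stored there may differ from \<open>a\<close> and \<open>b\<close>
  by computation, hence the final \<open>subt\<close>. With the flag off, an \<open>XEq\<close> is
  typed through its unfolding.\<close>

fun infer_step :: "runner => xt list => xt => xt option" where
  "infer_step R G (XVar k) = obind (look G k) (%T. Some (lft (Suc k) T))"
| "infer_step R G (XU i) = Some (XU (Suc i))"
| "infer_step R G (XPi A B) = obind (infU R G A) (%i. obind (infU R (A # G) B) (%j. Some (XU (max i j))))"
| "infer_step R G (XSig A B) = obind (infU R G A) (%i. obind (infU R (A # G) B) (%j. Some (XU (max i j))))"
| "infer_step R G (XLam A b) = obind (infU R G A) (%i. obind (inf R (A # G) b) (%B. Some (XPi A B)))"
| "infer_step R G (XApp f a) = obind (inf R G f) (%F. obind (toPi R G F) (%(A, B).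
      if chk R G a A then Some (ins B a) else None))"
| "infer_step R G (XTup a b) = obind (inf R G a) (%A. obind (inf R G b) (%B.
      if pair_ok R G A (lft 1 B) then Some (XSig A (lft 1 B)) else None))"
| "infer_step R G (XFst p) = obind (inf R G p) (%P. obind (toSig R G P) (%(A, B). Some A))"
| "infer_step R G (XSnd p) = obind (inf R G p) (%P. obind (toSig R G P) (%(A, B). Some (ins B (XFst p))))"
| "infer_step R G (XPath A a b) = obind (infU R G A) (%i. if chk R G a A then
      if chk R G b A then Some (XU i) else None else None)"
| "infer_step R G (XRefl a) = obind (inf R G a) (%A. obind (infU R G A) (%i. Some (XPath A a a)))"
| "infer_step R G (XJ a C c b p) = obind (inf R G p) (%P. obind (toPath R G P) (%(A, _).
      if pair_ok R G A (XPath (lft 1 A) (lft 1 a) (XVar 0)) then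
      obind (infU R (XPath (lft 1 A) (lft 1 a) (XVar 0) # A # G) C) (%k.
      if chk R G a A then if chk R G b A then if chk R G c (ins2 C a (XRefl a)) then
      if subt R G P (XPath A a b) then Some (ins2 C b p) else None else None else None else None)
      else None))"
| "infer_step R G (XUa i A B) = (if chk R G A (XU i) then if chk R G B (XU i) then
      Some (XEq (XPath (XU i) A B) (xequiv A B) (xidtoeqv i A B)) else None else None)"
| "infer_step R G (XFx A B f g) = (if pair_ok R G A B then
      if chk R G f (XPi A B) then if chk R G g (XPi A B) then
      Some (XEq (XPath (XPi A B) f g) (xhtpy A B f g) (xhapply A B f g)) else None else None else None)"
| "infer_step R G (XEq A B f) = (if flag R then obind (infU R G A) (%i. obind (infU R G B) (%j.
      if chk R G f (fn A B) then Some (XU (max i j)) else None))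
      else inf R G (XSig (xsec A B f) (lft 1 (xretr A B f))))"
| "infer_step R G (XMap Om e m A B f) = (if flag R then
      if chk R G Om (fn (XU 0) (XU 0)) then if chk R G e (xunit Om) then if chk R G m (xmod Om e) then
      if chk R G A (XU 0) then if chk R G B (XU 0) then if chk R G f (fn A B) then Some (fn (XApp Om A) (XApp Om B))
      else None else None else None else None else None else None else None)"
| "infer_step R G (XNat Om e m A B f a) = (if flag R then
      if chk R G Om (fn (XU 0) (XU 0)) then if chk R G e (xunit Om) then if chk R G m (xmod Om e) then
      if chk R G A (XU 0) then if chk R G B (XU 0) then if chk R G f (fn A B) then if chk R G a A then
      Some (XPath (XApp Om B) (XApp (XApp e B) (XApp f a)) (XApp (XMap Om e m A B f) (XApp (XApp e A) a)))
      else None else None else None else None else None else None else None else None)"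
| "infer_step R G (XLm j) = libr R j"

definition check_inf :: "runner => xt list => xt => xt => bool" where
  "check_inf R G t T = (case inf R G t of None => False | Some T' => subt R G T' T)"

text \<open>When an explicit pair is projected, the expected type goes to the selected component and
  the other one is inferred. For a redex ending in a tuple, the body is checked against the weakened
  type, which the argument leaves unchanged.\<close>

fun check_step :: "runner => xt list => xt => xt => bool" where
  "check_step R G (XLam A b) T = (case toPi R G T of None => False | Some (A', B) =>
      (case infU R G A of None => False | Some i =>
       if A = A' then chk R (A # G) b B
       else (case eqT R G A A' of None => False | Some _ =>
         (if pair_ok R G A B then chk R (A # G) b B else False))))"
| "check_step R G (XTup a b) T = (case toSig R G T of None => False | Some (A, B) =>
      if chk R G a A then if pair_ok R G A B then chk R G b (ins B a) else False else False)"
| "check_step R G (XRefl a) T = (case toPath R G T of None => False | Some (A, u, v) =>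
      (case infU R G A of None => False | Some i =>
        if eqM R G a u A then eqM R G a v A else False))"
| "check_step R G (XFst p) T = (case asTup p of
        Some (a, b) => if chk R G a T then (case inf R G b of None => False | Some B =>
           pair_ok R G T (lft 1 B)) else False
      | None => check_inf R G (XFst p) T)"
| "check_step R G (XSnd p) T = (case asTup p of
        Some (a, b) => if chk R G b T then (case inf R G a of None => False | Some A =>
           pair_ok R G A (lft 1 T)) else False
      | None => check_inf R G (XSnd p) T)"
| "check_step R G (XApp f a) T = (if tup_redex f then (case asLam f of
         Some (A, b) => (case infU R G A of None => False | Some i =>
           if chk R G a A then chk R (A # G) b (lft 1 T) else False)
       | None => (case inf R G a of None => False | Some A => chk R G f (XPi A (lft 1 T))))
      else check_inf R G (XApp f a) T)"
| "check_step R G t T = check_inf R G t T"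

section \<open>Weak head reduction\<close>

definition whd_beta :: "runner => xt list => xt => xt => xt => (xt \<times> xt) option" where
  "whd_beta R G A b a = obind (infU R G A) (%i. obind (inf R (A # G) b) (%B. if chk R G a A then
        obind (whc R G (ins b a) (ins B a)) (%c. Some (c, ins B a)) else None))"

definition whd_app :: "runner => xt list => xt => xt => (xt \<times> xt) option" where
  "whd_app R G f a = obind (whd R G f) (%(f', F). obind (toPi R G F) (%(A, B).
        if chk R G a A then (case asLam f' of
          Some _ => obind (whc R G (XApp f' a) (ins B a)) (%c. Some (c, ins B a))
        | None => Some (XApp f' a, ins B a)) else None))"

definition whd_fst :: "runner => xt list => xt => (xt \<times> xt) option" where
  "whd_fst R G p = obind (whd R G p) (%(p', P). obind (toSig R G P) (%(A, B).
        case asTup p' of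
          Some (a, b) => if pair_ok R G A B then obind (whc R G a A) (%a'.
             if chk R G b (ins B a) then Some (a', A) else None) else None
        | None => Some (XFst p', A)))"

definition whd_snd :: "runner => xt list => xt => (xt \<times> xt) option" where
  "whd_snd R G p = obind (whd R G p) (%(p', P). obind (toSig R G P) (%(A, B).
        case asTup p' of
          Some (a, b) => if pair_ok R G A B then
             if chk R G a A then obind (whc R G b (ins B a)) (%b'. Some (b', ins B a)) else None else None
        | None => Some (XSnd p', ins B (XFst p))))"

text \<open>A \<open>p\<close> that reduces to some reflexivity is not enough for
  \<open>J_beta\<close>: \<open>b\<close> and \<open>p\<close> must be compared with
  \<open>a\<close> and \<open>XRefl a\<close>, and the type of the redex with the type of the
  result.\<close>

definition whd_j :: "runner => xt list => xt => xt => xt => xt => xt => (xt \<times> xt) option" where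
  "whd_j R G a C c b p = obind (whd R G p) (%(p', P). obind (toPath R G P) (%(A, _).
     if (case asRefl p' of None => False | Some _ => True) then
      if pair_ok R G A (XPath (lft 1 A) (lft 1 a) (XVar 0)) then
        obind (infU R (XPath (lft 1 A) (lft 1 a) (XVar 0) # A # G) C) (%k.
        if chk R G b A then if eqM R G a b A then if chk R G p (XPath A a b) then
        if eqM R G p (XRefl a) (XPath A a b) then if subt R G (ins2 C b p) (ins2 C a (XRefl a)) then
        obind (whc R G c (ins2 C a (XRefl a))) (%c'. Some (c', ins2 C a (XRefl a)))
        else None else None else None else None else None)
      else None
     else obind (inf R G (XJ a C c b p)) (%T. Some (XJ a C c b p, T))))"

definition whd_inf :: "runner => xt list => xt => (xt \<times> xt) option" where
  "whd_inf R G t = obind (inf R G t) (%T. Some (t, T))"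

fun whd_step :: "runner => xt list => xt => (xt \<times> xt) option" where
  "whd_step R G (XApp f a) = (if neutral f then whd_inf R G (XApp f a) else
    (case asLam f of Some (A, b) => whd_beta R G A b a | None => whd_app R G f a))"
| "whd_step R G (XFst p) = (if neutral p then whd_inf R G (XFst p) else
    (case asTup p of
      Some (a, b) => obind (inf R G a) (%A. obind (inf R G b) (%B.
        if pair_ok R G A (lft 1 B) then obind (whc R G a A) (%a'. Some (a', A)) else None))
    | None => whd_fst R G p))"
| "whd_step R G (XSnd p) = (if neutral p then whd_inf R G (XSnd p) else
    (case asTup p of
      Some (a, b) => obind (inf R G a) (%A. obind (inf R G b) (%B.
        if pair_ok R G A (lft 1 B) then obind (whc R G b B) (%b'. Some (b', B)) else None))
    | None => whd_snd R G p))"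
| "whd_step R G (XJ a C c b p) = (if neutral p then whd_inf R G (XJ a C c b p) else whd_j R G a C c b p)"
| "whd_step R G t = whd_inf R G t"

definition whc_inf :: "runner => xt list => xt => xt => xt option" where
  "whc_inf R G t T = obind (whd R G t) (%(t', T'). if subt R G T' T then Some t' else None)"

definition whc_chk :: "runner => xt list => xt => xt => xt option" where
  "whc_chk R G t T = (if chk R G t T then Some t else None)"

definition whc_beta :: "runner => xt list => xt => xt => xt => xt option" where
  "whc_beta R G f a T = (case asLam f of
         Some (A, b) => obind (infU R G A) (%i.
           if chk R G a A then if chk R (A # G) b (lft 1 T) then
             whc R G (ins b a) T else None else None)
       | None => obind (inf R G a) (%A.
           obind (whc R G f (XPi A (lft 1 T))) (%f'.
           obind (asLam f') (%_. whc R G (XApp f' a) T))))"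

fun whc_step :: "runner => xt list => xt => xt => xt option" where
  "whc_step R G (XApp f a) T = (if tup_redex f then whc_beta R G f a T else whc_inf R G (XApp f a) T)"
| "whc_step R G (XFst p) T = (case asTup p of
      Some (a, b) => if chk R G (XFst p) T then obind (inf R G b) (%B.
         if pair_ok R G T (lft 1 B) then whc R G a T else None) else None
    | None => whc_inf R G (XFst p) T)"
| "whc_step R G (XSnd p) T = (case asTup p of
      Some (a, b) => if chk R G (XSnd p) T then obind (inf R G a) (%A.
         if pair_ok R G A (lft 1 T) then whc R G b T else None) else None
    | None => whc_inf R G (XSnd p) T)"
| "whc_step R G (XJ a C c b p) T = whc_inf R G (XJ a C c b p) T"
| "whc_step R G t T = whc_chk R G t T"

text \<open>Keeps the level at which the reduction of a type is an equality; 0 is a dummy value when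
  nothing had to be reduced.\<close>

definition whl :: "runner => xt list => xt => (xt \<times> nat) option" where
  "whl R G T = (if hdf T then Some (T, 0) else obind (whd R G T) (%(T', K). obind (asU K) (%j. Some (T', j))))"
definition eqT_whn :: "runner => xt list => xt => xt => nat option" where
  "eqT_whn R G T T' = (if same_head T T' then obind (eqS R G T T') (%K. toU R G K)
     else obind (whl R G T) (%(T1, j). obind (whl R G T') (%(T2, k).
       if (if T1 = T then if T2 = T' then True else False else False) then None
       else obind (eqT R G T1 T2) (%l. Some (max j (max k l))))))"

definition eqT_sig :: "runner => xt list => xt => xt => nat option" where
  "eqT_sig R G T T' =
     (case asSig T of Some (A, B) => (case asSig T' of Some (A', B') =>
         obind (eqT R G A A') (%i. obind (eqT R (A # G) B B') (%j. Some (max i j))) | None => eqT_whn R G T T')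
     | None => eqT_whn R G T T')"

definition eqT_step :: "runner => xt list => xt => xt => nat option" where
  "eqT_step R G T T' = (if T = T' then infU R G T else
     (case asPi T of Some (A, B) => (case asPi T' of Some (A', B') =>
         obind (eqT R G A A') (%i. obind (eqT R (A # G) B B') (%j. Some (max i j))) | None => eqT_whn R G T T')
     | None => (case asPath T of Some (A, a, b) => (case asPath T' of Some (A', a', b') =>
         obind (eqT R G A A') (%i. if eqM R G a a' A then if eqM R G b b' A then Some i else None else None)
         | None => eqT_whn R G T T')
     | None => (case asEq T of Some (A, B, f) => (case asEq T' of Some (A', B', f') =>
         if flag R then obind (eqT R G A A') (%i. obind (eqT R G B B') (%j. if eqM R G f f' (fn A B) then Some (max i j) else None))
         else eqT_sig R G T T'
         | None => eqT_sig R G T T')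
     | None => eqT_sig R G T T'))))"

definition eqM_j :: "runner => xt list => xt => xt => xt => bool" where
  "eqM_j R G u v T = (case asJ u of None => False | Some (a, C, c, b, p) => (case asJ v of None => False | Some (a', C', c', b', p') =>
     (case obind (inf R G p) (%P. toPath R G P) of None => False | Some (A, _) =>
       if pair_ok R G A (XPath (lft 1 A) (lft 1 a) (XVar 0)) then
       (case eqT R (XPath (lft 1 A) (lft 1 a) (XVar 0) # A # G) C C' of None => False | Some _ =>
         if eqM R G a a' A then if eqM R G b b' A then if eqM R G c c' (ins2 C a (XRefl a)) then
         if eqM R G p p' (XPath A a b) then subt R G (ins2 C b p) T else False else False else False else False) else False)))"

definition eqM_eta1 :: "runner => xt list => xt => xt => xt => xt => bool" where
  "eqM_eta1 R G a b p A = (case toSig R G A of None => False | Some (D, B) =>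
     if pair_ok R G D B then if chk R G p (XSig D B) then
       if eqM R G a (XFst p) D then eqM R G b (XSnd p) (ins B a) else False else False else False)"

definition eqM_eta2 :: "runner => xt list => xt => xt => xt => xt => bool" where
  "eqM_eta2 R G p a b A = (case toSig R G A of None => False | Some (D, B) =>
     if pair_ok R G D B then if chk R G p (XSig D B) then
       if eqM R G (XFst p) a D then eqM R G (XSnd p) b (ins B (XFst p)) else False else False else False)"

text \<open>If reduction changes neither side, what remains is surjective pairing, equality of
  types, or congruence of \<open>XJ\<close>. The test for a change also keeps the recursion from
  repeating itself.\<close>

definition eqM_whn :: "runner => xt list => xt => xt => xt => bool" where
  "eqM_whn R G u v A = (if same_head u v then (case eqS R G u v of None => False | Some T => subt R G T A)
     else (case whc R G u A of None => False | Some u' => (case whc R G v A of None => False | Some v' =>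
       if (if u = u' then if v = v' then True else False else False) then
         (case asTup u of Some (a, b) => eqM_eta1 R G a b v A
         | None => (case asTup v of Some (a, b) => eqM_eta2 R G u a b A
         | None => (if hdf u then (case eqT R G u v of None => False | Some i => subt R G (XU i) A) else eqM_j R G u v A)))
       else eqM R G u' v' A)))"

definition eqM_step :: "runner => xt list => xt => xt => xt => bool" where
  "eqM_step R G u v A = (if u = v then chk R G u A else
     (case asLam u of Some (C, b) => (case asLam v of Some (C', b') =>
         (case toPi R G A of None => False | Some (D, B) => if C = D then
            (case eqT R G C C' of None => False | Some _ => eqM R (C # G) b b' B) else False) | None => eqM_whn R G u v A)
     | None => (case asTup u of Some (a, b) => (case asTup v of Some (a', b') =>
         (case toSig R G A of None => False | Some (D, B) => if pair_ok R G D B then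
            if eqM R G a a' D then eqM R G b b' (ins B a) else False else False) | None => eqM_whn R G u v A)
     | None => (case asRefl u of Some a => (case asRefl v of Some a' =>
         (case toPath R G A of None => False | Some (D, _) => if chk R G u A then
            (case infU R G D of None => False | Some _ => if subt R G (XPath D a a) A then eqM R G a a' D else False) else False) | None => eqM_whn R G u v A)
     | None => eqM_whn R G u v A))))"

definition eqS_step :: "runner => xt list => xt => xt => xt option" where
  "eqS_step R G u v = (if u = v then inf R G u else
     (case asApp u of Some (f, a) => obind (asApp v) (%(f', a').
        obind (eqS R G f f') (%F. obind (toPi R G F) (%(A, B). if eqM R G a a' A then Some (ins B a) else None)))
     | None => (case asFst u of Some p => obind (asFst v) (%p'.
        obind (eqS R G p p') (%P. obind (toSig R G P) (%(A, B). Some A)))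
     | None => obind (asSnd u) (%p. obind (asSnd v) (%p'.
        obind (eqS R G p p') (%P. obind (toSig R G P) (%(A, B). Some (ins B (XFst p)))))))))"

definition step :: "(nat => xt option) => bool => runner => runner" where
  "step L b R d G u v T = (case d of
     MI => obind (infer_step R G u) (%T'. Some (T', T'))
   | MC => if check_step R G u T then Some (u, T) else None
   | MW => whd_step R G u
   | MK => obind (whc_step R G u T) (%t'. Some (t', T))
   | MT => obind (eqT_step R G u v) (%i. Some (XU i, u))
   | MM => if eqM_step R G u v T then Some (u, T) else None
   | MS => obind (eqS_step R G u v) (%T'. Some (T', u))
   | MF => if b then Some (u, u) else None
   | MX => (case u of XLm j => obind (L j) (%T'. Some (T', T')) | _ => None))"

text \<open>Fuel bounds the depth of nested calls and makes the checker total without a termination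
  argument. Exhaustion answers \<open>None\<close>, so only acceptance carries meaning.\<close>

primrec run :: "(nat => xt option) => bool => nat => runner" where
  "run L b 0 = (%d G u v T. None)"
| "run L b (Suc n) = (%d G u v T. step L b (run L b n) d G u v T)"

definition ok :: "(nat => xt option) => bool => nat => xt list => xt => xt => bool" where
  "ok L b n G t T = (case infU (run L b n) G T of None => False | Some _ => chk (run L b n) G t T)"

text \<open>One equation per mode lets rewriting enter the relevant branch at once, without carrying
  the whole case distinction.\<close>

lemma run_MI: "run L b (Suc n) MI G u v T = obind (infer_step (run L b n) G u) (%T'. Some (T', T'))"
  and run_MC: "run L b (Suc n) MC G u v T = (if check_step (run L b n) G u T then Some (u, T) else None)"
  and run_MW: "run L b (Suc n) MW G u v T = whd_step (run L b n) G u"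
  and run_MK: "run L b (Suc n) MK G u v T = obind (whc_step (run L b n) G u T) (%t'. Some (t', T))"
  and run_MT: "run L b (Suc n) MT G u v T = obind (eqT_step (run L b n) G u v) (%i. Some (XU i, u))"
  and run_MM: "run L b (Suc n) MM G u v T = (if eqM_step (run L b n) G u v T then Some (u, T) else None)"
  and run_MS: "run L b (Suc n) MS G u v T = obind (eqS_step (run L b n) G u v) (%T'. Some (T', u))"
  and run_MF: "run L b (Suc n) MF G u v T = (if b then Some (u, u) else None)"
  and run_MX: "run L b (Suc n) MX G (XLm j) v T = obind (L j) (%T'. Some (T', T'))"
  by (simp_all add: step_def)

text \<open>Universe levels are relative to the level \<open>i\<close> of the modality.\<close>

primrec er :: "nat => (nat => tm) => xt => tm" where
  "er i \<sigma> (XVar n) = Var n"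
| "er i \<sigma> (XU k) = Univ (k + i)"
| "er i \<sigma> (XPi A B) = Pi (er i \<sigma> A) (er i \<sigma> B)"
| "er i \<sigma> (XLam A b) = Lam (er i \<sigma> A) (er i \<sigma> b)"
| "er i \<sigma> (XApp f a) = App (er i \<sigma> f) (er i \<sigma> a)"
| "er i \<sigma> (XSig A B) = Sig (er i \<sigma> A) (er i \<sigma> B)"
| "er i \<sigma> (XTup a b) = Tup (er i \<sigma> a) (er i \<sigma> b)"
| "er i \<sigma> (XFst p) = Fst (er i \<sigma> p)"
| "er i \<sigma> (XSnd p) = Snd (er i \<sigma> p)"
| "er i \<sigma> (XPath A a b) = Path (er i \<sigma> A) (er i \<sigma> a) (er i \<sigma> b)"
| "er i \<sigma> (XRefl a) = Refl (er i \<sigma> a)"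
| "er i \<sigma> (XJ a C c b p) = J (er i \<sigma> a) (er i \<sigma> C) (er i \<sigma> c) (er i \<sigma> b) (er i \<sigma> p)"
| "er i \<sigma> (XUa k A B) = Ua (k + i) (er i \<sigma> A) (er i \<sigma> B)"
| "er i \<sigma> (XFx A B f g) = Funext (er i \<sigma> A) (er i \<sigma> B) (er i \<sigma> f) (er i \<sigma> g)"
| "er i \<sigma> (XEq A B f) = is_equiv (er i \<sigma> A) (er i \<sigma> B) (er i \<sigma> f)"
| "er i \<sigma> (XMap Om e m A B f) = mod_map (er i \<sigma> Om) (er i \<sigma> e) (er i \<sigma> m) (er i \<sigma> A) (er i \<sigma> B) (er i \<sigma> f)"
| "er i \<sigma> (XNat Om e m A B f a) =
    mod_natural (er i \<sigma> Om) (er i \<sigma> e) (er i \<sigma> m) (er i \<sigma> A) (er i \<sigma> B) (er i \<sigma> f) (er i \<sigma> a)"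
| "er i \<sigma> (XLm j) = \<sigma> j"

lemma shv_upr: "shv k (Suc c) = upr (shv k c)"
  by (rule ext) (simp split: nat.split)

text \<open>The two assumptions say that the terms standing for \<open>XLm j\<close> are closed,
  matching the fact that \<open>sh\<close> and \<open>sb\<close> leave \<open>XLm j\<close>
  alone.\<close>

locale env =
  fixes i :: nat and \<sigma> :: "nat => tm"
  assumes ren_env: "ren r (\<sigma> j) = \<sigma> j" and sub_env: "sub s (\<sigma> j) = \<sigma> j"
begin

abbreviation "E \<equiv> er i \<sigma>"

lemma er_sh: "E (sh k c t) = ren (shv k c) (E t)"
  by (induction t arbitrary: c) (simp_all del: shv.simps add: shv_upr ren_obj ren_env)

lemma er_lft: "E (lft k t) = lift k (E t)"
proof -
  have "shv k 0 = (%n. n + k)" by (rule ext) simp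
  then show ?thesis by (simp only: lft_def er_sh lift_def)
qed

lemma er_sh1: "E (sh k (Suc 0) t) = lift1 k (E t)"
proof -
  have "shv k 0 = (%n. n + k)" by (rule ext) simp
  then show ?thesis by (simp only: er_sh shv_upr lift1_def)
qed

lemma er_sbv_Suc: "E (sbv (Suc k) c a n) = ren Suc (E (sbv k c a n))"
proof (induction c arbitrary: k n)
  case 0
  have "E (sh (Suc k) 0 a) = ren Suc (E (sh k 0 a))" for k
    using er_lft[of "Suc k" a] er_lft[of k a] by (simp add: lft_def lift_Suc)
  moreover have "E (sh 0 0 a) = E a" using er_lft[of 0 a] by (simp add: lft_def)
  ultimately show ?case by (cases n; cases k) simp_all
qed (simp split: nat.split)

lemma er_sbv_ups: "(%n. E (sbv 0 (Suc c) a n)) = ups (%n. E (sbv 0 c a n))"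
  by (rule ext) (simp add: ups_def er_sbv_Suc split: nat.split)

lemma er_sb: "E (sb c a t) = sub (%n. E (sbv 0 c a n)) (E t)"
  by (induction t arbitrary: c) (simp_all del: sbv.simps add: er_sbv_ups sub_obj sub_env)

lemma er_ins: "E (ins b a) = inst (E b) (E a)"
proof -
  have "(%n. E (sbv 0 0 a n)) = case_nat (E a) Var"
    by (rule ext) (simp split: nat.split)
  then show ?thesis by (simp only: ins_def inst_def er_sb)
qed

lemma er_ins2: "E (ins2 C a b) = inst2 (E C) (E a) (E b)"
  using er_ins[of "sb 0 (lft 1 b) C" a] er_ins[of C "lft 1 b"]
  by (simp only: ins2_def ins_def inst2_inst er_lft)

lemmas er_simps = er.simps er_lft er_sh1 er_ins er_ins2

lemma er_obj:
  "E (fn A B) = Fn (E A) (E B)"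
  "E (xequiv A B) = Equiv (E A) (E B)"
  "E (xid A) = id_equiv (E A)"
  "E (xhtpy A B f g) = Htpy (E A) (E B) (E f) (E g)"
  "E (xunit Om) = unit_type i (E Om)"
  "E (xdom Om A P) = mod_dom (E Om) (E A) (E P)"
  "E (xcod Om e A P) = mod_cod (E Om) (E e) (E A) (E P)"
  "E (xpre Om e A P) = mod_precomp (E Om) (E e) (E A) (E P)"
  by (simp_all add: fn_def xequiv_def xid_def xhtpy_def xunit_def xdom_def xcod_def xpre_def er_simps
     Fn_def Equiv_def id_equiv_def Htpy_def unit_type_def mod_dom_def mod_cod_def mod_precomp_def Let_def del: One_nat_def)

lemma er_sec: "E (xsec A B f) = sec (E A) (E B) (E f)" and er_retr: "E (xretr A B f) = retr (E A) (E B) (E f)"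
  by (simp_all add: xsec_def xretr_def sec_def retr_def er_simps er_obj del: One_nat_def)

lemma er_obj2:
  "E (xidtoeqv k A B) = idtoeqv (k + i) (E A) (E B)"
  "E (xhapply A B f g) = happly (E A) (E B) (E f) (E g)"
  "E (xmod Om e) = is_modality i (E Om) (E e)"
  by (simp_all add: xidtoeqv_def xhapply_def xmod_def idtoeqv_def happly_def is_modality_def er_simps er_obj del: One_nat_def)

lemma is_equiv_sig: "is_equiv (E A) (E B) (E f) = Sig (E (xsec A B f)) (E (lft 1 (xretr A B f)))"
  by (simp only: is_equiv_def Prod_def er_sec er_retr er_lft)

end

section \<open>Soundness of the checker\<close>

lemma drop_ctx_Cons: "(\<And>k. ctx (drop k (A # G))) ==> ctx (drop k G)"
  by (metis drop_Suc_Cons)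

text \<open>Stated for all suffixes because a premise under a binder speaks only of the extended
  context.\<close>

lemma ctx_drop:
  "ctx G ==> ctx (drop k G)"
  "G \<turnstile> t \<Ztypecolon> T ==> ctx (drop k G)"
  "G \<turnstile> t \<doteq> u \<Ztypecolon> T ==> ctx (drop k G)"
proof (induction arbitrary: k and k and k rule: ctx_has_type_jeq.inducts)
  case (ctx_Cons G A i)
  then show ?case by (cases k) (auto intro: ctx_has_type_jeq.ctx_Cons)
qed (auto intro: ctx_Nil drop_ctx_Cons)

lemma ctx_of: "G \<turnstile> t \<Ztypecolon> T ==> ctx G" "G \<turnstile> t \<doteq> u \<Ztypecolon> T ==> ctx G"
  using ctx_drop(2,3)[where k = 0] by simp_all

lemma cumul: "G \<turnstile> A \<Ztypecolon> Univ i ==> i \<le> j ==> G \<turnstile> A \<Ztypecolon> Univ j"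
  by (induction j) (auto intro: ty_Cumul elim: le_SucE)
lemma cumul_eq: "G \<turnstile> A \<doteq> B \<Ztypecolon> Univ i ==> i \<le> j ==> G \<turnstile> A \<doteq> B \<Ztypecolon> Univ j"
  by (induction j) (auto intro: eq_Cumul elim: le_SucE)

lemma look_D: "look G n = Some T ==> n < length G \<and> G ! n = T"
  by (induction G arbitrary: n) (auto split: nat.splits)

lemma inst_Univ: "inst (Univ i) a = Univ i" by (simp add: inst_def)

text \<open>Substitution respects judgmental equality, because a beta-redex does.\<close>

lemma inst_cong:
  assumes B: "A # G \<turnstile> B \<Ztypecolon> Univ i" and a: "G \<turnstile> a \<Ztypecolon> A" and b: "G \<turnstile> b \<Ztypecolon> A" and eq: "G \<turnstile> a \<doteq> b \<Ztypecolon> A"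
  shows "G \<turnstile> inst B a \<doteq> inst B b \<Ztypecolon> Univ i"
proof -
  have "G \<turnstile> App (Lam A B) a \<doteq> App (Lam A B) b \<Ztypecolon> Univ i"
    using eq_App[OF eq_Refl[OF ty_Lam[OF B]] eq] by (simp add: inst_Univ)
  moreover have "G \<turnstile> App (Lam A B) a \<doteq> inst B a \<Ztypecolon> Univ i" "G \<turnstile> App (Lam A B) b \<doteq> inst B b \<Ztypecolon> Univ i"
    using Pi_beta[OF B a] Pi_beta[OF B b] by (simp_all add: inst_Univ)
  ultimately show ?thesis by (meson eq_Sym eq_Trans)
qed

text \<open>The rules for the folded constants.  They are proved by a run of the checker without them.\<close>

definition derived :: "nat => bool" where
  "derived i \<longleftrightarrow>
    (\<forall>G A B f j. G \<turnstile> A \<Ztypecolon> Univ j \<longrightarrow> G \<turnstile> B \<Ztypecolon> Univ j \<longrightarrow> G \<turnstile> f \<Ztypecolon> Fn A B \<longrightarrow> G \<turnstile> is_equiv A B f \<Ztypecolon> Univ j) \<and>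
    (\<forall>G A B f A' B' f' j. G \<turnstile> A \<doteq> A' \<Ztypecolon> Univ j \<longrightarrow> G \<turnstile> B \<doteq> B' \<Ztypecolon> Univ j \<longrightarrow> G \<turnstile> f \<doteq> f' \<Ztypecolon> Fn A B \<longrightarrow>
      G \<turnstile> A \<Ztypecolon> Univ j \<longrightarrow> G \<turnstile> B \<Ztypecolon> Univ j \<longrightarrow> G \<turnstile> f \<Ztypecolon> Fn A B \<longrightarrow>
      G \<turnstile> is_equiv A B f \<doteq> is_equiv A' B' f' \<Ztypecolon> Univ j) \<and>
    (\<forall>G Om e m A B f. G \<turnstile> Om \<Ztypecolon> Fn (Univ i) (Univ i) \<longrightarrow> G \<turnstile> e \<Ztypecolon> unit_type i Om \<longrightarrow> G \<turnstile> m \<Ztypecolon> is_modality i Om e \<longrightarrow>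
      G \<turnstile> A \<Ztypecolon> Univ i \<longrightarrow> G \<turnstile> B \<Ztypecolon> Univ i \<longrightarrow> G \<turnstile> f \<Ztypecolon> Fn A B \<longrightarrow>
      G \<turnstile> mod_map Om e m A B f \<Ztypecolon> Fn (App Om A) (App Om B) \<and>
      (\<forall>a. G \<turnstile> a \<Ztypecolon> A \<longrightarrow> G \<turnstile> mod_natural Om e m A B f a
         \<Ztypecolon> Path (App Om B) (App (App e B) (App f a)) (App (mod_map Om e m A B f) (App (App e A) a))))"

lemma derivedD:
  assumes "derived i"
  shows "G \<turnstile> A \<Ztypecolon> Univ j ==> G \<turnstile> B \<Ztypecolon> Univ j ==> G \<turnstile> f \<Ztypecolon> Fn A B ==> G \<turnstile> is_equiv A B f \<Ztypecolon> Univ j"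
    and "G \<turnstile> A \<doteq> A' \<Ztypecolon> Univ j ==> G \<turnstile> B \<doteq> B' \<Ztypecolon> Univ j ==> G \<turnstile> f \<doteq> f' \<Ztypecolon> Fn A B ==>
      G \<turnstile> A \<Ztypecolon> Univ j ==> G \<turnstile> B \<Ztypecolon> Univ j ==> G \<turnstile> f \<Ztypecolon> Fn A B ==>
      G \<turnstile> is_equiv A B f \<doteq> is_equiv A' B' f' \<Ztypecolon> Univ j"
    and "G \<turnstile> Om \<Ztypecolon> Fn (Univ i) (Univ i) ==> G \<turnstile> e \<Ztypecolon> unit_type i Om ==> G \<turnstile> m \<Ztypecolon> is_modality i Om e ==>
      G \<turnstile> A \<Ztypecolon> Univ i ==> G \<turnstile> B \<Ztypecolon> Univ i ==> G \<turnstile> f \<Ztypecolon> Fn A B ==>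
      G \<turnstile> mod_map Om e m A B f \<Ztypecolon> Fn (App Om A) (App Om B)"
    and "G \<turnstile> Om \<Ztypecolon> Fn (Univ i) (Univ i) ==> G \<turnstile> e \<Ztypecolon> unit_type i Om ==> G \<turnstile> m \<Ztypecolon> is_modality i Om e ==>
      G \<turnstile> A \<Ztypecolon> Univ i ==> G \<turnstile> B \<Ztypecolon> Univ i ==> G \<turnstile> f \<Ztypecolon> Fn A B ==> G \<turnstile> a \<Ztypecolon> A ==>
      G \<turnstile> mod_natural Om e m A B f a
         \<Ztypecolon> Path (App Om B) (App (App e B) (App f a)) (App (mod_map Om e m A B f) (App (App e A) a))"
  using assms by (simp_all add: derived_def)

lemma asU_D: "asU t = Some i ==> t = XU i" by (cases t) auto
lemma asPi_D: "asPi t = Some (A, B) ==> t = XPi A B" by (cases t) auto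
lemma asPath_D: "asPath t = Some (A, a, b) ==> t = XPath A a b" by (cases t) auto
lemma asEq_D: "asEq t = Some (A, B, f) ==> t = XEq A B f" by (cases t) auto
lemma asJ_D: "asJ t = Some (a, C, c, b, p) ==> t = XJ a C c b p" by (cases t) auto
lemma asLam_D: "asLam t = Some (A, b) ==> t = XLam A b" by (cases t) auto
lemma asTup_D: "asTup t = Some (A, b) ==> t = XTup A b" by (cases t) auto
lemma asApp_D: "asApp t = Some (f, a) ==> t = XApp f a" by (cases t) auto
lemma asFst_D: "asFst t = Some p ==> t = XFst p" by (cases t) auto
lemma asSnd_D: "asSnd t = Some p ==> t = XSnd p" by (cases t) auto

context env
begin

definition cx :: "xt list => bool" where "cx G \<longleftrightarrow> ctx (map E G)"
definition wt :: "xt list => xt => xt => bool" where "wt G t T \<longleftrightarrow> map E G \<turnstile> E t \<Ztypecolon> E T"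
definition we :: "xt list => xt => xt => xt => bool" where "we G t u T \<longleftrightarrow> map E G \<turnstile> E t \<doteq> E u \<Ztypecolon> E T"
text \<open>The first disjunct covers types that were not reduced or differ only by folding: for
  these no universe level has been established, yet judgments can be moved across.\<close>

definition te :: "xt list => xt => xt => bool" where "te G A B \<longleftrightarrow> E A = E B \<or> (\<exists>k. we G A B (XU k))"

lemmas xd = cx_def wt_def we_def list.map er_simps er_obj er_obj2

lemma asSig_D: "asSig t = Some (A, B) ==> E t = E (XSig A B)"
  by (cases t) (auto simp: is_equiv_sig)

lemma wt_cx: "wt G t T ==> cx G" and we_cx: "we G t u T ==> cx G"
  unfolding xd by (fact ctx_of)+

lemma x_Cons: "wt G A (XU k) ==> cx (A # G)" unfolding xd by (rule ctx_Cons)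
lemma x_cumul: "wt G A (XU j) ==> j \<le> k ==> wt G A (XU k)" unfolding xd by (erule cumul) simp
lemma x_cumul_eq: "we G A B (XU j) ==> j \<le> k ==> we G A B (XU k)" unfolding xd by (erule cumul_eq) simp
lemma x_Var: "look G n = Some T ==> cx G ==> wt G (XVar n) (lft (Suc n) T)"
  using ty_Var[of "map E G" n] by (auto simp: xd dest: look_D)
lemma x_Univ: "cx G ==> wt G (XU k) (XU (Suc k))" unfolding xd add_Suc by (rule ty_Univ)
lemma x_Conv: "wt G a A ==> we G A B (XU k) ==> wt G a B" unfolding xd by (rule ty_Conv)
lemma x_Convq: "we G a b A ==> we G A B (XU k) ==> we G a b B" unfolding xd by (rule eq_Conv)
lemma x_refl: "wt G a A ==> we G a a A" unfolding xd by (rule eq_Refl)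
lemma x_sym: "we G a b A ==> we G b a A" unfolding xd by (rule eq_Sym)
lemma x_trans: "we G a b A ==> we G b c A ==> we G a c A" unfolding xd by (rule eq_Trans)
lemma x_Lam: "wt (A # G) b B ==> wt G (XLam A b) (XPi A B)" unfolding xd by (rule ty_Lam)
lemma x_App: "wt G f (XPi A B) ==> wt G a A ==> wt G (XApp f a) (ins B a)" unfolding xd by (rule ty_App)
lemma x_Pi_beta: "wt (A # G) b B ==> wt G a A ==> we G (XApp (XLam A b) a) (ins b a) (ins B a)"
  unfolding xd by (rule Pi_beta)
lemma x_eq_Lam: "we G A A' (XU k) ==> we (A # G) b b' B ==> we G (XLam A b) (XLam A' b') (XPi A B)"
  unfolding xd by (rule eq_Lam)
lemma x_eq_App: "we G f f' (XPi A B) ==> we G a a' A ==> we G (XApp f a) (XApp f' a') (ins B a)"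
  unfolding xd by (rule eq_App)
lemma x_Tup: "wt (A # G) B (XU k) ==> wt G a A ==> wt G b (ins B a) ==> wt G (XTup a b) (XSig A B)"
  unfolding xd by (rule ty_Tup)
lemma x_Fst: "wt G p (XSig A B) ==> wt G (XFst p) A" unfolding xd by (rule ty_Fst)
lemma x_Snd: "wt G p (XSig A B) ==> wt G (XSnd p) (ins B (XFst p))" unfolding xd by (rule ty_Snd)
lemma x_Sig_beta1: "wt (A # G) B (XU k) ==> wt G a A ==> wt G b (ins B a) ==> we G (XFst (XTup a b)) a A"
  unfolding xd by (rule Sig_beta1)
lemma x_Sig_beta2: "wt (A # G) B (XU k) ==> wt G a A ==> wt G b (ins B a) ==> we G (XSnd (XTup a b)) b (ins B a)"
  unfolding xd by (rule Sig_beta2)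
lemma x_Sig_eta: "wt G p (XSig A B) ==> we G p (XTup (XFst p) (XSnd p)) (XSig A B)" unfolding xd by (rule Sig_eta)
lemma x_eq_Tup: "wt (A # G) B (XU k) ==> we G a a' A ==> we G b b' (ins B a) ==> we G (XTup a b) (XTup a' b') (XSig A B)"
  unfolding xd by (rule eq_Tup)
lemma x_eq_Fst: "we G p p' (XSig A B) ==> we G (XFst p) (XFst p') A" unfolding xd by (rule eq_Fst)
lemma x_eq_Snd: "we G p p' (XSig A B) ==> we G (XSnd p) (XSnd p') (ins B (XFst p))" unfolding xd by (rule eq_Snd)
lemma x_Path: "wt G A (XU k) ==> wt G a A ==> wt G b A ==> wt G (XPath A a b) (XU k)" unfolding xd by (rule ty_Path)
lemma x_Refl: "wt G A (XU k) ==> wt G a A ==> wt G (XRefl a) (XPath A a a)" unfolding xd by (rule ty_Refl)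
lemma x_J: "wt (XPath (lft 1 A) (lft 1 a) (XVar 0) # A # G) C (XU k) ==> wt G a A ==>
    wt G c (ins2 C a (XRefl a)) ==> wt G b A ==> wt G p (XPath A a b) ==> wt G (XJ a C c b p) (ins2 C b p)"
  unfolding xd by (rule ty_J)
lemma x_J_beta: "wt (XPath (lft 1 A) (lft 1 a) (XVar 0) # A # G) C (XU k) ==> wt G a A ==>
    wt G c (ins2 C a (XRefl a)) ==> we G (XJ a C c a (XRefl a)) c (ins2 C a (XRefl a))"
  unfolding xd by (rule J_beta)
lemma x_eq_Path: "we G A A' (XU k) ==> we G a a' A ==> we G b b' A ==> we G (XPath A a b) (XPath A' a' b') (XU k)"
  unfolding xd by (rule eq_Path)
lemma x_eq_Refl: "wt G A (XU k) ==> we G a a' A ==> we G (XRefl a) (XRefl a') (XPath A a a)" unfolding xd by (rule eq_ReflI)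
lemma x_eq_J: "we (XPath (lft 1 A) (lft 1 a) (XVar 0) # A # G) C C' (XU k) ==> we G a a' A ==>
    we G c c' (ins2 C a (XRefl a)) ==> we G b b' A ==> we G p p' (XPath A a b) ==>
    we G (XJ a C c b p) (XJ a' C' c' b' p') (ins2 C b p)"
  unfolding xd by (rule eq_J)
lemma x_Ua: "wt G A (XU k) ==> wt G B (XU k) ==> wt G (XUa k A B) (XEq (XPath (XU k) A B) (xequiv A B) (xidtoeqv k A B))"
  unfolding xd by (rule ty_Ua)
lemma x_Funext: "wt G A (XU k) ==> wt (A # G) B (XU k) ==> wt G f (XPi A B) ==> wt G g (XPi A B) ==>
    wt G (XFx A B f g) (XEq (XPath (XPi A B) f g) (xhtpy A B f g) (xhapply A B f g))"
  unfolding xd by (rule ty_Funext)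

lemma x_Pi0: "wt G A (XU k) ==> wt (A # G) B (XU k) ==> wt G (XPi A B) (XU k)" unfolding xd by (rule ty_Pi)
lemma x_Sig0: "wt G A (XU k) ==> wt (A # G) B (XU k) ==> wt G (XSig A B) (XU k)" unfolding xd by (rule ty_Sig)
lemma x_eq_Pi0: "we G A A' (XU k) ==> we (A # G) B B' (XU k) ==> we G (XPi A B) (XPi A' B') (XU k)"
  unfolding xd by (rule eq_Pi)
lemma x_eq_Sig0: "we G A A' (XU k) ==> we (A # G) B B' (XU k) ==> we G (XSig A B) (XSig A' B') (XU k)"
  unfolding xd by (rule eq_Sig)
lemma x_Pi: "wt G A (XU j) ==> wt (A # G) B (XU k) ==> wt G (XPi A B) (XU (max j k))"
  by (meson x_cumul x_Pi0 max.cobounded1 max.cobounded2)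
lemma x_Sig: "wt G A (XU j) ==> wt (A # G) B (XU k) ==> wt G (XSig A B) (XU (max j k))"
  by (meson x_cumul x_Sig0 max.cobounded1 max.cobounded2)
lemma x_eq_Pi: "we G A A' (XU j) ==> we (A # G) B B' (XU k) ==> we G (XPi A B) (XPi A' B') (XU (max j k))"
  by (meson x_cumul_eq x_eq_Pi0 max.cobounded1 max.cobounded2)
lemma x_eq_Sig: "we G A A' (XU j) ==> we (A # G) B B' (XU k) ==> we G (XSig A B) (XSig A' B') (XU (max j k))"
  by (meson x_cumul_eq x_eq_Sig0 max.cobounded1 max.cobounded2)

lemma x_Eq: "derived i ==> wt G A (XU k) ==> wt G B (XU k) ==> wt G f (fn A B) ==> wt G (XEq A B f) (XU k)"
  unfolding xd by (rule derivedD)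
lemma x_eq_Eq: "derived i ==> we G A A' (XU k) ==> we G B B' (XU k) ==> we G f f' (fn A B) ==>
    wt G A (XU k) ==> wt G B (XU k) ==> wt G f (fn A B) ==> we G (XEq A B f) (XEq A' B' f') (XU k)"
  unfolding xd by (rule derivedD)
lemma x_Map: "derived i ==> wt G Om (fn (XU 0) (XU 0)) ==> wt G e (xunit Om) ==> wt G m (xmod Om e) ==>
    wt G A (XU 0) ==> wt G B (XU 0) ==> wt G f (fn A B) ==> wt G (XMap Om e m A B f) (fn (XApp Om A) (XApp Om B))"
  unfolding xd add_0 by (rule derivedD)
lemma x_Nat: "derived i ==> wt G Om (fn (XU 0) (XU 0)) ==> wt G e (xunit Om) ==> wt G m (xmod Om e) ==>
    wt G A (XU 0) ==> wt G B (XU 0) ==> wt G f (fn A B) ==> wt G a A ==> wt G (XNat Om e m A B f a)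
      (XPath (XApp Om B) (XApp (XApp e B) (XApp f a)) (XApp (XMap Om e m A B f) (XApp (XApp e A) a)))"
  unfolding xd add_0 by (rule derivedD)

lemma te_wt: "wt G t A ==> te G A B ==> wt G t B"
  and te_we: "we G t u A ==> te G A B ==> we G t u B"
  and te_sym: "te G A B ==> te G B A"
  and te_refl: "te G A A"
  by (auto simp: te_def intro: x_Conv x_Convq x_sym) (simp_all add: wt_def we_def)
lemma te_trans: "te G A B ==> E B = E C ==> te G A C" by (simp add: te_def we_def)

lemma ins_lft [simp]: "E (ins (lft (Suc 0) T) a) = E T"
  by (metis er_ins er_lft inst_lift One_nat_def)
lemma wt_ins_lft: "wt G t (ins (lft 1 T) a) = wt G t T" and we_ins_lft: "we G t u (ins (lft 1 T) a) = we G t u T"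
  by (simp_all add: wt_def we_def)

lemma x_ins_cong: "wt (A # G) B (XU k) ==> wt G a A ==> wt G b A ==> we G a b A ==> we G (ins B a) (ins B b) (XU k)"
  unfolding xd by (rule inst_cong)

text \<open>\<open>eq_Snd\<close> leaves the type at a first projection; since substitution respects
  equality, that type can be moved to \<open>a\<close>.\<close>

lemma Snd_Tup_eq:
  assumes p: "we G p (XTup a b) (XSig A B)" and B: "wt (A # G) B (XU k)"
    and a: "wt G a A" and b: "wt G b (ins B a)"
  shows "we G (XSnd p) b (ins B a)"
proof -
  have t: "wt G (XTup a b) (XSig A B)" using x_Tup[OF B a b] .
  have "we G (XSnd (XTup a b)) (XSnd p) (ins B (XFst (XTup a b)))"
    by (rule x_eq_Snd) (rule x_sym[OF p])
  moreover have "we G (ins B (XFst (XTup a b))) (ins B a) (XU k)"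
    by (rule x_ins_cong[OF B x_Fst[OF t] a x_Sig_beta1[OF B a b]])
  ultimately have "we G (XSnd (XTup a b)) (XSnd p) (ins B a)" by (rule x_Convq)
  then show ?thesis using x_Sig_beta2[OF B a b] by (meson x_sym x_trans)
qed

lemma Fst_Tup_eq:
  assumes p: "we G p (XTup a b) (XSig A B)" and B: "wt (A # G) B (XU k)"
    and a: "wt G a A" and b: "wt G b (ins B a)"
  shows "we G (XFst p) a A"
  using x_eq_Fst[OF p] x_Sig_beta1[OF B a b] by (rule x_trans)

text \<open>\<open>eq_J\<close> takes its type from the left-hand term, so it is applied from
  \<open>a\<close> and reflexivity towards \<open>b\<close> and \<open>p\<close>, after
  \<open>p\<close> has been moved into the type of loops at \<open>a\<close>.\<close>

lemma J_Refl_eq: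
  assumes C: "wt (XPath (lft 1 A) (lft 1 a) (XVar 0) # A # G) C (XU k)" and A: "wt G A (XU j)"
    and a: "wt G a A" and c: "wt G c (ins2 C a (XRefl a))" and ab: "we G a b A"
    and p: "we G p (XRefl a) (XPath A a b)"
  shows "we G (XJ a C c b p) c (ins2 C a (XRefl a))"
proof -
  have "we G (XPath A a b) (XPath A a a) (XU j)"
    by (rule x_eq_Path[OF x_refl[OF A] x_refl[OF a] x_sym[OF ab]])
  then have "we G (XRefl a) p (XPath A a a)" using p by (meson x_Convq x_sym)
  then have "we G (XJ a C c a (XRefl a)) (XJ a C c b p) (ins2 C a (XRefl a))"
    by (rule x_eq_J[OF x_refl[OF C] x_refl[OF a] x_refl[OF c] ab])
  then show ?thesis using x_J_beta[OF C a c] by (meson x_sym x_trans)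
qed

definition valid :: "(nat => xt option) => bool" where
  "valid L \<longleftrightarrow> (\<forall>j T G. L j = Some T \<longrightarrow> ctx G \<longrightarrow> G \<turnstile> \<sigma> j \<Ztypecolon> E T)"

text \<open>The equality modes also promise a typed left-hand side, which spares their callers a
  separate check. In mode \<open>MT\<close> the answer \<open>XU k\<close> encodes a level.\<close>

definition sound :: "runner => bool" where
  "sound R \<longleftrightarrow> (\<forall>G u v T r s. cx G \<longrightarrow>
     (R MI G u v T = Some (r, s) \<longrightarrow> wt G u r) \<and>
     (R MC G u v T = Some (r, s) \<longrightarrow> wt G u T) \<and>
     (R MW G u v T = Some (r, s) \<longrightarrow> wt G u s \<and> we G u r s) \<and>
     (R MK G u v T = Some (r, s) \<longrightarrow> wt G u T \<and> we G u r T) \<and>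
     (R MT G u v T = Some (r, s) \<longrightarrow> (\<forall>k. r = XU k \<longrightarrow> wt G u (XU k) \<and> we G u v (XU k))) \<and>
     (R MM G u v T = Some (r, s) \<longrightarrow> wt G u T \<and> we G u v T) \<and>
     (R MS G u v T = Some (r, s) \<longrightarrow> wt G u r \<and> we G u v r)) \<and>
     (flag R \<longrightarrow> derived i) \<and> valid (libr R)"

end

text \<open>The assumption is the induction hypothesis on fuel: recursive calls go to a sound
  runner.\<close>

locale sound_runner = env +
  fixes R assumes sound: "sound R"
begin

lemma infD: "inf R G t = Some T ==> cx G ==> wt G t T"
  using sound by (auto simp: inf_def sound_def split: option.splits)
lemma chkD: "chk R G t T ==> cx G ==> wt G t T"
  using sound by (auto simp: chk_def sound_def split: option.splits)
lemma whdT: "whd R G t = Some (t', T) ==> cx G ==> wt G t T"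
  and whdD: "whd R G t = Some (t', T) ==> cx G ==> we G t t' T"
  using sound by (auto simp: whd_def sound_def split: option.splits)
lemma whcT: "whc R G t T = Some t' ==> cx G ==> wt G t T"
  and whcD: "whc R G t T = Some t' ==> cx G ==> we G t t' T"
  using sound by (auto simp: whc_def sound_def split: option.splits)
lemma eqTT: "eqT R G A B = Some k ==> cx G ==> wt G A (XU k)"
  and eqTD: "eqT R G A B = Some k ==> cx G ==> we G A B (XU k)"
  using sound by (auto simp: eqT_def sound_def dest!: asU_D split: option.splits)
lemma eqMT: "eqM R G u v A ==> cx G ==> wt G u A"
  and eqMD: "eqM R G u v A ==> cx G ==> we G u v A"
  using sound by (auto simp: eqM_def sound_def split: option.splits)
lemma eqST: "eqS R G u v = Some A ==> cx G ==> wt G u A"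
  and eqSD: "eqS R G u v = Some A ==> cx G ==> we G u v A"
  using sound by (auto simp: eqS_def sound_def split: option.splits)
lemma flagD: "flag R ==> derived i" using sound by (simp add: sound_def)
lemma librD: "libr R j = Some T ==> cx G ==> wt G (XLm j) T"
  using sound by (auto simp: sound_def valid_def wt_def cx_def)

lemma whnD: "whn R G T = Some T' ==> cx G ==> te G T T'"
  by (auto simp: whn_def te_def dest!: whdD asU_D split: option.splits prod.splits if_splits)
lemma toUD: "toU R G T = Some k ==> cx G ==> te G T (XU k)"
  by (auto simp: toU_def dest!: asU_D whnD split: option.splits prod.splits)
lemma toPiD: "toPi R G T = Some (A, B) ==> cx G ==> te G T (XPi A B)"
  by (auto simp: toPi_def dest!: whnD asPi_D split: option.splits)
lemma toSigD: "toSig R G T = Some (A, B) ==> cx G ==> te G T (XSig A B)"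
  by (auto simp: toSig_def dest!: whnD split: option.splits intro: te_trans[OF _ asSig_D])
lemma toPathD: "toPath R G T = Some (A, a, b) ==> cx G ==> te G T (XPath A a b)"
  by (auto simp: toPath_def dest!: whnD asPath_D split: option.splits)
lemma infUD: "infU R G t = Some k ==> cx G ==> wt G t (XU k)"
  by (auto simp: infU_def dest!: infD toUD intro: te_wt split: option.splits)

lemma subt_cases: "subt R G A B ==> cx G ==> te G A B \<or> (\<exists>j k. A = XU j \<and> B = XU k \<and> j \<le> k)"
  by (auto simp: subt_def te_def dest!: asU_D eqTD split: option.splits if_splits)
lemma subt_ty: "subt R G A B ==> wt G t A ==> wt G t B"
  using subt_cases[of G A B] by (auto intro: te_wt x_cumul dest: wt_cx)
lemma subt_eq: "subt R G A B ==> we G t u A ==> we G t u B"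
  using subt_cases[of G A B] by (auto intro: te_we x_cumul_eq dest: we_cx)

lemma pair_okD: "pair_ok R G A B ==> cx G ==>
    (\<exists>k. wt G A (XU k) \<and> wt (A # G) B (XU k)) \<and> cx (B # A # G)"
proof -
  assume "pair_ok R G A B" and c: "cx G"
  then obtain i j where "infU R G A = Some i" and j: "infU R (A # G) B = Some j"
    by (auto simp: pair_ok_def split: option.splits)
  then have A: "wt G A (XU i)" using c by (blast intro: infUD)
  then have B: "wt (A # G) B (XU j)" using j by (blast intro: infUD x_Cons)
  from A B show ?thesis by (meson x_cumul x_Cons max.cobounded1 max.cobounded2)
qed

lemma infer_stepD:
  assumes t: "infer_step R G t = Some T" and c: "cx G"
  shows "wt G t T"
proof (cases t)
  case (XVar n)
  with t c show ?thesis by (auto intro: x_Var split: option.splits)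
next
  case (XU i)
  with t c show ?thesis by (auto intro: x_Univ)
next
  case (XPi A B)
  with t c show ?thesis
    by (auto simp: infUD x_Cons intro!: x_Pi split: option.splits) (meson infUD x_Cons)
next
  case (XSig A B)
  with t c show ?thesis
    by (auto simp: infUD x_Cons intro!: x_Sig split: option.splits) (meson infUD x_Cons)
next
  case (XLam A b)
  with t c show ?thesis
    by (auto intro!: x_Lam infD elim!: infUD[THEN x_Cons] split: option.splits)
next
  case (XApp f a)
  with t c show ?thesis
    by (auto dest!: infD toPiD chkD intro!: x_App elim: te_wt split: option.splits if_splits)
next
  case (XTup a b)
  with t obtain A B where ab: "inf R G a = Some A" "inf R G b = Some B" "pair_ok R G A (lft 1 B)"
      and T: "T = XSig A (lft 1 B)"
    by (auto split: option.splits if_splits)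
  from pair_okD[OF ab(3) c] obtain k where "wt (A # G) (lft 1 B) (XU k)" by blast
  with infD[OF ab(1) c] infD[OF ab(2) c] show ?thesis
    unfolding T XTup by (auto intro!: x_Tup simp only: wt_ins_lft)
next
  case (XFst p)
  with t c show ?thesis
    by (auto dest!: infD toSigD intro!: x_Fst elim: te_wt split: option.splits)
next
  case (XSnd p)
  with t c show ?thesis
    by (auto dest!: infD toSigD intro!: x_Snd elim: te_wt split: option.splits)
next
  case (XPath A a b)
  with t c show ?thesis by (auto dest!: infUD chkD intro!: x_Path split: option.splits if_splits)
next
  case (XRefl a)
  with t c show ?thesis by (auto dest!: infUD infD intro!: x_Refl split: option.splits if_splits)
next
  case (XJ a C d b p)
  let ?Q = "%A. XPath (lft 1 A) (lft 1 a) (XVar 0)"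
  from XJ t obtain P A u k where *: "inf R G p = Some P" "toPath R G P = Some (A, u)"
      "pair_ok R G A (?Q A)" "infU R (?Q A # A # G) C = Some k" "chk R G a A" "chk R G b A"
      "chk R G d (ins2 C a (XRefl a))" "subt R G P (XPath A a b)" and T: "T = ins2 C b p"
    by (auto split: option.splits if_splits prod.splits)
  from pair_okD[OF *(3) c] have "cx (?Q A # A # G)" by blast
  then have "wt (?Q A # A # G) C (XU k)" using *(4) by (blast intro: infUD)
  then show ?thesis unfolding XJ T
    by (rule x_J) (use * c in \<open>blast intro: chkD subt_ty infD\<close>)+
next
  case (XUa i A B)
  with t c show ?thesis by (auto dest!: chkD intro!: x_Ua split: if_splits)
next
  case (XFx A B f g)
  with t c show ?thesis
    by (auto dest!: chkD pair_okD intro!: x_Funext split: if_splits)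
next
  case (XEq A B f)
  show ?thesis
  proof (cases "flag R")
    case True
    with t XEq obtain j k where *: "infU R G A = Some j" "infU R G B = Some k" "chk R G f (fn A B)"
        and T: "T = XU (max j k)"
      by (auto split: option.splits if_splits)
    then have "wt G A (XU (max j k))" "wt G B (XU (max j k))" "wt G f (fn A B)"
      using c by (meson infUD chkD x_cumul max.cobounded1 max.cobounded2)+
    then show ?thesis using x_Eq[OF flagD[OF True]] unfolding T XEq by blast
  next
    case False
    with t XEq have "wt G (XSig (xsec A B f) (lft 1 (xretr A B f))) T" using c by (auto intro: infD)
    then show ?thesis by (simp only: XEq wt_def er.simps is_equiv_sig)
  qed
next
  case (XMap Om e m A B f)
  with t have f: "flag R" and *: "chk R G Om (fn (XU 0) (XU 0))" "chk R G e (xunit Om)" "chk R G m (xmod Om e)"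
      "chk R G A (XU 0)" "chk R G B (XU 0)" "chk R G f (fn A B)"
      and T: "T = fn (XApp Om A) (XApp Om B)" by (auto split: if_splits)
  show ?thesis unfolding T XMap by (rule x_Map[OF flagD[OF f] *[THEN chkD, OF c]])
next
  case (XNat Om e m A B f a)
  with t have f: "flag R" and *: "chk R G Om (fn (XU 0) (XU 0))" "chk R G e (xunit Om)" "chk R G m (xmod Om e)"
      "chk R G A (XU 0)" "chk R G B (XU 0)" "chk R G f (fn A B)" "chk R G a A"
      and T: "T = XPath (XApp Om B) (XApp (XApp e B) (XApp f a)) (XApp (XMap Om e m A B f) (XApp (XApp e A) a))" by (auto split: if_splits)
  show ?thesis unfolding T XNat by (rule x_Nat[OF flagD[OF f] *[THEN chkD, OF c]])
next
  case (XLm j)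
  with t c show ?thesis by (auto intro: librD)
qed

lemma check_infD: "check_inf R G t T ==> cx G ==> wt G t T"
  by (auto simp: check_inf_def dest!: infD intro: subt_ty split: option.splits)

lemma Lam_conv: "we G A A' (XU j) ==> wt (A # G) B (XU k) ==> te G (XPi A B) (XPi A' B)"
  unfolding te_def using x_eq_Pi x_refl by blast

lemma check_stepD:
  assumes t: "check_step R G t T" and c: "cx G"
  shows "wt G t T"
proof (cases t)
  case (XLam A b)
  with t obtain A' B where T: "toPi R G T = Some (A', B)" by (auto split: option.splits)
  with XLam t obtain k where k: "infU R G A = Some k" by (auto split: option.splits)
  have b: "chk R (A # G) b B" and eq: "A = A' \<or> (\<exists>j. eqT R G A A' = Some j) \<and> pair_ok R G A B"
    using XLam t T k by (simp_all split: option.splits if_splits)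
  have "cx (A # G)" using infUD[OF k c] by (rule x_Cons)
  then have "wt G (XLam A b) (XPi A B)" using b by (blast intro: x_Lam chkD)
  moreover have "te G (XPi A B) (XPi A' B)"
    using eq
  proof
    assume "(\<exists>j. eqT R G A A' = Some j) \<and> pair_ok R G A B"
    then show ?thesis using c by (blast dest: eqTD pair_okD intro: Lam_conv)
  qed (simp add: te_refl)
  ultimately show ?thesis using toPiD[OF T c] XLam by (blast intro: te_wt te_sym)
next
  case (XTup a b)
  with t obtain A B where T: "toSig R G T = Some (A, B)" and *: "chk R G a A" "pair_ok R G A B" "chk R G b (ins B a)"
    by (auto split: option.splits if_splits)
  with c have "wt G (XTup a b) (XSig A B)" by (blast dest: pair_okD intro: x_Tup chkD)
  with toSigD[OF T c] XTup show ?thesis by (blast intro: te_wt te_sym)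
next
  case (XRefl a)
  with t obtain A u v k where T: "toPath R G T = Some (A, u, v)" and *: "infU R G A = Some k"
      "eqM R G a u A" "eqM R G a v A"
    by (auto split: option.splits if_splits)
  have a: "wt G a A" and A: "wt G A (XU k)" using * c by (auto intro: eqMT infUD)
  have "we G (XPath A a a) (XPath A u v) (XU k)"
    using a A * c by (blast intro: x_eq_Path x_refl eqMD)
  then have "te G (XPath A a a) (XPath A u v)" by (auto simp: te_def)
  with x_Refl[OF A a] toPathD[OF T c] XRefl show ?thesis by (blast intro: te_wt te_sym)
next
  case (XFst p)
  show ?thesis
  proof (cases "asTup p")
    case None
    with t c XFst show ?thesis by (auto intro: check_infD)
  next
    case (Some ab)
    then obtain a b where p: "p = XTup a b" by (cases ab) (auto dest: asTup_D)
    with t XFst obtain B where *: "chk R G a T" "inf R G b = Some B" "pair_ok R G T (lft 1 B)"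
      by (auto split: option.splits if_splits)
    then have "wt G (XTup a b) (XSig T (lft 1 B))"
      using c by (auto dest!: pair_okD infD chkD intro!: x_Tup simp only: wt_ins_lft)
    then show ?thesis unfolding XFst p by (rule x_Fst)
  qed
next
  case (XSnd p)
  show ?thesis
  proof (cases "asTup p")
    case None
    with t c XSnd show ?thesis by (auto intro: check_infD)
  next
    case (Some ab)
    then obtain a b where p: "p = XTup a b" by (cases ab) (auto dest: asTup_D)
    with t XSnd obtain A where *: "chk R G b T" "inf R G a = Some A" "pair_ok R G A (lft 1 T)"
      by (auto split: option.splits if_splits)
    then have "wt G (XTup a b) (XSig A (lft 1 T))"
      using c by (auto dest!: pair_okD infD chkD intro!: x_Tup simp only: wt_ins_lft)
    from x_Snd[OF this] show ?thesis unfolding XSnd p wt_ins_lft .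
  qed
next
  case (XApp f a)
  show ?thesis
  \<comment> \<open>If inference does not account for the acceptance, it came from the branch for
    redexes ending in a tuple, where the codomain is \<open>T\<close> weakened.\<close>
  proof (cases "check_inf R G (XApp f a) T")
    case True
    with c XApp show ?thesis by (auto intro: check_infD)
  next
    case False
    have "\<exists>A. wt G f (XPi A (lft 1 T)) \<and> wt G a A"
    proof (cases "asLam f")
      case None
      with False t XApp obtain A where "inf R G a = Some A" "chk R G f (XPi A (lft 1 T))"
        by (auto split: option.splits if_splits)
      with c show ?thesis by (blast intro: infD chkD)
    next
      case (Some Ab)
      then obtain A b where f: "f = XLam A b" by (cases Ab) (auto dest: asLam_D)
      with False t XApp obtain i where *: "infU R G A = Some i" "chk R G a A" "chk R (A # G) b (lft 1 T)"
        by (auto split: option.splits if_splits)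
      then have "cx (A # G)" using c by (blast intro: infUD x_Cons)
      with * c f show ?thesis by (blast intro: chkD x_Lam)
    qed
    then show ?thesis unfolding XApp using x_App wt_ins_lft by metis
  qed
qed (use t c in \<open>auto intro: check_infD\<close>)

lemma whd_betaD:
  assumes t: "whd_beta R G A b a = Some (t', T)" and c: "cx G"
  shows "wt G (XApp (XLam A b) a) T \<and> we G (XApp (XLam A b) a) t' T"
proof -
  from t obtain i B where *: "infU R G A = Some i" "inf R (A # G) b = Some B" "chk R G a A"
      "whc R G (ins b a) (ins B a) = Some t'" and T: "T = ins B a"
    by (auto simp: whd_beta_def split: option.splits if_splits)
  then have "cx (A # G)" using c by (blast intro: infUD x_Cons)
  with * c show "wt G (XApp (XLam A b) a) T \<and> we G (XApp (XLam A b) a) t' T"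
    unfolding T by (blast intro: x_trans x_Pi_beta infD chkD whcD x_App x_Lam)
qed

lemma whd_appD:
  assumes t: "whd_app R G f a = Some (t', T)" and c: "cx G"
  shows "wt G (XApp f a) T \<and> we G (XApp f a) t' T"
proof -
  from t obtain f' F A B where *: "whd R G f = Some (f', F)" "toPi R G F = Some (A, B)" "chk R G a A" and T: "T = ins B a"
      and t': "whc R G (XApp f' a) (ins B a) = Some t' \<or> t' = XApp f' a"
    by (auto simp: whd_app_def split: option.splits if_splits)
  have f: "we G f f' (XPi A B)" "wt G f (XPi A B)"
    using * c by (blast intro: te_we whdD toPiD te_wt whdT)+
  with t' * c show ?thesis unfolding T by (blast intro: x_trans x_eq_App x_refl chkD whcD x_App)
qed

lemma whd_fstD:
  assumes t: "whd_fst R G p = Some (t', T)" and c: "cx G"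
  shows "wt G (XFst p) T \<and> we G (XFst p) t' T"
proof -
  from t obtain p' P B where *: "whd R G p = Some (p', P)" "toSig R G P = Some (T, B)"
    by (auto simp: whd_fst_def split: option.splits if_splits)
  have p: "we G p p' (XSig T B)" "wt G p (XSig T B)"
    using * c by (blast intro: te_we whdD toSigD te_wt whdT)+
  show ?thesis
  proof (cases "asTup p'")
    case None
    with t * p show ?thesis by (auto simp: whd_fst_def intro: x_eq_Fst x_Fst)
  next
    case (Some ab)
    then obtain a b where p': "p' = XTup a b" by (cases ab) (auto dest: asTup_D)
    with t * have **: "pair_ok R G T B" "whc R G a T = Some t'" "chk R G b (ins B a)"
      by (auto simp: whd_fst_def split: if_splits option.splits)
    from pair_okD[OF **(1) c] obtain k where B: "wt (T # G) B (XU k)" by blast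
    have "we G (XFst p) a T" using p ** c B unfolding p' by (blast intro: Fst_Tup_eq chkD whcT)
    then show ?thesis using p ** c by (blast intro: x_trans whcD x_Fst)
  qed
qed

lemma whd_sndD:
  assumes t: "whd_snd R G p = Some (t', T)" and c: "cx G"
  shows "wt G (XSnd p) T \<and> we G (XSnd p) t' T"
proof -
  from t obtain p' P A B where *: "whd R G p = Some (p', P)" "toSig R G P = Some (A, B)"
    by (auto simp: whd_snd_def split: option.splits if_splits)
  have p: "we G p p' (XSig A B)" "wt G p (XSig A B)"
    using * c by (blast intro: te_we whdD toSigD te_wt whdT)+
  show ?thesis
  proof (cases "asTup p'")
    case None
    with t * p show ?thesis by (auto simp: whd_snd_def intro: x_eq_Snd x_Snd)
  next
    case (Some ab)
    then obtain a b where p': "p' = XTup a b" by (cases ab) (auto dest: asTup_D)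
    with t * have **: "pair_ok R G A B" "chk R G a A" "whc R G b (ins B a) = Some t'" and T: "T = ins B a"
      by (auto simp: whd_snd_def split: if_splits option.splits)
    then obtain k where 1: "wt (A # G) B (XU k)" and 2: "wt G a A" "wt G b (ins B a)"
      using c by (blast dest: pair_okD intro: chkD whcT)
    have "we G (ins B (XFst p)) (ins B a) (XU k)"
      using 1 2 p unfolding p' by (blast intro: x_ins_cong Fst_Tup_eq x_Fst)
    moreover have "we G (XSnd p) b (ins B a)" using 1 2 p unfolding p' by (blast intro: Snd_Tup_eq)
    ultimately show ?thesis using ** c p unfolding T by (blast intro: x_trans whcD x_Conv x_Snd)
  qed
qed

lemma whd_infD: "whd_inf R G t = Some (t', T) ==> cx G ==> wt G t T \<and> we G t t' T"
  by (auto simp: whd_inf_def dest: infD intro: x_refl split: option.splits)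

lemma whd_jD:
  assumes t: "whd_j R G a C d b p = Some (t', T)" and c: "cx G"
  shows "wt G (XJ a C d b p) T \<and> we G (XJ a C d b p) t' T"
proof -
  let ?G = "%A. XPath (lft 1 A) (lft 1 a) (XVar 0) # A # G"
  from t consider (1) "inf R G (XJ a C d b p) = Some T" "t' = XJ a C d b p"
    | (2) k A where "infU R (?G A) C = Some k" "chk R G b A" "eqM R G a b A" "chk R G p (XPath A a b)"
      "eqM R G p (XRefl a) (XPath A a b)" "subt R G (ins2 C b p) (ins2 C a (XRefl a))"
      "whc R G d (ins2 C a (XRefl a)) = Some t'" "pair_ok R G A (XPath (lft 1 A) (lft 1 a) (XVar 0))"
      "T = ins2 C a (XRefl a)"
    by (auto simp: whd_j_def split: option.splits if_splits prod.splits)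
  then show ?thesis
  proof cases
    case 1
    then show ?thesis using c by (blast intro: infD x_refl)
  next
    case 2
    from pair_okD[OF 2(8) c] obtain j where A: "wt G A (XU j)" and "cx (?G A)" by blast
    then have C: "wt (?G A) C (XU k)" using 2 by (blast intro: infUD)
    have a: "wt G a A" using 2 c by (blast intro: eqMT)
    from C have "we G (XJ a C d b p) d (ins2 C a (XRefl a))"
      by (rule J_Refl_eq) (use 2 a A c in \<open>blast intro: eqMD chkD whcT\<close>)+
    moreover have "wt G (XJ a C d b p) (ins2 C b p)"
      by (rule x_J[OF C]) (use 2 a c in \<open>blast intro: chkD whcT\<close>)+
    ultimately show ?thesis unfolding 2(9) using 2 c by (blast intro: x_trans whcD subt_ty)
  qed
qed

lemma whd_stepD:
  assumes t: "whd_step R G t = Some (t', T)" and c: "cx G"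
  shows "wt G t T \<and> we G t t' T"
proof (cases t)
  case (XApp f a)
  with t consider "whd_inf R G (XApp f a) = Some (t', T)" | "whd_app R G f a = Some (t', T)"
    | A b where "f = XLam A b" "whd_beta R G A b a = Some (t', T)"
    by (auto split: option.splits if_splits dest: asLam_D)
  then show ?thesis using c XApp by cases (auto dest: whd_betaD whd_appD whd_infD)
next
  case (XFst p)
  with t consider "whd_inf R G (XFst p) = Some (t', T)" | "whd_fst R G p = Some (t', T)"
    | (3) a b A B where "p = XTup a b" "inf R G a = Some A" "inf R G b = Some B" "pair_ok R G A (lft 1 B)"
        "whc R G a A = Some t'" "T = A"
    by (auto split: option.splits if_splits dest: asTup_D)
  then show ?thesis
  proof cases
    case 3
    from pair_okD[OF 3(4) c] obtain k where B: "wt (A # G) (lft 1 B) (XU k)" by blast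
    have b: "wt G b (ins (lft 1 B) a)" using infD[OF 3(3) c] by (simp only: wt_ins_lft)
    from B b 3 c show ?thesis unfolding XFst
      by (blast intro: x_Fst x_Tup x_trans x_Sig_beta1 infD whcD)
  qed (use c XFst in \<open>auto dest: whd_fstD whd_infD\<close>)
next
  case (XSnd p)
  with t consider "whd_inf R G (XSnd p) = Some (t', T)" | "whd_snd R G p = Some (t', T)"
    | (3) a b A B where "p = XTup a b" "inf R G a = Some A" "inf R G b = Some B" "pair_ok R G A (lft 1 B)"
        "whc R G b B = Some t'" "T = B"
    by (auto split: option.splits if_splits dest: asTup_D)
  then show ?thesis
  proof cases
    case 3
    from pair_okD[OF 3(4) c] obtain k where B: "wt (A # G) (lft 1 B) (XU k)" by blast
    have b: "wt G b (ins (lft 1 B) a)" using infD[OF 3(3) c] by (simp only: wt_ins_lft)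
    have a: "wt G a A" using infD[OF 3(2) c] .
    from x_Snd[OF x_Tup[OF B a b]] x_Sig_beta2[OF B a b] whcD[OF 3(5) c]
    show ?thesis unfolding XSnd 3 wt_ins_lft we_ins_lft by (blast intro: x_trans)
  qed (use c XSnd in \<open>auto dest: whd_sndD whd_infD\<close>)
next
  case (XJ a C d b p)
  with t c show ?thesis by (auto dest: whd_jD whd_infD split: if_splits)
qed (use t c in \<open>simp add: whd_infD\<close>)+

lemma whc_infD: "whc_inf R G t T = Some t' ==> cx G ==> wt G t T \<and> we G t t' T"
  by (auto simp: whc_inf_def intro: subt_ty whdT split: option.splits if_splits) (meson subt_eq whdD)
lemma whc_chkD: "whc_chk R G t T = Some t' ==> cx G ==> wt G t T \<and> we G t t' T"
  by (auto simp: whc_chk_def dest: chkD intro: x_refl split: if_splits)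

lemma whc_betaD:
  assumes t: "whc_beta R G f a T = Some t'" and c: "cx G"
  shows "wt G (XApp f a) T \<and> we G (XApp f a) t' T"
proof (cases "asLam f")
  case None
  with t obtain A f' where *: "inf R G a = Some A" "whc R G f (XPi A (lft 1 T)) = Some f'"
      "whc R G (XApp f' a) T = Some t'"
    by (auto simp: whc_beta_def split: option.splits if_splits)
  have a: "wt G a A" using infD[OF *(1) c] .
  from x_App[OF whcT[OF *(2) c] a] x_eq_App[OF whcD[OF *(2) c] x_refl[OF a]] whcD[OF *(3) c]
  show ?thesis unfolding wt_ins_lft we_ins_lft by (blast intro: x_trans)
next
  case (Some Ab)
  then obtain A b where f: "f = XLam A b" by (cases Ab) (auto dest: asLam_D)
  with t obtain i where *: "infU R G A = Some i" "chk R G a A" "chk R (A # G) b (lft 1 T)"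
      "whc R G (ins b a) T = Some t'"
    by (auto simp: whc_beta_def split: option.splits if_splits)
  then have "cx (A # G)" using c by (blast intro: infUD x_Cons)
  then have b: "wt (A # G) b (lft 1 T)" using * by (blast intro: chkD)
  have a: "wt G a A" using chkD[OF *(2) c] .
  from x_App[OF x_Lam[OF b] a] x_Pi_beta[OF b a] whcD[OF *(4) c]
  show ?thesis unfolding f wt_ins_lft we_ins_lft by (blast intro: x_trans)
qed

lemma whc_stepD:
  assumes t: "whc_step R G t T = Some t'" and c: "cx G"
  shows "wt G t T \<and> we G t t' T"
proof (cases t)
  case (XApp f a)
  with t c show ?thesis by (auto dest: whc_betaD whc_infD split: if_splits)
next
  case (XFst p)
  with t consider "whc_inf R G (XFst p) T = Some t'"
    | (2) a b B where "p = XTup a b" "chk R G (XFst p) T" "inf R G b = Some B" "pair_ok R G T (lft 1 B)" "whc R G a T = Some t'"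
    by (auto split: option.splits if_splits dest: asTup_D)
  then show ?thesis
  proof cases
    case 2
    from pair_okD[OF 2(4) c] obtain k where B: "wt (T # G) (lft 1 B) (XU k)" by blast
    have b: "wt G b (ins (lft 1 B) a)" using infD[OF 2(3) c] by (simp only: wt_ins_lft)
    from B b 2 c show ?thesis unfolding XFst by (blast intro: x_trans x_Sig_beta1 whcT whcD chkD)
  qed (use c XFst in \<open>auto dest: whc_infD\<close>)
next
  case (XSnd p)
  with t consider "whc_inf R G (XSnd p) T = Some t'"
    | (2) a b A where "p = XTup a b" "chk R G (XSnd p) T" "inf R G a = Some A" "pair_ok R G A (lft 1 T)" "whc R G b T = Some t'"
    by (auto split: option.splits if_splits dest: asTup_D)
  then show ?thesis
  proof cases
    case 2
    from pair_okD[OF 2(4) c] obtain k where B: "wt (A # G) (lft 1 T) (XU k)" by blast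
    have b: "wt G b (ins (lft 1 T) a)" using whcT[OF 2(5) c] by (simp only: wt_ins_lft)
    have a: "wt G a A" using infD[OF 2(3) c] .
    from x_Sig_beta2[OF B a b] have "we G (XSnd (XTup a b)) b T" by (simp only: we_ins_lft)
    with 2 c show ?thesis unfolding XSnd by (blast intro: x_trans whcD chkD)
  qed (use c XSnd in \<open>auto dest: whc_infD\<close>)
next
  case (XJ a C d b p)
  with t c show ?thesis by (auto dest: whc_infD)
qed (use t c in \<open>simp add: whc_chkD\<close>)+

end

context sound_runner
begin

text \<open>The typing of the left side is what allows the context to be extended by
  \<open>A\<close> when the comparison goes under a binder.\<close>

definition tj :: "xt list => xt => xt => nat => bool" where
  "tj G A B k \<longleftrightarrow> wt G A (XU k) \<and> we G A B (XU k)"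

lemma eqT_tj: "eqT R G A B = Some k ==> cx G ==> tj G A B k"
  by (auto simp: tj_def dest: eqTT eqTD)

lemma tj_le: "tj G A B j ==> j \<le> k ==> tj G A B k"
  by (auto simp: tj_def intro: x_cumul x_cumul_eq)

lemma tj_cx: "tj G A B k ==> cx (A # G)"
  unfolding tj_def by (blast intro: x_Cons)

lemma tj_Pi: "tj G A A' j ==> tj (A # G) B B' k ==> tj G (XPi A B) (XPi A' B') (max j k)"
  by (simp add: tj_def x_Pi x_eq_Pi)

lemma tj_Sig: "tj G A A' j ==> tj (A # G) B B' k ==> tj G (XSig A B) (XSig A' B') (max j k)"
  by (simp add: tj_def x_Sig x_eq_Sig)

lemma whlD: "whl R G T = Some (T', k) ==> cx G ==> T = T' \<or> tj G T T' k"
  by (auto simp: whl_def tj_def dest!: asU_D dest: whdT whdD split: option.splits prod.splits if_splits)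

text \<open>The two reductions and the comparison may live in different universes; cumulativity
  brings them to the maximum, in which a dummy level does no harm.\<close>

lemma tj_step:
  assumes "tj G T1 T2 l" "T = T1 \<or> tj G T T1 j" "T' = T2 \<or> tj G T' T2 k"
  shows "tj G T T' (max j (max k l))"
proof -
  let ?l = "max j (max k l)"
  have 1: "tj G T1 T2 ?l" using assms(1) by (rule tj_le) simp
  have 2: "tj G T T1 ?l"
    using assms(2) 1 by (auto simp: tj_def intro: x_refl x_cumul x_cumul_eq)
  have 3: "T' = T2 \<or> tj G T' T2 ?l"
    using assms(3) by (auto intro: tj_le)
  show ?thesis using 1 2 3 unfolding tj_def by (blast intro: x_trans x_sym)
qed

lemma eqT_whnD:
  assumes t: "eqT_whn R G T T' = Some k" and c: "cx G"
  shows "tj G T T' k"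
proof -
  from t consider (1) K where "eqS R G T T' = Some K" "toU R G K = Some k"
    | (2) T1 j T2 j' l where "whl R G T = Some (T1, j)" "whl R G T' = Some (T2, j')" "eqT R G T1 T2 = Some l" "k = max j (max j' l)"
    by (auto simp: eqT_whn_def split: option.splits if_splits)
  then show ?thesis
  proof cases
    case 1
    then show ?thesis using c unfolding tj_def by (blast intro: te_wt te_we toUD eqST eqSD)
  next
    case 2
    show ?thesis unfolding 2(4) by (rule tj_step[OF eqT_tj[OF 2(3) c] whlD[OF 2(1) c] whlD[OF 2(2) c]])
  qed
qed

lemma tj_E: "E A = E C ==> E B = E D ==> tj G C D k ==> tj G A B k"
  by (simp add: tj_def wt_def we_def)

lemma eqT_sigD:
  assumes t: "eqT_sig R G T T' = Some k" and c: "cx G"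
  shows "tj G T T' k"
proof -
  from t consider (1) "eqT_whn R G T T' = Some k"
    | (2) A B A' B' j l where "asSig T = Some (A, B)" "asSig T' = Some (A', B')" "eqT R G A A' = Some j"
        "eqT R (A # G) B B' = Some l" "k = max j l"
    by (auto simp: eqT_sig_def split: option.splits)
  then show ?thesis
  proof cases
    case 2
    then have A: "tj G A A' j" using c by (blast intro: eqT_tj)
    then have B: "tj (A # G) B B' l" using 2 by (blast intro: eqT_tj tj_cx)
    show ?thesis unfolding 2(5) by (rule tj_E[OF 2(1,2)[THEN asSig_D] tj_Sig[OF A B]])
  qed (use c in \<open>blast intro: eqT_whnD\<close>)
qed

lemma eqT_stepD:
  assumes t: "eqT_step R G T T' = Some k" and c: "cx G"
  shows "tj G T T' k"
proof -
  from t consider (1) "T = T'" "infU R G T = Some k" | (2) "eqT_whn R G T T' = Some k" | (3) "eqT_sig R G T T' = Some k"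
    | (4) A B A' B' j l where "asPi T = Some (A, B)" "asPi T' = Some (A', B')" "eqT R G A A' = Some j"
        "eqT R (A # G) B B' = Some l" "k = max j l"
    | (5) A a b A' a' b' where "asPath T = Some (A, a, b)" "asPath T' = Some (A', a', b')" "eqT R G A A' = Some k"
        "eqM R G a a' A" "eqM R G b b' A"
    | (6) A B f A' B' f' j l where "asEq T = Some (A, B, f)" "asEq T' = Some (A', B', f')" "flag R"
        "eqT R G A A' = Some j" "eqT R G B B' = Some l" "eqM R G f f' (fn A B)" "k = max j l"
    by (auto simp: eqT_step_def split: option.splits if_splits)
  then show ?thesis
  proof cases
    case 1
    then show ?thesis using c unfolding tj_def by (blast intro: infUD x_refl)
  next
    case 4
    then have A: "tj G A A' j" using c by (blast intro: eqT_tj)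
    then have "tj (A # G) B B' l" using 4 by (blast intro: eqT_tj tj_cx)
    from tj_Pi[OF A this] show ?thesis unfolding 4(1,2)[THEN asPi_D] 4(5) .
  next
    case 5
    then show ?thesis using c unfolding 5(1,2)[THEN asPath_D] tj_def
      by (blast intro: x_Path x_eq_Path eqTT eqTD eqMT eqMD)
  next
    case 6
    then have "tj G A A' k" "tj G B B' k" using c by (auto intro: tj_le eqT_tj)
    then show ?thesis using 6 c unfolding 6(1,2)[THEN asEq_D] tj_def
      by (blast intro: x_Eq x_eq_Eq flagD eqMT eqMD)
  qed (use c in \<open>blast intro: eqT_whnD eqT_sigD\<close>)+
qed

definition mj :: "xt list => xt => xt => xt => bool" where
  "mj G u v A \<longleftrightarrow> wt G u A \<and> we G u v A"

lemma eqM_mj: "eqM R G u v A ==> cx G ==> mj G u v A"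
  by (auto simp: mj_def dest: eqMT eqMD)
lemma mj_te: "mj G u v A ==> te G A B ==> mj G u v B"
  by (auto simp: mj_def intro: te_wt te_we)
lemma mj_subt: "mj G u v A ==> subt R G A B ==> mj G u v B"
  by (auto simp: mj_def intro: subt_ty subt_eq)

lemma eqM_jD:
  assumes t: "eqM_j R G u v T" and c: "cx G"
  shows "mj G u v T"
proof -
  let ?G = "%A a. XPath (lft 1 A) (lft 1 a) (XVar 0) # A # G"
  from t obtain a C d b p a' C' d' b' p' where uv: "asJ u = Some (a, C, d, b, p)" "asJ v = Some (a', C', d', b', p')"
    by (auto simp: eqM_j_def split: option.splits)
  with t obtain A x where A: "obind (inf R G p) (toPath R G) = Some (A, x)"
    by (cases "obind (inf R G p) (toPath R G)") (auto simp: eqM_j_def)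
  with t uv obtain k where *: "eqT R (?G A a) C C' = Some k"
    by (cases "eqT R (?G A a) C C'") (simp_all add: eqM_j_def del: One_nat_def split: if_splits)
  then have *: "pair_ok R G A (XPath (lft 1 A) (lft 1 a) (XVar 0))" "eqT R (?G A a) C C' = Some k"
      "eqM R G a a' A" "eqM R G b b' A" "eqM R G d d' (ins2 C a (XRefl a))" "eqM R G p p' (XPath A a b)"
      "subt R G (ins2 C b p) T"
    using t uv A by (simp_all add: eqM_j_def del: One_nat_def split: if_splits)
  from pair_okD[OF *(1) c] have G: "cx (?G A a)" by blast
  have "mj G (XJ a C d b p) (XJ a' C' d' b' p') (ins2 C b p)" unfolding mj_def
    using x_J[OF eqTT[OF *(2) G] eqMT[OF *(3) c] eqMT[OF *(5) c] eqMT[OF *(4) c] eqMT[OF *(6) c]]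
      x_eq_J[OF eqTD[OF *(2) G] eqMD[OF *(3) c] eqMD[OF *(5) c] eqMD[OF *(4) c] eqMD[OF *(6) c]] ..
  then show ?thesis unfolding uv[THEN asJ_D] using *(7) by (rule mj_subt)
qed

lemma eqM_eta1D:
  assumes t: "eqM_eta1 R G a b p T" and c: "cx G"
  shows "mj G (XTup a b) p T"
proof -
  from t obtain D B where *: "toSig R G T = Some (D, B)" "pair_ok R G D B" "chk R G p (XSig D B)"
      "eqM R G a (XFst p) D" "eqM R G b (XSnd p) (ins B a)"
    by (auto simp: eqM_eta1_def split: option.splits if_splits)
  from pair_okD[OF *(2) c] obtain k where B: "wt (D # G) B (XU k)" by blast
  have "mj G (XTup a b) p (XSig D B)" using * B c unfolding mj_def
    by (meson x_Tup x_eq_Tup x_Sig_eta x_trans x_sym eqMT eqMD chkD)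
  then show ?thesis using toSigD[OF *(1) c] by (blast intro: mj_te te_sym)
qed

lemma eqM_eta2D:
  assumes t: "eqM_eta2 R G p a b T" and c: "cx G"
  shows "mj G p (XTup a b) T"
proof -
  from t obtain D B where *: "toSig R G T = Some (D, B)" "pair_ok R G D B" "chk R G p (XSig D B)"
      "eqM R G (XFst p) a D" "eqM R G (XSnd p) b (ins B (XFst p))"
    by (auto simp: eqM_eta2_def split: option.splits if_splits)
  from pair_okD[OF *(2) c] obtain k where B: "wt (D # G) B (XU k)" by blast
  have "mj G p (XTup a b) (XSig D B)" using * B c unfolding mj_def
    by (meson x_eq_Tup x_Sig_eta x_trans eqMD chkD)
  then show ?thesis using toSigD[OF *(1) c] by (blast intro: mj_te te_sym)
qed

lemma eqM_whnD:
  assumes t: "eqM_whn R G u v A" and c: "cx G"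
  shows "mj G u v A"
proof -
  from t consider (1) T where "eqS R G u v = Some T" "subt R G T A"
    | (2) u' v' where "whc R G u A = Some u'" "whc R G v A = Some v'" "eqM R G u' v' A"
    | (3) a b where "asTup u = Some (a, b)" "eqM_eta1 R G a b v A"
    | (4) a b where "asTup v = Some (a, b)" "eqM_eta2 R G u a b A"
    | (5) k where "eqT R G u v = Some k" "subt R G (XU k) A"
    | (6) "eqM_j R G u v A"
    by (auto simp: eqM_whn_def split: option.splits if_splits)
  then show ?thesis
  proof cases
    case 1
    then show ?thesis using c by (auto simp: mj_def intro: subt_ty subt_eq eqST eqSD)
  next
    case 2
    then show ?thesis using c unfolding mj_def by (meson whcT whcD eqMD x_trans x_sym)
  next
    case 3
    then show ?thesis using c asTup_D eqM_eta1D by blast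
  next
    case 4
    then show ?thesis using c asTup_D eqM_eta2D by blast
  next
    case 5
    then show ?thesis using c by (auto simp: mj_def intro: subt_ty subt_eq eqTT eqTD)
  qed (use c in \<open>blast intro: eqM_jD\<close>)
qed

lemma eqM_stepD:
  assumes t: "eqM_step R G u v A" and c: "cx G"
  shows "mj G u v A"
proof -
  consider (1) "u = v" | (2) "eqM_whn R G u v A"
    | (3) C b C' b' where "u = XLam C b" "v = XLam C' b'" "u \<noteq> v"
    | (4) a b a' b' where "u = XTup a b" "v = XTup a' b'" "u \<noteq> v"
    | (5) a a' where "u = XRefl a" "v = XRefl a'" "u \<noteq> v"
    using t by (cases u; cases v) (auto simp: eqM_step_def split: if_splits)
  then show ?thesis
  proof cases
    case 1
    then show ?thesis using t c by (auto simp: mj_def eqM_step_def intro: chkD x_refl)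
  next
    case 3
    with t obtain D B where T: "toPi R G A = Some (D, B)"
      by (auto simp: eqM_step_def split: option.splits if_splits)
    with t 3 obtain k where k: "eqT R G C C' = Some k"
      by (auto simp: eqM_step_def split: option.splits if_splits)
    with t 3 T have D: "D = C" and b: "eqM R (C # G) b b' B"
      by (auto simp: eqM_step_def split: if_splits)
    have "mj (C # G) b b' B" using tj_cx[OF eqT_tj[OF k c]] b by (blast intro: eqM_mj)
    then have "mj G (XLam C b) (XLam C' b') (XPi C B)"
      using k c unfolding mj_def by (blast intro: x_Lam x_eq_Lam eqTD)
    then show ?thesis unfolding 3 using toPiD[OF T c] unfolding D by (blast intro: mj_te te_sym)
  next
    case 4
    with t obtain D B where T: "toSig R G A = Some (D, B)"
      by (auto simp: eqM_step_def split: option.splits if_splits)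
    with t 4 have *: "pair_ok R G D B" "eqM R G a a' D" "eqM R G b b' (ins B a)"
      by (auto simp: eqM_step_def split: if_splits)
    from pair_okD[OF *(1) c] obtain k where B: "wt (D # G) B (XU k)" by blast
    then have "mj G (XTup a b) (XTup a' b') (XSig D B)"
      using * c unfolding mj_def by (blast intro: x_Tup x_eq_Tup eqMD eqMT)
    then show ?thesis unfolding 4 using toSigD[OF T c] by (blast intro: mj_te te_sym)
  next
    case 5
    with t obtain D x where T: "toPath R G A = Some (D, x)"
      by (auto simp: eqM_step_def split: option.splits if_splits)
    with t 5 obtain k where k: "infU R G D = Some k"
      by (auto simp: eqM_step_def split: option.splits if_splits)
    with t 5 T have *: "subt R G (XPath D a a) A" "eqM R G a a' D"
      by (auto simp: eqM_step_def split: if_splits)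
    then have "mj G (XRefl a) (XRefl a') (XPath D a a)"
      using k c unfolding mj_def by (blast intro: x_Refl x_eq_Refl eqMT eqMD infUD)
    then show ?thesis unfolding 5 using *(1) by (rule mj_subt)
  qed (use c in \<open>blast intro: eqM_whnD\<close>)
qed

lemma eqS_stepD:
  assumes t: "eqS_step R G u v = Some T" and c: "cx G"
  shows "mj G u v T"
proof -
  from t consider (1) "u = v" "inf R G u = Some T"
    | (2) f a f' a' F A B where "asApp u = Some (f, a)" "asApp v = Some (f', a')" "eqS R G f f' = Some F"
        "toPi R G F = Some (A, B)" "eqM R G a a' A" "T = ins B a"
    | (3) p p' P A B where "asFst u = Some p" "asFst v = Some p'" "eqS R G p p' = Some P" "toSig R G P = Some (A, B)" "T = A"
    | (4) p p' P A B where "asSnd u = Some p" "asSnd v = Some p'" "eqS R G p p' = Some P" "toSig R G P = Some (A, B)" "T = ins B (XFst p)"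
    by (auto simp: eqS_step_def split: option.splits if_splits)
  then show ?thesis
  proof cases
    case 1
    then show ?thesis using c by (auto simp: mj_def intro: infD x_refl)
  next
    case 2
    have "mj G f f' (XPi A B)" using 2 c unfolding mj_def by (blast intro: te_wt te_we toPiD eqST eqSD)
    with 2 c show ?thesis unfolding 2(1,2)[THEN asApp_D] mj_def by (blast intro: x_App x_eq_App eqMT eqMD)
  next
    case 3
    have "mj G p p' (XSig A B)" using 3 c unfolding mj_def by (blast intro: te_wt te_we toSigD eqST eqSD)
    with 3 c show ?thesis unfolding 3(1,2)[THEN asFst_D] mj_def by (blast intro: x_Fst x_eq_Fst)
  next
    case 4
    have "mj G p p' (XSig A B)" using 4 c unfolding mj_def by (blast intro: te_wt te_we toSigD eqST eqSD)
    with 4 c show ?thesis unfolding 4(1,2)[THEN asSnd_D] mj_def by (blast intro: x_Snd x_eq_Snd)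
  qed
qed

lemma sound_step:
  assumes b: "b ==> derived i" and L: "valid L"
  shows "sound (step L b R)"
proof -
  have "flag (step L b R) = b" by (simp add: flag_def step_def)
  moreover have "libr (step L b R) = L" by (rule ext) (simp add: libr_def step_def split: option.split)
  ultimately have f: "flag (step L b R) \<longrightarrow> derived i" "valid (libr (step L b R))" using b L by simp_all
  have m1: "wt G u r" if "cx G" "step L b R MI G u v T = Some (r, s)" for G u v T r s
    using that infer_stepD by (simp add: step_def split: option.splits)
  have m2: "wt G u T" if "cx G" "step L b R MC G u v T = Some (r, s)" for G u v T r s
    using that check_stepD by (simp add: step_def split: if_splits)
  have m3: "wt G u s \<and> we G u r s" if "cx G" "step L b R MW G u v T = Some (r, s)" for G u v T r s
    using that whd_stepD by (simp add: step_def)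
  have m4: "wt G u T \<and> we G u r T" if "cx G" "step L b R MK G u v T = Some (r, s)" for G u v T r s
    using that whc_stepD by (simp add: step_def split: option.splits)
  have m5: "tj G u v k" if "cx G" "step L b R MT G u v T = Some (XU k, s)" for G u v T k s
    using that eqT_stepD by (simp add: step_def split: option.splits)
  have m6: "mj G u v T" if "cx G" "step L b R MM G u v T = Some (r, s)" for G u v T r s
    using that eqM_stepD by (simp add: step_def split: if_splits)
  have m7: "mj G u v r" if "cx G" "step L b R MS G u v T = Some (r, s)" for G u v T r s
    using that eqS_stepD by (simp add: step_def split: option.splits)
  show ?thesis unfolding sound_def
    by (intro conjI allI impI) (use f in \<open>auto dest: m1 m2 m3 m4 m5[unfolded tj_def] m6[unfolded mj_def] m7[unfolded mj_def]\<close>)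
qed

end

lemma (in env) sound_run:
  assumes "b ==> derived i" and "valid L"
  shows "sound (run L b n)"
proof (induction n)
  case 0
  have "libr (run L b 0) = (%_. None)" by (rule ext) (simp add: libr_def)
  then show ?case by (simp add: sound_def flag_def valid_def)
next
  case (Suc n)
  then interpret sound_runner i \<sigma> "run L b n" by unfold_locales
  show ?case using sound_step[OF assms] by simp
qed

theorem (in env) okD:
  assumes "ok L b n G t T" and "b ==> derived i" and "valid L" and c: "cx G"
  shows "\<exists>k. wt G T (XU k)" and "wt G t T"
proof -
  interpret sound_runner i \<sigma> "run L b n" by unfold_locales (rule sound_run[OF assms(2,3)])
  show "\<exists>k. wt G T (XU k)" "wt G t T"
    using assms(1) c by (auto simp: ok_def intro: infUD chkD split: option.splits)
qed

section \<open>Terms in higher-order syntax\<close>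

text \<open>A term is a function of its binding depth; a bound variable remembers the depth of its binder.\<close>

type_synonym h = "nat => xt"

definition vr :: "nat => h" where "vr l = (%d. XVar (d - Suc l))"
definition U :: "nat => h" where "U i = (%d. XU i)"
definition pi :: "h => (h => h) => h" where "pi A B = (%d. XPi (A d) (B (vr d) (Suc d)))"
definition sg :: "h => (h => h) => h" where "sg A B = (%d. XSig (A d) (B (vr d) (Suc d)))"
definition lam :: "h => (h => h) => h" where "lam A B = (%d. XLam (A d) (B (vr d) (Suc d)))"
definition app :: "h => h => h" (infixl "$" 100) where "app f a = (%d. XApp (f d) (a d))"
definition arr :: "h => h => h" (infixr "~>" 95) where "arr A B = pi A (%_. B)"
definition tp :: "h => h => h" where "tp a b = (%d. XTup (a d) (b d))"
definition fs :: "h => h" where "fs p = (%d. XFst (p d))"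
definition sn :: "h => h" where "sn p = (%d. XSnd (p d))"
definition pth :: "h => h => h => h" where "pth A a b = (%d. XPath (A d) (a d) (b d))"
definition rf :: "h => h" where "rf a = (%d. XRefl (a d))"
definition jj :: "h => (h => h => h) => h => h => h => h" where
  "jj a C c b p = (%d. XJ (a d) (C (vr d) (vr (Suc d)) (Suc (Suc d))) (c d) (b d) (p d))"
definition ua :: "nat => h => h => h" where "ua i A B = (%d. XUa i (A d) (B d))"
definition fx :: "h => (h => h) => h => h => h" where
  "fx A B f g = (%d. XFx (A d) (B (vr d) (Suc d)) (f d) (g d))"
definition iseq :: "h => h => h => h" where "iseq A B f = (%d. XEq (A d) (B d) (f d))"
definition eqv :: "h => h => h" where "eqv A B = (%d. xequiv (A d) (B d))"
definition hap :: "h => (h => h) => h => h => h" where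
  "hap A B f g = (%d. xhapply (A d) (B (vr d) (Suc d)) (f d) (g d))"
definition ieq :: "nat => h => h => h" where "ieq i A B = (%d. xidtoeqv i (A d) (B d))"
definition idp :: "h => h" where "idp A = (%d. xid (A d))"

definition pull :: "h => h => h => h => h => h" where
  "pull A B C f g = sg A (%x. sg B (%y. pth C (f $ x) (g $ y)))"
definition hunit :: "h => h" where "hunit Om = (%d. xunit (Om d))"
definition hmod :: "h => h => h" where "hmod Om eta = (%d. xmod (Om d) (eta d))"
definition mdom :: "h => h => h => h" where "mdom Om A P = (%d. xdom (Om d) (A d) (P d))"
definition mcod :: "h => h => h => h => h" where "mcod Om eta A P = (%d. xcod (Om d) (eta d) (A d) (P d))"
definition mpre :: "h => h => h => h => h" where "mpre Om eta A P = (%d. xpre (Om d) (eta d) (A d) (P d))"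
definition modal :: "h => h => h => h" where "modal Om eta A = iseq A (Om $ A) (eta $ A)"
definition mmap :: "h => h => h => h => h => h => h" where
  "mmap Om eta m A B f = (%d. XMap (Om d) (eta d) (m d) (A d) (B d) (f d))"
definition mnat :: "h => h => h => h => h => h => h => h" where
  "mnat Om eta m A B f a = (%d. XNat (Om d) (eta d) (m d) (A d) (B d) (f d) (a d))"
definition mgap :: "h => h => h => h => h => h => h" where
  "mgap Om eta m A B f = lam A (%a. tp (f $ a) (tp (eta $ A $ a) (mnat Om eta m A B f a)))"
definition etale :: "h => h => h => h => h => h => h" where
  "etale Om eta m A B f = iseq A (pull B (Om $ A) (Om $ B) (eta $ B) (mmap Om eta m A B f)) (mgap Om eta m A B f)"
definition modov :: "h => h => h => h" where
  "modov Om eta X = sg (sg (U 0) (%A. modal Om eta A)) (%t. fs t ~> Om $ X)"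
definition etov :: "h => h => h => h => h" where
  "etov Om eta m X = sg (U 0) (%A. sg (A ~> X) (%g. etale Om eta m A X g))"
definition espace :: "h => h => h => h => h" where "espace Om eta X t = pull X (fs (fs t)) (Om $ X) (eta $ X) (sn t)"
definition eproj :: "h => h => h => h => h" where "eproj Om eta X t = lam (espace Om eta X t) (%p. fs p)"
definition etet :: "h => h => h => h => h" where
  "etet Om eta m X = pi (modov Om eta X) (%t. etale Om eta m (espace Om eta X t) X (eproj Om eta X t))"
definition hetmap :: "h => h => h => h => h" where
  "hetmap Om eta X e = lam (modov Om eta X) (%t. tp (espace Om eta X t) (tp (eproj Om eta X t) (e $ t)))"
definition lm :: "nat => h" where "lm j = (%d. XLm j)"

section \<open>Evaluation by rewriting\<close>

lemma add_simps: "0 + n = (n::nat)" "Suc m + n = Suc (m + n)" by simp_all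
lemma sub_simps: "m - 0 = (m::nat)" "Suc m - Suc n = m - n" by simp_all
lemma max_simps: "max 0 n = (n::nat)" "max m 0 = (m::nat)" "max (Suc m) (Suc n) = Suc (max m n)" by simp_all
lemma le_simps: "0 \<le> (n::nat)" "Suc m \<le> Suc n \<longleftrightarrow> m \<le> n" "\<not> (Suc m \<le> 0)" by simp_all
lemma if_simps: "(if True then a else b) = a" "(if False then a else b) = b" by simp_all
lemma conj_simps: "(True \<and> b) = b" "(False \<and> b) = False" by simp_all
text \<open>Used as a congruence rule, it evaluates the left conjunct first, so a structural
  equality test stops at the first difference.\<close>

lemma conj_left: "a = b ==> (a \<and> c) = (b \<and> c)" by simp
lemma eq_self: "(a = a) = True" by simp

text \<open>Fuel in chunks, so that the terms seen by the simplifier stay small.\<close>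

primrec ck :: "nat => nat" where
  "ck 0 = 0"
| "ck (Suc k) = Suc (Suc (Suc (Suc (Suc (Suc (Suc (Suc (Suc (Suc (Suc (Suc (Suc (Suc (Suc (Suc (ck k))))))))))))))))"

lemma run_ck: "run L b (ck (Suc k)) =
  run L b (Suc (Suc (Suc (Suc (Suc (Suc (Suc (Suc (Suc (Suc (Suc (Suc (Suc (Suc (Suc (Suc (ck k)))))))))))))))))"
  by simp

lemmas ev_defs = inf_def chk_def whd_def whc_def eqT_def eqM_def eqS_def flag_def libr_def whn_def whl_def
  toU_def toPi_def toSig_def toPath_def infU_def subt_def pair_ok_def check_inf_def whd_beta_def whd_app_def whd_fst_def
  whd_snd_def whd_j_def whd_inf_def whc_inf_def whc_chk_def whc_beta_def eqT_whn_def eqT_sig_def eqT_step_def eqM_j_def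
  eqM_eta1_def eqM_eta2_def eqM_whn_def eqM_step_def eqS_step_def same_head_def ok_def
  run_MI run_MC run_MW run_MK run_MT run_MM run_MS run_MF run_MX run_ck

lemmas ev_funs = infer_step.simps check_step.simps whd_step.simps whc_step.simps
  asU.simps asPi.simps asSig.simps asPath.simps asEq.simps asJ.simps asLam.simps asTup.simps asRefl.simps asApp.simps
  asFst.simps asSnd.simps hdf.simps tup_body.simps tup_redex.simps neutral.simps hdv.simps
  look.simps shv.simps sh.simps sbv.simps sb.simps

lemmas ev_obj = lft_def ins_def ins2_def fn_def xsec_def xretr_def xequiv_def xid_def xidtoeqv_def xhtpy_def xhapply_def
  xunit_def xdom_def xcod_def xpre_def xmod_def One_nat_def numeral_2_eq_2 numeral_3_eq_3

lemmas ev_data = option.case prod.case nat.case xt.inject xt.distinct nat.inject nat.distinct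
  numeral_eq_iff num.inject num.distinct
  add_simps sub_simps max_simps le_simps if_simps conj_simps eq_self simp_thms(6-8)

lemmas ev_h = vr_def U_def pi_def sg_def lam_def app_def arr_def tp_def fs_def sn_def pth_def rf_def jj_def ua_def fx_def
  iseq_def eqv_def hap_def ieq_def idp_def
  pull_def hunit_def hmod_def mdom_def mcod_def mpre_def modal_def mmap_def mnat_def mgap_def etale_def modov_def etov_def
  espace_def eproj_def etet_def hetmap_def lm_def Let_def

lemmas ev = ev_defs ev_funs ev_obj ev_data ev_h

text \<open>Only the scrutinee of a conditional or \<open>case\<close> is evaluated; the branches
  stay frozen until one is chosen.\<close>

lemmas ev_cong = if_weak_cong option.case_cong_weak prod.case_cong_weak nat.case_cong_weak conj_left

text \<open>Soundness holds for every amount of fuel; this one only has to suffice for the deepest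
  evaluation below.\<close>

abbreviation fuel :: nat where
  "fuel \<equiv> ck (Suc (Suc (Suc (Suc (Suc (Suc (Suc (Suc (Suc (Suc (Suc (Suc (Suc (Suc (Suc (Suc (Suc (Suc (Suc (Suc 0))))))))))))))))))))"

section \<open>Proofs in the object theory\<close>

text \<open>The path algebra: concatenation \<open>tr\<close>, inverse \<open>sy\<close>, action of
  a function \<open>ap\<close>, transport \<open>tpt\<close>.\<close>

definition "tr A x y z p q = jj y (%z _. pth A x z) p z q"
definition "sy A x y p = jj x (%y _. pth A y x) (rf x) y p"
definition "ap B f x y p = jj x (%y _. pth B (f x) (f y)) (rf (f x)) y p"
definition "tpt C x y p c = jj x (%y _. C y) c y p"
text \<open>\<open>fxt\<close> turns a homotopy into a path, and \<open>fxh\<close> is the path from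
  \<open>happly\<close> of the result back to the homotopy: the two halves of the section in
  \<open>Funext\<close>.\<close>

definition "fxt A B f g h = fs (fs (fx A (%_. B) f g)) $ h"
definition "fxh A B f g h = sn (fs (fx A (%_. B) f g)) $ h"
definition "idm A = lam A (%x. x)"
definition "ide A = tp (tp (idm A) (lam A (%x. rf x))) (tp (idm A) (lam A (%x. rf x)))"
definition "hty A B f g = pi A (%x. pth B (f x) (g x))"

text \<open>Path induction with the right endpoint fixed, whereas \<open>J\<close> fixes the left
  one. Quantifying over the motive inside the family of \<open>jj\<close> lets the other endpoint
  move.\<close>

definition "path_r_ty = pi (U 0) (%A. pi A (%a. pi (pi A (%x. pth A x a ~> U 1)) (%C.
     C $ a $ rf a ~> pi A (%x. pi (pth A x a) (%p. C $ x $ p)))))"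
definition "path_r_tm = lam (U 0) (%A. lam A (%a. lam (pi A (%x. pth A x a ~> U 1)) (%C.
     lam (C $ a $ rf a) (%c. lam A (%x. lam (pth A x a) (%p.
       jj x (%y q. pi (pi A (%z. pth A z y ~> U 1)) (%C. C $ y $ rf y ~> C $ x $ q))
         (lam (pi A (%z. pth A z x ~> U 1)) (%C. lam (C $ x $ rf x) (%c. c))) a p $ C $ c))))))"

text \<open>A homotopy into \<open>f\<close> may be taken to be reflexivity: path induction handles
  the path obtained by function extensionality, and transport along \<open>fxh\<close> returns to
  the given \<open>h\<close>.\<close>

definition "htpy_ind_ty = pi (U 0) (%A. pi (U 0) (%B. pi (A ~> B) (%f.
     pi (pi (A ~> B) (%g. hty A B (%x. g $ x) (%x. f $ x) ~> U 1)) (%C.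
     C $ f $ lam A (%x. rf (f $ x)) ~>
     pi (A ~> B) (%g. pi (hty A B (%x. g $ x) (%x. f $ x)) (%h. C $ g $ h))))))"
definition "htpy_ind_tm JR = lam (U 0) (%A. lam (U 0) (%B. lam (A ~> B) (%f.
     lam (pi (A ~> B) (%g. hty A B (%x. g $ x) (%x. f $ x) ~> U 1)) (%C.
     lam (C $ f $ lam A (%x. rf (f $ x))) (%c.
     lam (A ~> B) (%g. lam (hty A B (%x. g $ x) (%x. f $ x)) (%h.
       tpt (%h'. C $ g $ h') (hap A (%_. B) g f $ fxt A B g f h) h (fxh A B g f h)
         (JR $ (A ~> B) $ f $ lam (A ~> B) (%g. lam (pth (A ~> B) g f) (%p. C $ g $ (hap A (%_. B) g f $ p)))
            $ c $ g $ fxt A B g f h))))))))"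

text \<open>Univalence as an induction principle. For the path made from \<open>(f, e)\<close>,
  \<open>jj\<close> reduces to the identity, where \<open>idtoeqv\<close> computes to
  \<open>idm A\<close> and \<open>ide A\<close>; transport along the section of \<open>Ua\<close>
  returns to \<open>(f, e)\<close>.\<close>

definition "equiv_ind_ty = pi (U 0) (%A. pi (pi (U 0) (%B. pi (A ~> B) (%f. iseq A B f ~> U 1))) (%C.
     C $ A $ idm A $ ide A ~> pi (U 0) (%B. pi (A ~> B) (%f. pi (iseq A B f) (%e. C $ B $ f $ e)))))"
definition "equiv_ind_tm = lam (U 0) (%A. lam (pi (U 0) (%B. pi (A ~> B) (%f. iseq A B f ~> U 1))) (%C.
     lam (C $ A $ idm A $ ide A) (%c. lam (U 0) (%B. lam (A ~> B) (%f. lam (iseq A B f) (%e.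
       tpt (%z. C $ B $ fs z $ sn z) (ieq 0 A B $ (fs (fs (ua 0 A B)) $ tp f e)) (tp f e)
         (sn (fs (ua 0 A B)) $ tp f e)
         (jj A (%B q. C $ B $ fs (ieq 0 A B $ q) $ sn (ieq 0 A B $ q)) c B (fs (fs (ua 0 A B)) $ tp f e))))))))"

definition "equiv_prop_ty = pi (U 0) (%A. pi (U 0) (%B. pi (A ~> B) (%f. pi (iseq A B f) (%u. pi (iseq A B f) (%v.
     pth (iseq A B f) u v)))))"
text \<open>Induction on the equivalence, and then on the two homotopies of a bi-inverse of the identity.\<close>

definition "equiv_prop_tm HIND EQIND = lam (U 0) (%A. lam (U 0) (%B. lam (A ~> B) (%f. lam (iseq A B f) (%u.
     EQIND $ A $ lam (U 0) (%B. lam (A ~> B) (%f. lam (iseq A B f) (%u. pi (iseq A B f) (%v. pth (iseq A B f) u v)))) $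
      (let T = iseq A A (idm A); H = (%g. hty A A (%x. g $ x) (%x. idm A $ x)) in
       lam T (%v. HIND $ A $ A $ idm A $
        lam (A ~> A) (%g. lam (H g) (%G. pi (A ~> A) (%h. pi (H h) (%H. pth T (ide A) (tp (tp g G) (tp h H)))))) $
        (HIND $ A $ A $ idm A $
          lam (A ~> A) (%h. lam (H h) (%H. pth T (ide A) (tp (tp (idm A) (lam A (%x. rf (idm A $ x)))) (tp h H)))) $
          rf (ide A)) $ fs (fs v) $ sn (fs v) $ fs (sn v) $ sn (sn v))) $ B $ f $ u))))"

text \<open>How paths between maps into \<open>Z\<close> with a proposition \<open>D\<close>
  attached are produced: equivalence induction makes \<open>f\<close> the identity, homotopy
  induction makes the maps equal, and \<open>dp\<close> identifies the proofs of
  \<open>D\<close>.\<close>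

definition "slice_path_ty = pi (U 0) (%Z. pi (pi (U 0) (%A. (A ~> Z) ~> U 0)) (%D.
     pi (pi (U 0) (%A. pi (A ~> Z) (%g. pi (D $ A $ g) (%u. pi (D $ A $ g) (%v. pth (D $ A $ g) u v))))) (%dp.
     pi (U 0) (%A. pi (A ~> Z) (%gA. pi (D $ A $ gA) (%dA.
     pi (U 0) (%B. pi (A ~> B) (%f. pi (iseq A B f) (%e.
     pi (B ~> Z) (%gB. pi (hty A Z (%x. gB $ (f $ x)) (%x. gA $ x)) (%h. pi (D $ B $ gB) (%dB.
       pth (sg (U 0) (%A. sg (A ~> Z) (%g. D $ A $ g))) (tp A (tp gA dA)) (tp B (tp gB dB))))))))))))))"
definition "slice_path_tm HIND EQIND = lam (U 0) (%Z. lam (pi (U 0) (%A. (A ~> Z) ~> U 0)) (%D.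
     lam (pi (U 0) (%A. pi (A ~> Z) (%g. pi (D $ A $ g) (%u. pi (D $ A $ g) (%v. pth (D $ A $ g) u v))))) (%dp.
     lam (U 0) (%A. lam (A ~> Z) (%gA. lam (D $ A $ gA) (%dA.
     let T = sg (U 0) (%A. sg (A ~> Z) (%g. D $ A $ g)); G = (%B gB dB. pth T (tp A (tp gA dA)) (tp B (tp gB dB))) in
     EQIND $ A $ lam (U 0) (%B. lam (A ~> B) (%f. lam (iseq A B f) (%e.
       pi (B ~> Z) (%gB. pi (hty A Z (%x. gB $ (f $ x)) (%x. gA $ x)) (%h. pi (D $ B $ gB) (%dB. G B gB dB)))))) $
     (HIND $ A $ Z $ gA $ lam (A ~> Z) (%g. lam (hty A Z (%x. g $ x) (%x. gA $ x)) (%h. pi (D $ A $ g) (%d. G A g d))) $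
       lam (D $ A $ gA) (%d. tpt (%d. G A gA d) dA d (dp $ A $ gA $ dA $ d) (rf (tp A (tp gA dA))))))))))) "

definition "equiv_inj_ty = pi (U 0) (%A. pi (U 0) (%B. pi (A ~> B) (%f. pi (iseq A B f) (%e. pi A (%x. pi A (%y.
     pth B (f $ x) (f $ y) ~> pth A x y))))))"
definition "equiv_inj_tm EQIND = lam (U 0) (%A.
     EQIND $ A $ lam (U 0) (%B. lam (A ~> B) (%f. lam (iseq A B f) (%e. pi A (%x. pi A (%y.
     pth B (f $ x) (f $ y) ~> pth A x y))))) $ lam A (%x. lam A (%y. lam (pth A x y) (%p. p))))"

text \<open>The paths in the fibre start at \<open>b\<close>, so that after reduction to the
  identity both can be contracted by \<open>jj\<close> directly.\<close>

definition "fib_prop_ty = pi (U 0) (%A. pi (U 0) (%B. pi (A ~> B) (%f. pi (iseq A B f) (%e.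
     pi B (%b. pi A (%x. pi (pth B b (f $ x)) (%p. pi A (%y. pi (pth B b (f $ y)) (%q.
     pth (sg A (%x. pth B b (f $ x))) (tp x p) (tp y q))))))))))"
definition "fib_prop_tm EQIND = lam (U 0) (%A.
     EQIND $ A $ lam (U 0) (%B. lam (A ~> B) (%f. lam (iseq A B f) (%e.
       pi B (%b. pi A (%x. pi (pth B b (f $ x)) (%p. pi A (%y. pi (pth B b (f $ y)) (%q.
       pth (sg A (%x. pth B b (f $ x))) (tp x p) (tp y q))))))))) $
     lam A (%b. let S = sg A (%x. pth A b x) in lam A (%x. lam (pth A b x) (%p.
       jj b (%x p. pi A (%y. pi (pth A b y) (%q. pth S (tp x p) (tp y q))))
         (lam A (%y. lam (pth A b y) (%q. jj b (%y q. pth S (tp b (rf b)) (tp y q)) (rf (tp b (rf b))) y q)))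
         x p))))"

section \<open>The universal property of the reflection\<close>

definition "md F = pi (U 0 ~> U 0) (%Om. pi (hunit Om) (%eta. pi (hmod Om eta) (%m. F Om eta m)))"
definition "mdl F = lam (U 0 ~> U 0) (%Om. lam (hunit Om) (%eta. lam (hmod Om eta) (%m. F Om eta m)))"

definition "mod_ind_ty = md (%Om eta m. pi (U 0) (%A. pi (Om $ A ~> U 0) (%P. pi (pi A (%a. Om $ (P $ (eta $ A $ a)))) (%g.
     sg (pi (Om $ A) (%z. Om $ (P $ z))) (%f. pi A (%a. pth (Om $ (P $ (eta $ A $ a))) (f $ (eta $ A $ a)) (g $ a)))))))"
definition "mod_ind_tm = mdl (%Om eta m. lam (U 0) (%A. lam (Om $ A ~> U 0) (%P. lam (pi A (%a. Om $ (P $ (eta $ A $ a)))) (%g.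
     let f = fs (fs (m $ A $ P)) $ g in
     tp f (lam A (%a. jj (mpre Om eta A P $ f)
       (%g _. pth (Om $ (P $ (eta $ A $ a))) (f $ (eta $ A $ a)) (g $ a)) (rf (f $ (eta $ A $ a))) g
       (sn (fs (m $ A $ P)) $ g)))))))"

text \<open>Precomposition with the unit, for a constant family, is an equivalence and therefore
  injective.\<close>

definition "free_unique_ty = md (%Om eta m. pi (U 0) (%A. pi (U 0) (%B. pi (Om $ A ~> Om $ B) (%f. pi (Om $ A ~> Om $ B) (%g.
     hty A (Om $ B) (%a. f $ (eta $ A $ a)) (%a. g $ (eta $ A $ a)) ~>
     hty (Om $ A) (Om $ B) (%w. f $ w) (%w. g $ w))))))"
definition "free_unique_tm INJ = mdl (%Om eta m. lam (U 0) (%A. lam (U 0) (%B. lam (Om $ A ~> Om $ B) (%f. lam (Om $ A ~> Om $ B) (%g.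
     lam (hty A (Om $ B) (%a. f $ (eta $ A $ a)) (%a. g $ (eta $ A $ a))) (%h. lam (Om $ A) (%w.
     let P = lam (Om $ A) (%_. B); pr = mpre Om eta A P in
     ap (Om $ B) (%f. f $ w) f g (INJ $ mdom Om A P $ mcod Om eta A P $ pr $ (m $ A $ P) $ f $ g $
       fxt A (Om $ B) (pr $ f) (pr $ g) h))))))))"

text \<open>Extending the identity along the unit of \<open>Om A\<close> gives a retraction
  \<open>r\<close>. It is a section too, since the unit after \<open>r\<close> and the identity
  agree on the image of the unit.\<close>

definition "free_modal_ty = md (%Om eta m. pi (U 0) (%A. modal Om eta (Om $ A)))"
definition "free_modal_tm MIND UNIQ0 = mdl (%Om eta m. lam (U 0) (%A.
     let e = MIND $ Om $ eta $ m $ (Om $ A) $ lam (Om $ (Om $ A)) (%_. A) $ lam (Om $ A) (%x. x); r = fs e in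
     tp (tp r (UNIQ0 $ Om $ eta $ m $ (Om $ A) $ (Om $ A) $ lam (Om $ (Om $ A)) (%y. eta $ (Om $ A) $ (r $ y)) $
          lam (Om $ (Om $ A)) (%y. y) $
          lam (Om $ A) (%x. ap (Om $ (Om $ A)) (%x. eta $ (Om $ A) $ x) (r $ (eta $ (Om $ A) $ x)) x (sn e $ x))))
        (tp r (sn e))))"

text \<open>The unit of a modal \<open>M\<close> is injective, so the claim can be tested after
  composing with it, where the targets are reflections.\<close>

definition "modal_unique_ty = md (%Om eta m. pi (U 0) (%A. pi (U 0) (%M. modal Om eta M ~> pi (Om $ A ~> M) (%f. pi (Om $ A ~> M) (%g.
     hty A M (%a. f $ (eta $ A $ a)) (%a. g $ (eta $ A $ a)) ~> hty (Om $ A) M (%w. f $ w) (%w. g $ w))))))"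
definition "modal_unique_tm INJ UNIQ0 = mdl (%Om eta m. lam (U 0) (%A. lam (U 0) (%M. lam (modal Om eta M) (%mM.
     lam (Om $ A ~> M) (%f. lam (Om $ A ~> M) (%g.
     lam (hty A M (%a. f $ (eta $ A $ a)) (%a. g $ (eta $ A $ a))) (%h. lam (Om $ A) (%w.
     INJ $ M $ (Om $ M) $ (eta $ M) $ mM $ (f $ w) $ (g $ w) $
      (UNIQ0 $ Om $ eta $ m $ A $ M $ lam (Om $ A) (%w. eta $ M $ (f $ w)) $ lam (Om $ A) (%w. eta $ M $ (g $ w)) $
        lam A (%a. ap (Om $ M) (%x. eta $ M $ x) (f $ (eta $ A $ a)) (g $ (eta $ A $ a)) (h $ a)) $ w)))))))))"

definition "modal_extend_ty = md (%Om eta m. pi (U 0) (%A. pi (U 0) (%M. modal Om eta M ~> pi (A ~> M) (%g.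
     sg (Om $ A ~> M) (%f. hty A M (%a. f $ (eta $ A $ a)) (%a. g $ a))))))"
definition "modal_extend_tm MIND = mdl (%Om eta m. lam (U 0) (%A. lam (U 0) (%M. lam (modal Om eta M) (%mM. lam (A ~> M) (%g.
     let e = MIND $ Om $ eta $ m $ A $ lam (Om $ A) (%_. M) $ lam A (%a. eta $ M $ (g $ a)); r = fs (sn mM) in
     tp (lam (Om $ A) (%w. r $ (fs e $ w)))
       (lam A (%a. tr M (r $ (fs e $ (eta $ A $ a))) (r $ (eta $ M $ (g $ a))) (g $ a)
          (ap M (%x. r $ x) (fs e $ (eta $ A $ a)) (eta $ M $ (g $ a)) (sn e $ a)) (sn (sn mM) $ (g $ a)))))))))"

text \<open>The unit is connected: its fibres have a reflection with a point, which agrees with the image of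
  every point of the fibre.\<close>

definition "mfib Om eta X z = sg X (%x. pth (Om $ X) (eta $ X $ x) z)"

definition "unit_conn_ty = md (%Om eta m. pi (U 0) (%X. sg (pi (Om $ X) (%z. Om $ mfib Om eta X z)) (%s.
     pi (Om $ X) (%z. pi (mfib Om eta X z) (%y. pth (Om $ mfib Om eta X z) (s $ z) (eta $ mfib Om eta X z $ y))))))"
definition "unit_conn_tm MIND = mdl (%Om eta m. lam (U 0) (%X.
     let F = mfib Om eta X;
       e = MIND $ Om $ eta $ m $ X $ lam (Om $ X) F $
        lam X (%x. eta $ F (eta $ X $ x) $ tp x (rf (eta $ X $ x))) in
     tp (fs e) (lam (Om $ X) (%z. lam (F z) (%y.
       jj (eta $ X $ fs y) (%z q. pth (Om $ F z) (fs e $ z) (eta $ F z $ tp (fs y) q))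
         (sn e $ fs y) z (sn y))))))"

text \<open>For modal \<open>A\<close> and \<open>f : A \<rightarrow> Om X\<close>, the reflection of the pullback \<open>P\<close> of \<open>f\<close> along the unit is \<open>A\<close>.
  The inverse sends \<open>a\<close> to the image of the point of the reflected fibre over \<open>f a\<close>.\<close>

definition "pb_refl_ty = md (%Om eta m. pi (U 0) (%X. pi (U 0) (%A. modal Om eta A ~> pi (A ~> Om $ X) (%f.
     let P = pull X A (Om $ X) (eta $ X) f in
     sg (Om $ P ~> A) (%t. sg (hty P A (%p. t $ (eta $ P $ p)) (%p. fs (sn p))) (%_. iseq (Om $ P) A t))))))"
text \<open>The point \<open>S\<close> of the reflected fibres, the maps \<open>W\<close> from these
  to \<open>Om P\<close> and the extension \<open>T\<close> of the projection are variables, so that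
  the checker need not unfold their constructions. With \<open>pi\<close> for \<open>L\<close> this
  gives the type, with \<open>lam\<close> the term.\<close>

definition "keyb L G = L (U 0 ~> U 0) (%Om. L (hunit Om) (%eta. L (hmod Om eta) (%m. L (U 0) (%X. L (U 0) (%A. L (modal Om eta A) (%mA. L (A ~> Om $ X) (%f.
     let P = pull X A (Om $ X) (eta $ X) f; OP = Om $ P; F = (%a. mfib Om eta X (f $ a)) in
     L (pi (Om $ X) (%z. Om $ mfib Om eta X z)) (%S.
     L (pi (Om $ X) (%z. pi (mfib Om eta X z) (%y. pth (Om $ mfib Om eta X z) (S $ z) (eta $ mfib Om eta X z $ y)))) (%sh.
     L (pi A (%a. sg (Om $ F a ~> OP) (%v. hty (F a) OP (%y. v $ (eta $ F a $ y)) (%y. eta $ P $ tp (fs y) (tp a (sn y)))))) (%W.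
     L (sg (OP ~> A) (%t. hty P A (%p. t $ (eta $ P $ p)) (%p. fs (sn p)))) (%T.
       G Om eta m X A mA f S sh W T)))))))))))"
definition "pb_refl0_ty = keyb pi (%Om eta m X A mA f S sh W T.
     let P = pull X A (Om $ X) (eta $ X) f in
     sg (Om $ P ~> A) (%t. sg (hty P A (%p. t $ (eta $ P $ p)) (%p. fs (sn p))) (%_. iseq (Om $ P) A t)))"
text \<open>The inverse is \<open>s\<close>. That \<open>t\<close> after \<open>s\<close> fixes
  \<open>a\<close> is shown for all points of the reflected fibre over \<open>f a\<close> at once,
  comparing with a constant map into the modal \<open>A\<close>, and then read off at
  \<open>S\<close>. That \<open>s\<close> after \<open>t\<close> is the identity is tested on
  \<open>eta\<close> of points \<open>p\<close>, where \<open>sh\<close> replaces \<open>S\<close>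
  by the point of the fibre given by \<open>p\<close>.\<close>

definition "pb_refl0_tm OMOD UNIQ = keyb lam (%Om eta m X A mA f S sh W T.
     let P = pull X A (Om $ X) (eta $ X) f; OP = Om $ P; F = (%a. mfib Om eta X (f $ a));
       ev = (%a y. tp (fs y) (tp a (sn y)));
       V = (%a. fs (W $ a)); Vh = (%a. sn (W $ a)); t = fs T; th = sn T; s = (%a. V a $ (S $ (f $ a))) in
       tp t (tp th (tp
         (tp (lam A s) (lam A (%a. UNIQ $ Om $ eta $ m $ F a $ A $ mA $ lam (Om $ F a) (%w. t $ (V a $ w)) $ lam (Om $ F a) (%_. a) $
           lam (F a) (%y. tr A (t $ (V a $ (eta $ F a $ y))) (t $ (eta $ P $ ev a y)) a
             (ap A (%x. t $ x) (V a $ (eta $ F a $ y)) (eta $ P $ ev a y) (Vh a $ y)) (th $ ev a y)) $ (S $ (f $ a)))))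
         (tp (lam A s) (UNIQ $ Om $ eta $ m $ P $ OP $ (OMOD $ Om $ eta $ m $ P) $ lam OP (%w. s (t $ w)) $ lam OP (%w. w) $
           lam P (%p. let a = fs (sn p); y = tp (fs p) (sn (sn p)) in
             tr OP (s (t $ (eta $ P $ p))) (s a) (eta $ P $ p) (ap OP s (t $ (eta $ P $ p)) a (th $ p))
               (tr OP (s a) (V a $ (eta $ F a $ y)) (eta $ P $ p)
                 (ap OP (%u. V a $ u) (S $ (f $ a)) (eta $ F a $ y) (sh $ (f $ a) $ y)) (Vh a $ y))))))))"
definition "pb_refl_tm MIND EXT CONN KEY1 = mdl (%Om eta m. lam (U 0) (%X. lam (U 0) (%A. lam (modal Om eta A) (%mA. lam (A ~> Om $ X) (%f.
     let P = pull X A (Om $ X) (eta $ X) f; F = (%a. mfib Om eta X (f $ a)) in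
     KEY1 $ Om $ eta $ m $ X $ A $ mA $ f
     $ fs (CONN $ Om $ eta $ m $ X) $ sn (CONN $ Om $ eta $ m $ X)
     $ lam A (%a. MIND $ Om $ eta $ m $ F a $ lam (Om $ F a) (%_. P) $ lam (F a) (%y. eta $ P $ tp (fs y) (tp a (sn y))))
     $ (EXT $ Om $ eta $ m $ P $ A $ mA $ lam P (%p. fs (sn p))))))))"

text \<open>Any two points of a fibre of \<open>F\<close> over \<open>h\<close> have the same
  properties. Fibres are phrased with homotopies, so transport between homotopies and paths frames
  the use of \<open>FIB\<close>.\<close>

definition "fib_transp_ty = pi (U 0) (%A. pi (U 0) (%N. pi (U 0) (%W. pi (W ~> A ~> N) (%F. pi (iseq W (A ~> N) F) (%e. pi (A ~> N) (%h.
     let Q = (%f. hty A N (%a. h $ a) (%a. F $ f $ a)) in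
     pi (pi W (%f. Q f ~> U 0)) (%C. pi W (%f. pi (Q f) (%q. pi W (%f'. pi (Q f') (%q'.
     C $ f $ q ~> C $ f' $ q')))))))))))"
definition "fib_transp_tm FIB = lam (U 0) (%A. lam (U 0) (%N. lam (U 0) (%W. lam (W ~> A ~> N) (%F. lam (iseq W (A ~> N) F) (%e. lam (A ~> N) (%h.
     let Q = (%f. hty A N (%a. h $ a) (%a. F $ f $ a));
        fq = (%f q. fxt A N h (F $ f) q); hp = (%f p. hap A (%_. N) h (F $ f) $ p) in
     lam (pi W (%f. Q f ~> U 0)) (%C. lam W (%f. lam (Q f) (%q. lam W (%f'. lam (Q f') (%q'.
     lam (C $ f $ q) (%c.
       tpt (%r. C $ f' $ r) (hp f' (fq f' q')) q' (fxh A N h (F $ f') q')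
        (tpt (%z. C $ fs z $ hp (fs z) (sn z)) (tp f (fq f q)) (tp f' (fq f' q'))
          (FIB $ W $ (A ~> N) $ F $ e $ h $ f $ fq f q $ f' $ fq f' q')
          (tpt (%r. C $ f $ r ~> C $ f $ hp f (fq f q)) (hp f (fq f q)) q (fxh A N h (F $ f) q)
            (lam (C $ f $ hp f (fq f q)) (%c. c)) $ c))))))))))))))"

text \<open>The case where \<open>F\<close> is precomposition with the unit: extensions of
  \<open>h\<close>, together with their homotopies, are interchangeable.\<close>

definition "map_transp_ty = md (%Om eta m. pi (U 0) (%A. pi (U 0) (%B. pi (A ~> Om $ B) (%h.
     let Q = (%f. hty A (Om $ B) (%a. h $ a) (%a. f $ (eta $ A $ a))) in
     pi (pi (Om $ A ~> Om $ B) (%f. Q f ~> U 0)) (%C.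
     pi (Om $ A ~> Om $ B) (%f. pi (Q f) (%q. pi (Om $ A ~> Om $ B) (%f'. pi (Q f') (%q'.
     C $ f $ q ~> C $ f' $ q')))))))))"
definition "map_transp_tm FIBG = mdl (%Om eta m. lam (U 0) (%A. lam (U 0) (%B. 
     FIBG $ A $ (Om $ B) $ (Om $ A ~> Om $ B) $
       lam (Om $ A ~> Om $ B) (%f. lam A (%a. f $ (eta $ A $ a))) $ (m $ A $ lam (Om $ A) (%_. B)))))"

text \<open>The gap map of a square with corner \<open>M\<close> and homotopy \<open>q\<close>.  That it is an equivalence depends neither
  on the model \<open>M\<close> of the reflection of \<open>P\<close>, nor on the bottom map and the homotopy.\<close>

definition "etlG Om eta X P g M f v q =
     iseq P (pull X M (Om $ X) (eta $ X) f) (lam P (%p. tp (g $ p) (tp (v p) (q p))))"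
definition "etale_transp_ty = md (%Om eta m. pi (U 0) (%X. pi (U 0) (%P. pi (P ~> X) (%g.
     let Q = (%v f. hty P (Om $ X) (%p. eta $ X $ (g $ p)) (%p. f $ v p)) in
     pi (Om $ P ~> Om $ X) (%f'. pi (Q (%p. eta $ P $ p) f') (%q'.
     pi (U 0) (%M. pi (Om $ P ~> M) (%t. pi (iseq (Om $ P) M t) (%e.
     pi (P ~> M) (%v. pi (hty P M (%p. v $ p) (%p. t $ (eta $ P $ p))) (%w.
     pi (M ~> Om $ X) (%f. pi (Q (%p. v $ p) f) (%q.
     etlG Om eta X P g M f (%p. v $ p) (%p. q $ p) ~> etlG Om eta X P g (Om $ P) f' (%p. eta $ P $ p) (%p. q' $ p))))))))))))))"
text \<open>Equivalence induction turns \<open>M\<close> into \<open>Om P\<close> with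
  \<open>t\<close> the identity, homotopy induction turns \<open>v\<close> into the unit, and the
  remaining change from \<open>f\<close>, \<open>q\<close> to \<open>f'\<close>, \<open>q'\<close>
  is an exchange of extensions along the unit.\<close>

definition "etale_transp_tm HIND EQIND FIBH = mdl (%Om eta m. lam (U 0) (%X. lam (U 0) (%P. lam (P ~> X) (%g.
     let OP = Om $ P; OX = Om $ X; eP = (%p. eta $ P $ p); Q = (%v f. hty P (Om $ X) (%p. eta $ X $ (g $ p)) (%p. f $ v p)) in
     lam (OP ~> OX) (%f'. lam (Q eP f') (%q'.
     let G' = etlG Om eta X P g OP f' eP (%p. q' $ p);
         R = (%M v. pi (M ~> OX) (%f. pi (Q (%p. v $ p) f) (%q. etlG Om eta X P g M f (%p. v $ p) (%p. q $ p) ~> G'))) in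
     EQIND $ OP $ lam (U 0) (%M. lam (OP ~> M) (%t. lam (iseq OP M t) (%_.
       pi (P ~> M) (%v. hty P M (%p. v $ p) (%p. t $ (eta $ P $ p)) ~> R M v)))) $
     (HIND $ P $ OP $ (eta $ P) $ lam (P ~> OP) (%v. lam (hty P OP (%p. v $ p) eP) (%_. R OP v)) $
       lam (OP ~> OX) (%f. lam (Q eP f) (%q.
        FIBH $ Om $ eta $ m $ P $ X $ lam P (%p. eta $ X $ (g $ p)) $
          lam (OP ~> OX) (%f. lam (Q eP f) (%q. etlG Om eta X P g OP f eP (%p. q $ p))) $ f $ q $ f' $ q')))))))))"

text \<open>\<open>MP\<close> and \<open>NT\<close> stand for \<open>mod_map\<close> and \<open>mod_natural\<close> and stay variables, so that the checker does not
  unfold them.\<close>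

definition "mpT Om X = pi (U 0) (%A. (A ~> X) ~> Om $ A ~> Om $ X)"
definition "ntT Om eta X MP = pi (U 0) (%A. pi (A ~> X) (%g. hty A (Om $ X) (%a. eta $ X $ (g $ a)) (%a. MP $ A $ g $ (eta $ A $ a))))"
definition "gapa eta NT A g = lam A (%a. tp (g $ a) (tp (eta $ A $ a) (NT $ A $ g $ a)))"
definition "gapb Om eta X MP A g = pull X (Om $ A) (Om $ X) (eta $ X) (MP $ A $ g)"
definition "pt Om eta X A f = pull X A (Om $ X) (eta $ X) f"

definition "mx L G = L (U 0 ~> U 0) (%Om. L (hunit Om) (%eta. L (hmod Om eta) (%m. L (U 0) (%X.
     L (mpT Om X) (%MP. L (ntT Om eta X MP) (%NT. G Om eta m X MP NT))))))"

text \<open>The defining square of \<open>P\<close>, with corner \<open>A\<close>, has the identity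
  as gap map by surjective pairing, so \<open>ide P\<close> proves it an equivalence;
  \<open>ETL\<close> moves this to the corner \<open>Om P\<close>.\<close>

definition "pb_etale_ty = mx pi (%Om eta m X MP NT. pi (U 0) (%A. modal Om eta A ~> pi (A ~> Om $ X) (%f.
     let P = pt Om eta X A f; g = lam P (%p. fs p) in iseq P (gapb Om eta X MP P g) (gapa eta NT P g))))"
definition "pb_etale_tm KEY ETL = mx lam (%Om eta m X MP NT. lam (U 0) (%A. lam (modal Om eta A) (%mA. lam (A ~> Om $ X) (%f.
     let P = pt Om eta X A f; g = lam P (%p. fs p); K = KEY $ Om $ eta $ m $ X $ A $ mA $ f in
     ETL $ Om $ eta $ m $ X $ P $ g $ (MP $ P $ g) $ (NT $ P $ g) $
       A $ fs K $ sn (sn K) $ lam P (%p. fs (sn p)) $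
       lam P (%p. sy A (fs K $ (eta $ P $ p)) (fs (sn p)) (fs (sn K) $ p)) $
       f $ lam P (%p. sn (sn p)) $ ide P))))"

section \<open>The inverse of \<open>etmap\<close> and the round trips\<close>

definition "hinv Om om MP Y g = tp (tp (Om $ Y) (om $ Y)) (MP $ Y $ g)"
definition "omT Om eta = pi (U 0) (%A. modal Om eta (Om $ A))"

text \<open>Rebrackets the total space: the proof of modality sits with the type, before the
  map.\<close>

definition "modal_slice_path_ty = pi (U 0) (%Z. pi (U 0 ~> U 0) (%D. pi (pi (U 0) (%A. pi (D $ A) (%u. pi (D $ A) (%v. pth (D $ A) u v)))) (%dp.
     pi (U 0) (%A. pi (A ~> Z) (%gA. pi (D $ A) (%dA. pi (U 0) (%B. pi (A ~> B) (%f. pi (iseq A B f) (%e.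
     pi (B ~> Z) (%gB. pi (hty A Z (%x. gB $ (f $ x)) (%x. gA $ x)) (%h. pi (D $ B) (%dB.
       pth (sg (sg (U 0) (%A. D $ A)) (%t. fs t ~> Z)) (tp (tp A dA) gA) (tp (tp B dB) gB)))))))))))))"
definition "modal_slice_path_tm SIP = lam (U 0) (%Z. lam (U 0 ~> U 0) (%D. lam (pi (U 0) (%A. pi (D $ A) (%u. pi (D $ A) (%v. pth (D $ A) u v)))) (%dp.
     lam (U 0) (%A. lam (A ~> Z) (%gA. lam (D $ A) (%dA. lam (U 0) (%B. lam (A ~> B) (%f. lam (iseq A B f) (%e.
     lam (B ~> Z) (%gB. lam (hty A Z (%x. gB $ (f $ x)) (%x. gA $ x)) (%h. lam (D $ B) (%dB.
       ap (sg (sg (U 0) (%A. D $ A)) (%t. fs t ~> Z)) (%z. tp (tp (fs z) (sn (sn z))) (fs (sn z)))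
         (tp A (tp gA dA)) (tp B (tp gB dB))
         (SIP $ Z $ lam (U 0) (%A. lam (A ~> Z) (%_. D $ A)) $ lam (U 0) (%A. lam (A ~> Z) (%_. dp $ A)) $
           A $ gA $ dA $ B $ f $ e $ gB $ h $ dB)))))))))))))"

text \<open>The equivalence from \<open>Om P\<close> to \<open>A\<close> lies over
  \<open>Om X\<close> because both maps to \<open>Om X\<close> agree on the unit: there one side
  reduces to \<open>f\<close> of the second component, and the path stored in \<open>P\<close>
  followed by naturality leads to the other.\<close>

definition "left_inv_ty = mx pi (%Om eta m X MP NT. pi (omT Om eta) (%om. pi (U 0) (%A. pi (modal Om eta A) (%mA. pi (A ~> Om $ X) (%f.
     let P = pt Om eta X A f; g = lam P (%p. fs p) in pth (modov Om eta X) (hinv Om om MP P g) (tp (tp A mA) f))))))"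
definition "left_inv_tm ISP SIP2 KEY UNIQ = mx lam (%Om eta m X MP NT. lam (omT Om eta) (%om. lam (U 0) (%A. lam (modal Om eta A) (%mA. lam (A ~> Om $ X) (%f.
     let P = pt Om eta X A f; g = lam P (%p. fs p); OP = Om $ P; OX = Om $ X; mp = MP $ P $ g;
         K = KEY $ Om $ eta $ m $ X $ A $ mA $ f; tt = fs K in
       SIP2 $ OX $ lam (U 0) (%A. modal Om eta A) $
          lam (U 0) (%A. ISP $ A $ (Om $ A) $ (eta $ A)) $
          OP $ mp $ (om $ P) $ A $ tt $ sn (sn K) $ f $
          (UNIQ $ Om $ eta $ m $ P $ OX $ (om $ X) $ lam OP (%w. f $ (tt $ w)) $ mp $
            lam P (%p. let u = eta $ P $ p; x = eta $ X $ fs p in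
              tr OX (f $ (tt $ u)) x (mp $ u)
               (tr OX (f $ (tt $ u)) (f $ fs (sn p)) x (ap OX (%a. f $ a) (tt $ u) (fs (sn p)) (fs (sn K) $ p))
                  (sy OX x (f $ fs (sn p)) (sn (sn p))))
               (NT $ P $ g $ p))) $ mA)))))"

text \<open>Also the type \<open>EO\<close> of etale maps, its projections \<open>y1\<close>, \<open>y2\<close>, \<open>y3\<close> and \<open>etmap\<close> (\<open>F\<close>) are variables.  \<open>HF\<close> gives
  the first two components of \<open>F t\<close>, and \<open>MK\<close> turns an equivalence over \<open>X\<close> into a path.\<close>

definition "mab L G = mx L (%Om eta m X MP NT. L (U 1) (%EO. L (EO ~> U 0) (%y1. L (pi EO (%y. y1 $ y ~> X)) (%y2.
     L (pi EO (%y. iseq (y1 $ y) (gapb Om eta X MP (y1 $ y) (y2 $ y)) (gapa eta NT (y1 $ y) (y2 $ y)))) (%y3.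
     L (modov Om eta X ~> EO) (%F.
     L (pi (modov Om eta X) (%t. let P = pt Om eta X (fs (fs t)) (sn t) in pi (pi (U 0) (%A. (A ~> X) ~> U 1)) (%C.
          C $ P $ lam P (%p. fs p) ~> C $ (y1 $ (F $ t)) $ (y2 $ (F $ t))))) (%HF.
     L (pi EO (%y. pi (modov Om eta X) (%t. let P = pt Om eta X (fs (fs t)) (sn t) in pi (y1 $ y ~> P) (%k.
          iseq (y1 $ y) P k ~> hty (y1 $ y) X (%x. fs (k $ x)) (%x. y2 $ y $ x) ~> pth EO y (F $ t))))) (%MK.
     G Om eta m X MP NT EO y1 y2 y3 F HF MK))))))))"
definition "gen_equiv_ty = mab pi (%Om eta m X MP NT EO y1 y2 y3 F HF MK. iseq (modov Om eta X) EO F)"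
text \<open>One round trip applies \<open>MK\<close> to the gap map of \<open>y\<close>, which lies
  over \<open>X\<close> by reflexivity. The other passes through \<open>HF\<close>, a Leibniz-style
  equality that costs nothing when \<open>F\<close> computes.\<close>

definition "gen_equiv_tm OMOD RET = mab lam (%Om eta m X MP NT EO y1 y2 y3 F HF MK.
     let om = OMOD $ Om $ eta $ m; MO = modov Om eta X; iv = (%y. hinv Om om MP (y1 $ y) (y2 $ y)); i = lam EO iv in
     tp (tp i (lam EO (%y. sy EO y (F $ iv y)
           (MK $ y $ iv y $ gapa eta NT (y1 $ y) (y2 $ y) $ (y3 $ y) $ lam (y1 $ y) (%x. rf (y2 $ y $ x))))))
       (tp i (lam MO (%t. HF $ t $ lam (U 0) (%A. lam (A ~> X) (%g. pth MO (hinv Om om MP A g) t)) $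
          (RET $ Om $ eta $ m $ X $ MP $ NT $ om $ fs (fs t) $ sn (fs t) $ sn t)))))"

definition "ieT Om eta X MP NT A g = iseq A (gapb Om eta X MP A g) (gapa eta NT A g)"
definition "eoT Om eta X MP NT = sg (U 0) (%A. sg (A ~> X) (%g. ieT Om eta X MP NT A g))"
definition "eeT Om eta X MP NT = pi (modov Om eta X) (%t. ieT Om eta X MP NT (espace Om eta X t) (eproj Om eta X t))"
definition "etale_equiv_ty = mx pi (%Om eta m X MP NT. pi (eeT Om eta X MP NT) (%e. iseq (modov Om eta X) (eoT Om eta X MP NT) (hetmap Om eta X e)))"
text \<open>\<open>Q A g\<close> stands for the proposition that \<open>g\<close> is etale.\<close>

definition "qx L G = mx L (%Om eta m X MP NT. L (pi (U 0) (%A. (A ~> X) ~> U 0)) (%Q.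
     L (pi (U 0) (%A. pi (A ~> X) (%g. pi (Q $ A $ g) (%u. pi (Q $ A $ g) (%v. pth (Q $ A $ g) u v))))) (%ip.
     L (pi (U 0) (%A. pi (A ~> X) (%g. Q $ A $ g ~> ieT Om eta X MP NT A g))) (%qe.
     L (pi (modov Om eta X) (%t. Q $ espace Om eta X t $ eproj Om eta X t)) (%e. G Om eta m X MP NT Q ip qe e)))))"
definition "qo X Q = sg (U 0) (%A. sg (A ~> X) (%g. Q $ A $ g))"
definition "prop_equiv_ty = qx pi (%Om eta m X MP NT Q ip qe e. iseq (modov Om eta X) (qo X Q) (hetmap Om eta X e))"
text \<open>For the actual \<open>etmap\<close> the components of \<open>F t\<close> compute, so the
  identity serves as \<open>HF\<close>; \<open>MK\<close> is the path principle for maps carrying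
  the proposition \<open>Q\<close>.\<close>

definition "prop_equiv_tm SIP MAIN = qx lam (%Om eta m X MP NT Q ip qe e.
     let MO = modov Om eta X; EO = qo X Q; F = hetmap Om eta X e; g' = (%t. eproj Om eta X t) in
     MAIN $ Om $ eta $ m $ X $ MP $ NT $ EO $ lam EO (%y. fs y) $ lam EO (%y. fs (sn y)) $
       lam EO (%y. qe $ fs y $ fs (sn y) $ sn (sn y)) $ F $
       lam MO (%t. lam (pi (U 0) (%A. (A ~> X) ~> U 1)) (%C. lam (C $ espace Om eta X t $ g' t) (%c. c))) $
       lam EO (%y. lam MO (%t. let P = espace Om eta X t; Y = fs y; g = fs (sn y) in lam (Y ~> P) (%k. lam (iseq Y P k) (%ek.
         lam (hty Y X (%x. fs (k $ x)) (%x. g $ x)) (%h.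
          SIP $ X $ Q $ ip $ Y $ g $ sn (sn y) $ P $ k $ ek $ g' t $ h $ (e $ t)))))))"
definition "etale_equiv_tm ISP MQ = mx lam (%Om eta m X MP NT. lam (eeT Om eta X MP NT) (%e.
     MQ $ Om $ eta $ m $ X $ MP $ NT $ lam (U 0) (%A. lam (A ~> X) (%g. ieT Om eta X MP NT A g)) $
       lam (U 0) (%A. lam (A ~> X) (%g. ISP $ A $ gapb Om eta X MP A g $ gapa eta NT A g)) $
       lam (U 0) (%A. lam (A ~> X) (%g. lam (ieT Om eta X MP NT A g) (%q. q))) $ e))"
text \<open>The actual values of the variables \<open>MP\<close> and \<open>NT\<close>, still
  folded.\<close>

definition "MPc Om eta m X = lam (U 0) (%A. lam (A ~> X) (%g. mmap Om eta m A X g))"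
definition "NTc Om eta m X = lam (U 0) (%A. lam (A ~> X) (%g. lam A (%a. mnat Om eta m A X g a)))"

definition "fam_ty = md (%Om eta m. pi (U 0) (%X. etet Om eta m X))"
definition "fam_tm ETA = mdl (%Om eta m. lam (U 0) (%X. lam (modov Om eta X) (%t.
     ETA $ Om $ eta $ m $ X $ MPc Om eta m X $ NTc Om eta m X $ fs (fs t) $ sn (fs t) $ sn t)))"
definition "thm_ty = md (%Om eta m. pi (U 0) (%X. pi (etet Om eta m X) (%e. iseq (modov Om eta X) (etov Om eta m X) (hetmap Om eta X e))))"
definition "thm_tm MAIN2 = mdl (%Om eta m. lam (U 0) (%X. lam (etet Om eta m X) (%e.
     MAIN2 $ Om $ eta $ m $ X $ MPc Om eta m X $ NTc Om eta m X $ e)))"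

section \<open>Rules for the folded constants\<close>

primrec okc :: "(nat => xt option) => bool => nat => xt list => bool" where
  "okc L b n [] = True"
| "okc L b n (A # G) = (if okc L b n G then (case infU (run L b n) G A of None => False | Some _ => True) else False)"

lemma (in env) okcD:
  assumes "b ==> derived i" and "valid L"
  shows "okc L b n G ==> cx G"
proof (induction G)
  case Nil
  show ?case by (simp add: cx_def ctx_Nil)
next
  case (Cons A G)
  interpret sound_runner i \<sigma> "run L b n" by unfold_locales (rule sound_run[OF assms])
  from Cons show ?case by (auto intro: x_Cons infUD split: option.splits if_splits)
qed

lemma wf_sub_Nil: "ctx D ==> wf_sub D s []"
  by (simp add: wf_sub_def)

lemma sub_case_lift_Suc: "sub (case_nat a s) (lift (Suc (Suc n)) t) = sub s (lift (Suc n) t)"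
  by (simp add: lift_def sub_ren)

lemma sub_case_lift0: "sub (case_nat a s) (lift (Suc 0) t) = sub s t"
  by (simp add: lift_def sub_ren)

lemma wf_sub_Cons:
  assumes "wf_sub D s G" and "D \<turnstile> a \<Ztypecolon> sub s A"
  shows "wf_sub D (case_nat a s) (A # G)"
  unfolding wf_sub_def
proof (intro conjI allI impI)
  show "ctx D" using assms(1) by (simp add: wf_sub_def)
  fix n assume "n < length (A # G)"
  then show "D \<turnstile> case_nat a s n \<Ztypecolon> sub (case_nat a s) (lift (Suc n) ((A # G) ! n))"
    using assms by (cases n) (simp_all add: wf_sub_def sub_case_lift0 sub_case_lift_Suc)
qed

lemma wf_eq_Nil: "ctx D ==> wf_eq D s s' []"
  by (simp add: wf_eq_def wf_sub_Nil)

lemma wf_eq_Cons: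
  assumes "wf_eq D s s' G" and "D \<turnstile> a \<Ztypecolon> sub s A" and "D \<turnstile> a \<doteq> a' \<Ztypecolon> sub s A"
  shows "wf_eq D (case_nat a s) (case_nat a' s') (A # G)"
proof -
  have "D \<turnstile> case_nat a s n \<doteq> case_nat a' s' n \<Ztypecolon> sub (case_nat a s) (lift (Suc n) ((A # G) ! n))"
    if "n < length (A # G)" for n
    using assms that by (cases n) (simp_all add: wf_eq_def sub_case_lift0 sub_case_lift_Suc)
  then show ?thesis using assms wf_sub_Cons by (simp add: wf_eq_def)
qed

definition x_mcomp :: "xt => xt => xt => xt => xt" where
  "x_mcomp e A B f = XLam A (XApp (XApp (lft 1 e) (lft 1 B)) (XApp (lft 1 f) (XVar 0)))"
definition x_msec :: "xt => xt => xt => xt => xt" where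
  "x_msec Om m A B = XFst (XApp (XApp m A) (XLam (XApp Om A) (lft 1 B)))"
definition x_mmap :: "xt => xt => xt => xt => xt => xt => xt" where
  "x_mmap Om e m A B f = XApp (XFst (x_msec Om m A B)) (x_mcomp e A B f)"
definition x_sym :: "xt => xt => xt => xt => xt" where
  "x_sym A a b p = XJ a (XPath (lft 2 A) (XVar 1) (lft 2 a)) (XRefl a) b p"
definition x_mnat :: "xt => xt => xt => xt => xt => xt => xt => xt" where
  "x_mnat Om e m A B f a =
     (let k = XLam A (XApp (lft 1 (x_mmap Om e m A B f)) (XApp (XApp (lft 1 e) (lft 1 A)) (XVar 0)));
          h = x_mcomp e A B f
      in x_sym (XApp Om B) (XApp k a) (XApp h a)
           (XApp (XApp (xhapply A (lft 1 (XApp Om B)) k h) (XApp (XSnd (x_msec Om m A B)) h)) a))"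

context env
begin

lemma er_mod:
  "E (x_mmap Om e m A B f) = mod_map (E Om) (E e) (E m) (E A) (E B) (E f)"
  "E (x_mnat Om e m A B f a) = mod_natural (E Om) (E e) (E m) (E A) (E B) (E f) (E a)"
  by (simp_all add: x_mmap_def x_mnat_def x_msec_def x_mcomp_def x_sym_def er_simps er_obj er_obj2
      mod_map_def mod_natural_def mod_section_def mod_comp_def sym_path_def Let_def del: One_nat_def)

end

text \<open>Generic contexts with variables for the arguments of the folded constants; the rules for
  arbitrary arguments follow by substitution.\<close>

definition ectx :: "xt list" where "ectx = [fn (XVar 1) (XVar 0), XU 0, XU 0]"
definition mctx :: "xt list" where
  "mctx = [fn (XVar 1) (XVar 0), XU 0, XU 0, xmod (XVar 1) (XVar 0), xunit (XVar 0), fn (XU 0) (XU 0)]"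
definition mmap0 :: xt where "mmap0 = x_mmap (XVar 5) (XVar 4) (XVar 3) (XVar 2) (XVar 1) (XVar 0)"
definition mmapT0 :: xt where "mmapT0 = fn (XApp (XVar 5) (XVar 2)) (XApp (XVar 5) (XVar 1))"
definition mnat0 :: xt where "mnat0 = x_mnat (XVar 6) (XVar 5) (XVar 4) (XVar 3) (XVar 2) (XVar 1) (XVar 0)"
definition mnatT0 :: xt where "mnatT0 = XPath (XApp (XVar 6) (XVar 2)) (XApp (XApp (XVar 5) (XVar 2)) (XApp (XVar 1) (XVar 0)))
   (XApp (x_mmap (XVar 6) (XVar 5) (XVar 4) (XVar 3) (XVar 2) (XVar 1)) (XApp (XApp (XVar 5) (XVar 3)) (XVar 0)))"

lemma num_simps: "4 = Suc 3" "5 = Suc 4" "6 = Suc 5" by simp_all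
lemmas evb = okc.simps ectx_def mctx_def mmap0_def mmapT0_def mnat0_def mnatT0_def x_mcomp_def x_msec_def x_mmap_def
  x_sym_def x_mnat_def Let_def num_simps

text \<open>The flag is off in these runs, so they do not presuppose \<open>derived\<close>:
  \<open>XEq\<close> is typed as a sum type and the maps of the modality are written out.\<close>

lemma ectx_ok: "okc (%_. None) False fuel ectx" by (simp only: ev evb cong: ev_cong)
lemma eq_ok: "ok (%_. None) False fuel ectx (XEq (XVar 2) (XVar 1) (XVar 0)) (XU 0)" by (simp only: ev evb cong: ev_cong)
lemma mctx_ok: "okc (%_. None) False fuel mctx" by (simp only: ev evb cong: ev_cong)
lemma mctx_ok': "okc (%_. None) False fuel (XVar 2 # mctx)" by (simp only: ev evb cong: ev_cong)
lemma mmap_ok: "ok (%_. None) False fuel mctx mmap0 mmapT0" by (simp only: ev evb cong: ev_cong)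
lemma mnat_ok: "ok (%_. None) False fuel (XVar 2 # mctx) mnat0 mnatT0" by (simp only: ev evb cong: ev_cong)

text \<open>These runs have an empty library; \<open>Star\<close> is an arbitrary closed placeholder
  for its entries.\<close>

lemma base:
  assumes "okc (%_. None) False n G" and "ok (%_. None) False n G t T"
  shows "map (er i (%_. Star)) G \<turnstile> er i (%_. Star) t \<Ztypecolon> er i (%_. Star) T"
proof -
  interpret env i "%_. Star" by unfold_locales simp_all
  have L: "valid (%_. None)" by (simp add: valid_def)
  show ?thesis using okD(2)[OF assms(2) _ L okcD[OF _ L assms(1)]] by (simp add: wt_def)
qed

lemma derived: "derived i"
proof -
  interpret env i "%_. Star" by unfold_locales simp_all
  \<comment> \<open>Levels in the checker are relative, so the single run at level 0 is read at base
    level \<open>j\<close> and covers every universe.\<close>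
  have eqc: "[Fn (Var 1) (Var 0), Univ j, Univ j] \<turnstile> is_equiv (Var 2) (Var 1) (Var 0) \<Ztypecolon> Univ j" for j
  proof -
    interpret e: env j "%_. Star" by unfold_locales simp_all
    show ?thesis using base[OF ectx_ok eq_ok, of j] by (simp add: ectx_def e.er_obj)
  qed
  let ?M = "[Fn (Var 1) (Var 0), Univ i, Univ i, is_modality i (Var 1) (Var 0), unit_type i (Var 0), Fn (Univ i) (Univ i)]"
  have mapc: "?M \<turnstile> mod_map (Var 5) (Var 4) (Var 3) (Var 2) (Var 1) (Var 0) \<Ztypecolon> Fn (App (Var 5) (Var 2)) (App (Var 5) (Var 1))"
    using base[OF mctx_ok mmap_ok, of i] by (simp add: mctx_def mmap0_def mmapT0_def er_obj er_obj2 er_mod)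
  have natc: "Var 2 # ?M \<turnstile> mod_natural (Var 6) (Var 5) (Var 4) (Var 3) (Var 2) (Var 1) (Var 0) \<Ztypecolon>
      Path (App (Var 6) (Var 2)) (App (App (Var 5) (Var 2)) (App (Var 1) (Var 0)))
        (App (mod_map (Var 6) (Var 5) (Var 4) (Var 3) (Var 2) (Var 1)) (App (App (Var 5) (Var 3)) (Var 0)))"
    using base[OF mctx_ok' mnat_ok, of i] by (simp add: mctx_def mnat0_def mnatT0_def er_obj er_obj2 er_mod)
  note nums = eval_nat_numeral
  show ?thesis unfolding derived_def
  proof (intro conjI allI impI)
    fix G A B f j
    assume A: "G \<turnstile> A \<Ztypecolon> Univ j" and B: "G \<turnstile> B \<Ztypecolon> Univ j" and f: "G \<turnstile> f \<Ztypecolon> Fn A B"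
    let ?s = "case_nat f (case_nat B (case_nat A Var))"
    have "wf_sub G ?s [Fn (Var 1) (Var 0), Univ j, Univ j]"
      using A B f by (intro wf_sub_Cons wf_sub_Nil) (auto simp: sub_obj dest: ctx_of)
    with sub_typing(2)[OF eqc] have "G \<turnstile> sub ?s (is_equiv (Var 2) (Var 1) (Var 0)) \<Ztypecolon> sub ?s (Univ j)" by blast
    then show "G \<turnstile> is_equiv A B f \<Ztypecolon> Univ j" by (simp add: sub_obj nums)
  next
    fix G A B f A' B' f' j
    assume A: "G \<turnstile> A \<Ztypecolon> Univ j" "G \<turnstile> A \<doteq> A' \<Ztypecolon> Univ j" and B: "G \<turnstile> B \<Ztypecolon> Univ j" "G \<turnstile> B \<doteq> B' \<Ztypecolon> Univ j"
      and f: "G \<turnstile> f \<Ztypecolon> Fn A B" "G \<turnstile> f \<doteq> f' \<Ztypecolon> Fn A B"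
    let ?s = "case_nat f (case_nat B (case_nat A Var))" and ?s' = "case_nat f' (case_nat B' (case_nat A' Var))"
    \<comment> \<open>Congruence comes from substituting two equal triples into the one derivation
      \<open>eqc\<close>.\<close>
    have "wf_eq G ?s ?s' [Fn (Var 1) (Var 0), Univ j, Univ j]"
      using A B f by (intro wf_eq_Cons wf_eq_Nil) (auto simp: sub_obj dest: ctx_of)
    with eq_typing(2)[OF eqc] have "G \<turnstile> sub ?s (is_equiv (Var 2) (Var 1) (Var 0)) \<doteq> sub ?s' (is_equiv (Var 2) (Var 1) (Var 0)) \<Ztypecolon> sub ?s (Univ j)"
      by blast
    then show "G \<turnstile> is_equiv A B f \<doteq> is_equiv A' B' f' \<Ztypecolon> Univ j" by (simp add: sub_obj nums)
  next
    fix G Om e m A B f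
    assume h: "G \<turnstile> Om \<Ztypecolon> Fn (Univ i) (Univ i)" "G \<turnstile> e \<Ztypecolon> unit_type i Om" "G \<turnstile> m \<Ztypecolon> is_modality i Om e"
      "G \<turnstile> A \<Ztypecolon> Univ i" "G \<turnstile> B \<Ztypecolon> Univ i" "G \<turnstile> f \<Ztypecolon> Fn A B"
    let ?s = "case_nat f (case_nat B (case_nat A (case_nat m (case_nat e (case_nat Om Var)))))"
    have s: "wf_sub G ?s ?M"
      using h by (intro wf_sub_Cons wf_sub_Nil) (auto simp: sub_obj dest: ctx_of)
    with sub_typing(2)[OF mapc] have "G \<turnstile> sub ?s (mod_map (Var 5) (Var 4) (Var 3) (Var 2) (Var 1) (Var 0)) \<Ztypecolon>
      sub ?s (Fn (App (Var 5) (Var 2)) (App (Var 5) (Var 1)))" by blast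
    then show "G \<turnstile> mod_map Om e m A B f \<Ztypecolon> Fn (App Om A) (App Om B)" by (simp add: sub_obj nums)
    fix a assume a: "G \<turnstile> a \<Ztypecolon> A"
    have "wf_sub G (case_nat a ?s) (Var 2 # ?M)" by (rule wf_sub_Cons[OF s]) (simp add: nums a)
    with sub_typing(2)[OF natc] have "G \<turnstile> sub (case_nat a ?s) (mod_natural (Var 6) (Var 5) (Var 4) (Var 3) (Var 2) (Var 1) (Var 0)) \<Ztypecolon>
      sub (case_nat a ?s) (Path (App (Var 6) (Var 2)) (App (App (Var 5) (Var 2)) (App (Var 1) (Var 0)))
        (App (mod_map (Var 6) (Var 5) (Var 4) (Var 3) (Var 2) (Var 1)) (App (App (Var 5) (Var 3)) (Var 0))))" by blast
    then show "G \<turnstile> mod_natural Om e m A B f a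
      \<Ztypecolon> Path (App Om B) (App (App e B) (App f a)) (App (mod_map Om e m A B f) (App (App e A) a))"
      by (simp add: sub_obj nums)
  qed
qed

section \<open>The checker accepts the proofs\<close>

text \<open>References start at 10 because the rules for evaluation turn 1, 2 and 3 into successors.\<close>

lemmas ev_lem = Let_def
  tr_def sy_def ap_def tpt_def fxt_def fxh_def idm_def ide_def hty_def path_r_ty_def path_r_tm_def htpy_ind_ty_def htpy_ind_tm_def 
  equiv_ind_ty_def equiv_ind_tm_def equiv_prop_ty_def equiv_prop_tm_def slice_path_ty_def slice_path_tm_def equiv_inj_ty_def equiv_inj_tm_def fib_prop_ty_def fib_prop_tm_def md_def 
  mdl_def mod_ind_ty_def mod_ind_tm_def free_unique_ty_def free_unique_tm_def free_modal_ty_def free_modal_tm_def modal_unique_ty_def modal_unique_tm_def modal_extend_ty_def modal_extend_tm_def 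
  mfib_def unit_conn_ty_def unit_conn_tm_def pb_refl_ty_def keyb_def pb_refl0_ty_def pb_refl0_tm_def pb_refl_tm_def fib_transp_ty_def fib_transp_tm_def map_transp_ty_def 
  map_transp_tm_def etlG_def etale_transp_ty_def etale_transp_tm_def mpT_def ntT_def gapa_def gapb_def pt_def mx_def pb_etale_ty_def pb_etale_tm_def 
  hinv_def omT_def modal_slice_path_ty_def modal_slice_path_tm_def left_inv_ty_def left_inv_tm_def mab_def gen_equiv_ty_def gen_equiv_tm_def ieT_def eoT_def eeT_def 
  etale_equiv_ty_def qx_def qo_def prop_equiv_ty_def prop_equiv_tm_def etale_equiv_tm_def MPc_def NTc_def fam_ty_def fam_tm_def thm_ty_def thm_tm_def 

text \<open>Here and below the library \<open>L\<close> is arbitrary except for the entries used, so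
  each proof is evaluated separately, seeing earlier results only through their types.\<close>

lemma path_r_ok: "ok L True fuel [] (path_r_tm 0) (path_r_ty 0)"
  by (simp only: ev ev_lem cong: ev_cong)
lemma htpy_ind_ok: "L 10 = Some (path_r_ty 0) ==> ok L True fuel [] (htpy_ind_tm (lm 10) 0) (htpy_ind_ty 0)"
  by (simp only: ev ev_lem cong: ev_cong)
lemma equiv_ind_ok: "ok L True fuel [] (equiv_ind_tm 0) (equiv_ind_ty 0)"
  by (simp only: ev ev_lem cong: ev_cong)
lemma equiv_prop_ok: "L 11 = Some (htpy_ind_ty 0) ==> L 12 = Some (equiv_ind_ty 0) ==> ok L True fuel [] (equiv_prop_tm (lm 11) (lm 12) 0) (equiv_prop_ty 0)"
  by (simp only: ev ev_lem cong: ev_cong)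
lemma slice_path_ok: "L 11 = Some (htpy_ind_ty 0) ==> L 12 = Some (equiv_ind_ty 0) ==> ok L True fuel [] (slice_path_tm (lm 11) (lm 12) 0) (slice_path_ty 0)"
  by (simp only: ev ev_lem cong: ev_cong)
lemma equiv_inj_ok: "L 12 = Some (equiv_ind_ty 0) ==> ok L True fuel [] (equiv_inj_tm (lm 12) 0) (equiv_inj_ty 0)"
  by (simp only: ev ev_lem cong: ev_cong)
lemma fib_prop_ok: "L 12 = Some (equiv_ind_ty 0) ==> ok L True fuel [] (fib_prop_tm (lm 12) 0) (fib_prop_ty 0)"
  by (simp only: ev ev_lem cong: ev_cong)
lemma mod_ind_ok: "ok L True fuel [] (mod_ind_tm 0) (mod_ind_ty 0)"
  by (simp only: ev ev_lem cong: ev_cong)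
lemma free_unique_ok: "L 15 = Some (equiv_inj_ty 0) ==> ok L True fuel [] (free_unique_tm (lm 15) 0) (free_unique_ty 0)"
  by (simp only: ev ev_lem cong: ev_cong)
lemma free_modal_ok: "L 17 = Some (mod_ind_ty 0) ==> L 18 = Some (free_unique_ty 0) ==> ok L True fuel [] (free_modal_tm (lm 17) (lm 18) 0) (free_modal_ty 0)"
  by (simp only: ev ev_lem cong: ev_cong)
lemma modal_unique_ok: "L 15 = Some (equiv_inj_ty 0) ==> L 18 = Some (free_unique_ty 0) ==> ok L True fuel [] (modal_unique_tm (lm 15) (lm 18) 0) (modal_unique_ty 0)"
  by (simp only: ev ev_lem cong: ev_cong)
lemma modal_extend_ok: "L 17 = Some (mod_ind_ty 0) ==> ok L True fuel [] (modal_extend_tm (lm 17) 0) (modal_extend_ty 0)"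
  by (simp only: ev ev_lem cong: ev_cong)
lemma unit_conn_ok: "L 17 = Some (mod_ind_ty 0) ==> ok L True fuel [] (unit_conn_tm (lm 17) 0) (unit_conn_ty 0)"
  by (simp only: ev ev_lem cong: ev_cong)
lemma pb_refl0_ok: "L 19 = Some (free_modal_ty 0) ==> L 20 = Some (modal_unique_ty 0) ==> ok L True fuel [] (pb_refl0_tm (lm 19) (lm 20) 0) (pb_refl0_ty 0)"
  by (simp only: ev ev_lem cong: ev_cong)
lemma pb_refl_ok: "L 17 = Some (mod_ind_ty 0) ==> L 21 = Some (modal_extend_ty 0) ==> L 22 = Some (unit_conn_ty 0) ==> L 23 = Some (pb_refl0_ty 0) ==> ok L True fuel [] (pb_refl_tm (lm 17) (lm 21) (lm 22) (lm 23) 0) (pb_refl_ty 0)"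
  by (simp only: ev ev_lem cong: ev_cong)
lemma fib_transp_ok: "L 16 = Some (fib_prop_ty 0) ==> ok L True fuel [] (fib_transp_tm (lm 16) 0) (fib_transp_ty 0)"
  by (simp only: ev ev_lem cong: ev_cong)
lemma map_transp_ok: "L 25 = Some (fib_transp_ty 0) ==> ok L True fuel [] (map_transp_tm (lm 25) 0) (map_transp_ty 0)"
  by (simp only: ev ev_lem cong: ev_cong)
lemma etale_transp_ok: "L 11 = Some (htpy_ind_ty 0) ==> L 12 = Some (equiv_ind_ty 0) ==> L 26 = Some (map_transp_ty 0) ==> ok L True fuel [] (etale_transp_tm (lm 11) (lm 12) (lm 26) 0) (etale_transp_ty 0)"
  by (simp only: ev ev_lem cong: ev_cong)
lemma pb_etale_ok: "L 24 = Some (pb_refl_ty 0) ==> L 27 = Some (etale_transp_ty 0) ==> ok L True fuel [] (pb_etale_tm (lm 24) (lm 27) 0) (pb_etale_ty 0)"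
  by (simp only: ev ev_lem cong: ev_cong)
lemma modal_slice_path_ok: "L 14 = Some (slice_path_ty 0) ==> ok L True fuel [] (modal_slice_path_tm (lm 14) 0) (modal_slice_path_ty 0)"
  by (simp only: ev ev_lem cong: ev_cong)
lemma left_inv_ok: "L 13 = Some (equiv_prop_ty 0) ==> L 29 = Some (modal_slice_path_ty 0) ==> L 24 = Some (pb_refl_ty 0) ==> L 20 = Some (modal_unique_ty 0) ==> ok L True fuel [] (left_inv_tm (lm 13) (lm 29) (lm 24) (lm 20) 0) (left_inv_ty 0)"
  by (simp only: ev ev_lem cong: ev_cong)
lemma gen_equiv_ok: "L 19 = Some (free_modal_ty 0) ==> L 30 = Some (left_inv_ty 0) ==> ok L True fuel [] (gen_equiv_tm (lm 19) (lm 30) 0) (gen_equiv_ty 0)"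
  by (simp only: ev ev_lem cong: ev_cong)
lemma prop_equiv_ok: "L 14 = Some (slice_path_ty 0) ==> L 31 = Some (gen_equiv_ty 0) ==> ok L True fuel [] (prop_equiv_tm (lm 14) (lm 31) 0) (prop_equiv_ty 0)"
  by (simp only: ev ev_lem cong: ev_cong)
lemma etale_equiv_ok: "L 13 = Some (equiv_prop_ty 0) ==> L 32 = Some (prop_equiv_ty 0) ==> ok L True fuel [] (etale_equiv_tm (lm 13) (lm 32) 0) (etale_equiv_ty 0)"
  by (simp only: ev ev_lem cong: ev_cong)
lemma fam_ok: "L 28 = Some (pb_etale_ty 0) ==> ok L True fuel [] (fam_tm (lm 28) 0) (fam_ty 0)"
  by (simp only: ev ev_lem cong: ev_cong)
lemma thm_ok: "L 33 = Some (etale_equiv_ty 0) ==> ok L True fuel [] (thm_tm (lm 33) 0) (thm_ty 0)"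
  by (simp only: ev ev_lem cong: ev_cong)

section \<open>The theorem\<close>

text \<open>Recognizes terms without library references; their meaning survives every extension of
  the library.\<close>

primrec lmf :: "xt => bool" where
  "lmf (XVar n) = True" | "lmf (XU k) = True"
| "lmf (XPi A B) = (lmf A \<and> lmf B)" | "lmf (XLam A b) = (lmf A \<and> lmf b)" | "lmf (XApp f a) = (lmf f \<and> lmf a)"
| "lmf (XSig A B) = (lmf A \<and> lmf B)" | "lmf (XTup a b) = (lmf a \<and> lmf b)" | "lmf (XFst p) = lmf p" | "lmf (XSnd p) = lmf p"
| "lmf (XPath A a b) = (lmf A \<and> lmf a \<and> lmf b)" | "lmf (XRefl a) = lmf a"
| "lmf (XJ a C c b p) = (lmf a \<and> lmf C \<and> lmf c \<and> lmf b \<and> lmf p)"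
| "lmf (XUa k A B) = (lmf A \<and> lmf B)" | "lmf (XFx A B f g) = (lmf A \<and> lmf B \<and> lmf f \<and> lmf g)"
| "lmf (XEq A B f) = (lmf A \<and> lmf B \<and> lmf f)"
| "lmf (XMap Om e m A B f) = (lmf Om \<and> lmf e \<and> lmf m \<and> lmf A \<and> lmf B \<and> lmf f)"
| "lmf (XNat Om e m A B f a) = (lmf Om \<and> lmf e \<and> lmf m \<and> lmf A \<and> lmf B \<and> lmf f \<and> lmf a)"
| "lmf (XLm j) = False"

lemma lmf_er: "lmf t ==> er i \<sigma> t = er i \<sigma>' t"
  by (induction t) auto

definition good :: "nat => (nat => xt option) => bool" where
  "good i L \<longleftrightarrow> (\<exists>\<sigma>. env \<sigma> \<and> env.valid i \<sigma> L) \<and> (\<forall>j T. L j = Some T \<longrightarrow> lmf T)"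

lemma good_empty: "good i (%_. None)"
proof -
  interpret env i "%_. Star" by unfold_locales simp_all
  show ?thesis unfolding good_def using env_axioms by (auto simp: valid_def)
qed

text \<open>The accepted term may itself refer to earlier entries; its erasure under the old
  interpretation is closed and becomes the new entry.\<close>

lemma good_upd:
  assumes g: "good i L" and ok: "ok L True n [] t T" and T: "lmf T"
  shows "good i (L(N \<mapsto> T))"
proof -
  from g obtain \<sigma> where e: "env \<sigma>" and v: "env.valid i \<sigma> L" by (auto simp: good_def)
  interpret env i \<sigma> by fact
  have c: "cx []" by (simp add: cx_def ctx_Nil)
  from okD[OF ok derived v c] obtain k where 1: "[] \<turnstile> E T \<Ztypecolon> Univ (k + i)" and 2: "[] \<turnstile> E t \<Ztypecolon> E T"
    by (auto simp: wt_def)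
  define \<sigma>' where "\<sigma>' = \<sigma>(N := E t)"
  interpret e': env i \<sigma>'
    by unfold_locales (auto simp: \<sigma>'_def ren_env sub_env closed_ren[OF 2] closed_sub[OF 2])
  \<comment> \<open>A derivation in the empty context is weakened to any well-formed one; being
    closed, the term and the type do not change.\<close>
  have "G \<turnstile> E t \<Ztypecolon> E T" if "ctx G" for G
  proof -
    have "wf_ren G id []" using that by (simp add: wf_ren_def)
    with ren_typing(2)[OF 2] have "G \<turnstile> ren id (E t) \<Ztypecolon> ren id (E T)" by blast
    then show ?thesis by (simp only: closed_ren[OF 1] closed_ren[OF 2])
  qed
  moreover have "e'.E S = E S" if "(L(N \<mapsto> T)) j = Some S" for j S
    using that g T by (intro lmf_er) (auto simp: good_def split: if_splits)
  ultimately have "e'.valid (L(N \<mapsto> T))"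
    unfolding e'.valid_def using v by (auto simp: valid_def \<sigma>'_def split: if_splits)
  with e'.env_axioms g T show ?thesis by (auto simp: good_def split: if_splits)
qed

lemma path_r_lmf: "lmf (path_r_ty 0)" by (simp only: ev_h ev_lem ev_obj ev_data ev_funs lmf.simps simp_thms)
lemma htpy_ind_lmf: "lmf (htpy_ind_ty 0)" by (simp only: ev_h ev_lem ev_obj ev_data ev_funs lmf.simps simp_thms)
lemma equiv_ind_lmf: "lmf (equiv_ind_ty 0)" by (simp only: ev_h ev_lem ev_obj ev_data ev_funs lmf.simps simp_thms)
lemma equiv_prop_lmf: "lmf (equiv_prop_ty 0)" by (simp only: ev_h ev_lem ev_obj ev_data ev_funs lmf.simps simp_thms)
lemma slice_path_lmf: "lmf (slice_path_ty 0)" by (simp only: ev_h ev_lem ev_obj ev_data ev_funs lmf.simps simp_thms)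
lemma equiv_inj_lmf: "lmf (equiv_inj_ty 0)" by (simp only: ev_h ev_lem ev_obj ev_data ev_funs lmf.simps simp_thms)
lemma fib_prop_lmf: "lmf (fib_prop_ty 0)" by (simp only: ev_h ev_lem ev_obj ev_data ev_funs lmf.simps simp_thms)
lemma mod_ind_lmf: "lmf (mod_ind_ty 0)" by (simp only: ev_h ev_lem ev_obj ev_data ev_funs lmf.simps simp_thms)
lemma free_unique_lmf: "lmf (free_unique_ty 0)" by (simp only: ev_h ev_lem ev_obj ev_data ev_funs lmf.simps simp_thms)
lemma free_modal_lmf: "lmf (free_modal_ty 0)" by (simp only: ev_h ev_lem ev_obj ev_data ev_funs lmf.simps simp_thms)
lemma modal_unique_lmf: "lmf (modal_unique_ty 0)" by (simp only: ev_h ev_lem ev_obj ev_data ev_funs lmf.simps simp_thms)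
lemma modal_extend_lmf: "lmf (modal_extend_ty 0)" by (simp only: ev_h ev_lem ev_obj ev_data ev_funs lmf.simps simp_thms)
lemma unit_conn_lmf: "lmf (unit_conn_ty 0)" by (simp only: ev_h ev_lem ev_obj ev_data ev_funs lmf.simps simp_thms)
lemma pb_refl0_lmf: "lmf (pb_refl0_ty 0)" by (simp only: ev_h ev_lem ev_obj ev_data ev_funs lmf.simps simp_thms)
lemma pb_refl_lmf: "lmf (pb_refl_ty 0)" by (simp only: ev_h ev_lem ev_obj ev_data ev_funs lmf.simps simp_thms)
lemma fib_transp_lmf: "lmf (fib_transp_ty 0)" by (simp only: ev_h ev_lem ev_obj ev_data ev_funs lmf.simps simp_thms)
lemma map_transp_lmf: "lmf (map_transp_ty 0)" by (simp only: ev_h ev_lem ev_obj ev_data ev_funs lmf.simps simp_thms)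
lemma etale_transp_lmf: "lmf (etale_transp_ty 0)" by (simp only: ev_h ev_lem ev_obj ev_data ev_funs lmf.simps simp_thms)
lemma pb_etale_lmf: "lmf (pb_etale_ty 0)" by (simp only: ev_h ev_lem ev_obj ev_data ev_funs lmf.simps simp_thms)
lemma modal_slice_path_lmf: "lmf (modal_slice_path_ty 0)" by (simp only: ev_h ev_lem ev_obj ev_data ev_funs lmf.simps simp_thms)
lemma left_inv_lmf: "lmf (left_inv_ty 0)" by (simp only: ev_h ev_lem ev_obj ev_data ev_funs lmf.simps simp_thms)
lemma gen_equiv_lmf: "lmf (gen_equiv_ty 0)" by (simp only: ev_h ev_lem ev_obj ev_data ev_funs lmf.simps simp_thms)
lemma prop_equiv_lmf: "lmf (prop_equiv_ty 0)" by (simp only: ev_h ev_lem ev_obj ev_data ev_funs lmf.simps simp_thms)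
lemma etale_equiv_lmf: "lmf (etale_equiv_ty 0)" by (simp only: ev_h ev_lem ev_obj ev_data ev_funs lmf.simps simp_thms)
lemma fam_lmf: "lmf (fam_ty 0)" by (simp only: ev_h ev_lem ev_obj ev_data ev_funs lmf.simps simp_thms)
lemma thm_lmf: "lmf (thm_ty 0)" by (simp only: ev_h ev_lem ev_obj ev_data ev_funs lmf.simps simp_thms)

lemma good_lib: "\<exists>L. good i L \<and> L 34 = Some (fam_ty 0) \<and> L 35 = Some (thm_ty 0)"
proof -
  define L0 :: "nat => xt option" where "L0 = (%_. None)"
  have g0: "good i L0" unfolding L0_def by (rule good_empty)
  define L1 where "L1 = L0(10 \<mapsto> path_r_ty 0)"
  note l = L0_def
  have g1: "good i L1" unfolding L1_def by (rule good_upd[OF g0 path_r_ok]) (simp_all add: l path_r_lmf)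
  define L2 where "L2 = L1(11 \<mapsto> htpy_ind_ty 0)"
  note l = L1_def l
  have g2: "good i L2" unfolding L2_def by (rule good_upd[OF g1 htpy_ind_ok]) (simp_all add: l htpy_ind_lmf)
  define L3 where "L3 = L2(12 \<mapsto> equiv_ind_ty 0)"
  note l = L2_def l
  have g3: "good i L3" unfolding L3_def by (rule good_upd[OF g2 equiv_ind_ok]) (simp_all add: l equiv_ind_lmf)
  define L4 where "L4 = L3(13 \<mapsto> equiv_prop_ty 0)"
  note l = L3_def l
  have g4: "good i L4" unfolding L4_def by (rule good_upd[OF g3 equiv_prop_ok]) (simp_all add: l equiv_prop_lmf)
  define L5 where "L5 = L4(14 \<mapsto> slice_path_ty 0)"
  note l = L4_def l
  have g5: "good i L5" unfolding L5_def by (rule good_upd[OF g4 slice_path_ok]) (simp_all add: l slice_path_lmf)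
  define L6 where "L6 = L5(15 \<mapsto> equiv_inj_ty 0)"
  note l = L5_def l
  have g6: "good i L6" unfolding L6_def by (rule good_upd[OF g5 equiv_inj_ok]) (simp_all add: l equiv_inj_lmf)
  define L7 where "L7 = L6(16 \<mapsto> fib_prop_ty 0)"
  note l = L6_def l
  have g7: "good i L7" unfolding L7_def by (rule good_upd[OF g6 fib_prop_ok]) (simp_all add: l fib_prop_lmf)
  define L8 where "L8 = L7(17 \<mapsto> mod_ind_ty 0)"
  note l = L7_def l
  have g8: "good i L8" unfolding L8_def by (rule good_upd[OF g7 mod_ind_ok]) (simp_all add: l mod_ind_lmf)
  define L9 where "L9 = L8(18 \<mapsto> free_unique_ty 0)"
  note l = L8_def l
  have g9: "good i L9" unfolding L9_def by (rule good_upd[OF g8 free_unique_ok]) (simp_all add: l free_unique_lmf)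
  define L10 where "L10 = L9(19 \<mapsto> free_modal_ty 0)"
  note l = L9_def l
  have g10: "good i L10" unfolding L10_def by (rule good_upd[OF g9 free_modal_ok]) (simp_all add: l free_modal_lmf)
  define L11 where "L11 = L10(20 \<mapsto> modal_unique_ty 0)"
  note l = L10_def l
  have g11: "good i L11" unfolding L11_def by (rule good_upd[OF g10 modal_unique_ok]) (simp_all add: l modal_unique_lmf)
  define L12 where "L12 = L11(21 \<mapsto> modal_extend_ty 0)"
  note l = L11_def l
  have g12: "good i L12" unfolding L12_def by (rule good_upd[OF g11 modal_extend_ok]) (simp_all add: l modal_extend_lmf)
  define L13 where "L13 = L12(22 \<mapsto> unit_conn_ty 0)"
  note l = L12_def l
  have g13: "good i L13" unfolding L13_def by (rule good_upd[OF g12 unit_conn_ok]) (simp_all add: l unit_conn_lmf)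
  define L14 where "L14 = L13(23 \<mapsto> pb_refl0_ty 0)"
  note l = L13_def l
  have g14: "good i L14" unfolding L14_def by (rule good_upd[OF g13 pb_refl0_ok]) (simp_all add: l pb_refl0_lmf)
  define L15 where "L15 = L14(24 \<mapsto> pb_refl_ty 0)"
  note l = L14_def l
  have g15: "good i L15" unfolding L15_def by (rule good_upd[OF g14 pb_refl_ok]) (simp_all add: l pb_refl_lmf)
  define L16 where "L16 = L15(25 \<mapsto> fib_transp_ty 0)"
  note l = L15_def l
  have g16: "good i L16" unfolding L16_def by (rule good_upd[OF g15 fib_transp_ok]) (simp_all add: l fib_transp_lmf)
  define L17 where "L17 = L16(26 \<mapsto> map_transp_ty 0)"
  note l = L16_def l
  have g17: "good i L17" unfolding L17_def by (rule good_upd[OF g16 map_transp_ok]) (simp_all add: l map_transp_lmf)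
  define L18 where "L18 = L17(27 \<mapsto> etale_transp_ty 0)"
  note l = L17_def l
  have g18: "good i L18" unfolding L18_def by (rule good_upd[OF g17 etale_transp_ok]) (simp_all add: l etale_transp_lmf)
  define L19 where "L19 = L18(28 \<mapsto> pb_etale_ty 0)"
  note l = L18_def l
  have g19: "good i L19" unfolding L19_def by (rule good_upd[OF g18 pb_etale_ok]) (simp_all add: l pb_etale_lmf)
  define L20 where "L20 = L19(29 \<mapsto> modal_slice_path_ty 0)"
  note l = L19_def l
  have g20: "good i L20" unfolding L20_def by (rule good_upd[OF g19 modal_slice_path_ok]) (simp_all add: l modal_slice_path_lmf)
  define L21 where "L21 = L20(30 \<mapsto> left_inv_ty 0)"
  note l = L20_def l
  have g21: "good i L21" unfolding L21_def by (rule good_upd[OF g20 left_inv_ok]) (simp_all add: l left_inv_lmf)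
  define L22 where "L22 = L21(31 \<mapsto> gen_equiv_ty 0)"
  note l = L21_def l
  have g22: "good i L22" unfolding L22_def by (rule good_upd[OF g21 gen_equiv_ok]) (simp_all add: l gen_equiv_lmf)
  define L23 where "L23 = L22(32 \<mapsto> prop_equiv_ty 0)"
  note l = L22_def l
  have g23: "good i L23" unfolding L23_def by (rule good_upd[OF g22 prop_equiv_ok]) (simp_all add: l prop_equiv_lmf)
  define L24 where "L24 = L23(33 \<mapsto> etale_equiv_ty 0)"
  note l = L23_def l
  have g24: "good i L24" unfolding L24_def by (rule good_upd[OF g23 etale_equiv_ok]) (simp_all add: l etale_equiv_lmf)
  define L25 where "L25 = L24(34 \<mapsto> fam_ty 0)"
  note l = L24_def l
  have g25: "good i L25" unfolding L25_def by (rule good_upd[OF g24 fam_ok]) (simp_all add: l fam_lmf)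
  define L26 where "L26 = L25(35 \<mapsto> thm_ty 0)"
  note l = L25_def l
  have g26: "good i L26" unfolding L26_def by (rule good_upd[OF g25 thm_ok]) (simp_all add: l thm_lmf)
  show ?thesis using g26 by (intro exI[of _ L26]) (simp add: L26_def l)
qed

context env
begin

lemmas defs_obj = is_etale_def gap_map_def Pullback_def Modal_Over_def Etale_Over_def Modal_Univ_def is_modal_def
  etmap_space_def etmap_proj_def etmap_etale_def etmap_def

text \<open>Ties the type the checker worked with to the notion in the statement: the higher-order
  definitions erase to exactly the same term.\<close>

lemma fam_er: "E (fam_ty 0) = Pi (Fn (Univ i) (Univ i)) (Pi (unit_type i (Var 0)) (Pi (is_modality i (Var 1) (Var 0))
    (Pi (Univ i) (etmap_etale i (Var 3) (Var 2) (Var 1) (Var 0)))))"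
  by (simp add: fam_ty_def md_def ev_h er_obj er_obj2 defs_obj Fn_def lift_def ren_obj upr_def eval_nat_numeral)

lemma thm_er: "E (thm_ty 0) = Pi (Fn (Univ i) (Univ i)) (Pi (unit_type i (Var 0)) (Pi (is_modality i (Var 1) (Var 0))
    (Pi (Univ i) (Pi (etmap_etale i (Var 3) (Var 2) (Var 1) (Var 0))
      (is_equiv (Modal_Over i (Var 4) (Var 3) (Var 1)) (Etale_Over i (Var 4) (Var 3) (Var 2) (Var 1))
        (etmap i (Var 4) (Var 3) (Var 1) (Var 0)))))))"
  by (simp add: thm_ty_def md_def ev_h er_obj er_obj2 defs_obj Fn_def lift_def ren_obj upr_def eval_nat_numeral)

end

text \<open>Arguments are collected in one pending substitution, so the type after several
  applications is computed once instead of through nested \<open>inst\<close>.\<close>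

lemma app_sub:
  assumes "G \<turnstile> t \<Ztypecolon> sub s (Pi A B)" and "G \<turnstile> a \<Ztypecolon> sub s A"
  shows "G \<turnstile> App t a \<Ztypecolon> sub (case_nat a s) B"
proof -
  have "inst (sub (ups s) B) a = sub (case_nat a s) B"
    unfolding inst_def sub_sub
    by (rule arg_cong[of _ _ "%s. sub s B"]) (auto simp: ups_def sub_ren split: nat.split)
  then show ?thesis using ty_App[of G t "sub s A" "sub (ups s) B" a] assms by simp
qed

text \<open>The first conjunct shows that the second is not vacuous. Both come from closed library
  terms, entries 34 and 35, applied to the given data in \<open>\<Gamma>\<close>.\<close>

theorem mainTheorem13:
  fixes \<Gamma> :: "tm list" and i :: nat and Om eta m X :: tm
  assumes "\<Gamma> \<turnstile> Om \<Ztypecolon> Fn (Univ i) (Univ i)"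
    and "\<Gamma> \<turnstile> eta \<Ztypecolon> unit_type i Om"
    and "\<Gamma> \<turnstile> m \<Ztypecolon> is_modality i Om eta"
    and "\<Gamma> \<turnstile> X \<Ztypecolon> Univ i"
  shows "(\<exists>e. \<Gamma> \<turnstile> e \<Ztypecolon> etmap_etale i Om eta m X) \<and>
    (\<forall>e. \<Gamma> \<turnstile> e \<Ztypecolon> etmap_etale i Om eta m X \<longrightarrow>
      (\<exists>p. \<Gamma> \<turnstile> p \<Ztypecolon> is_equiv (Modal_Over i Om eta X) (Etale_Over i Om eta m X) (etmap i Om eta X e)))"
proof -
  from good_lib[of i] obtain L where "good i L" and L: "L 34 = Some (fam_ty 0)" "L 35 = Some (thm_ty 0)" by blast
  then obtain \<sigma> where e: "env \<sigma>" and v: "env.valid i \<sigma> L" by (auto simp: good_def)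
  interpret env i \<sigma> by fact
  have c: "ctx \<Gamma>" using assms(1) by (rule ctx_of)
  have 1: "\<Gamma> \<turnstile> \<sigma> 34 \<Ztypecolon> E (fam_ty 0)" and 2: "\<Gamma> \<turnstile> \<sigma> 35 \<Ztypecolon> E (thm_ty 0)"
    using v L c by (auto simp: valid_def)
  let ?M = "\<lambda>B. Pi (Fn (Univ i) (Univ i)) (Pi (unit_type i (Var 0)) (Pi (is_modality i (Var 1) (Var 0)) (Pi (Univ i) B)))"
  let ?E = "etmap_etale i (Var 3) (Var 2) (Var 1) (Var 0)"
  let ?F = "is_equiv (Modal_Over i (Var 4) (Var 3) (Var 1)) (Etale_Over i (Var 4) (Var 3) (Var 2) (Var 1))
     (etmap i (Var 4) (Var 3) (Var 1) (Var 0))"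
  have E1: "E (fam_ty 0) = ?M ?E" by (rule fam_er)
  have E2: "E (thm_ty 0) = ?M (Pi ?E ?F)" by (rule thm_er)
  let ?s = "case_nat X (case_nat m (case_nat eta (case_nat Om Var)))"
  have app: "\<Gamma> \<turnstile> App (App (App (App t Om) eta) m) X \<Ztypecolon> sub ?s B" if "\<Gamma> \<turnstile> t \<Ztypecolon> ?M B" for t B
    using assms that by (intro app_sub[where A = "Univ i"] app_sub[where A = "is_modality i (Var 1) (Var 0)"]
      app_sub[where A = "unit_type i (Var 0)"] app_sub[where A = "Fn (Univ i) (Univ i)"]) (simp_all add: sub_obj)
  have sE: "sub ?s ?E = etmap_etale i Om eta m X" by (simp add: sub_obj eval_nat_numeral)
  have "\<exists>e. \<Gamma> \<turnstile> e \<Ztypecolon> etmap_etale i Om eta m X"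
    using app[OF 1[unfolded E1]] unfolding sE by blast
  moreover have "\<exists>p. \<Gamma> \<turnstile> p \<Ztypecolon> is_equiv (Modal_Over i Om eta X) (Etale_Over i Om eta m X) (etmap i Om eta X e)"
    if "\<Gamma> \<turnstile> e \<Ztypecolon> etmap_etale i Om eta m X" for e
  proof -
    have "\<Gamma> \<turnstile> App (App (App (App (App (\<sigma> 35) Om) eta) m) X) e \<Ztypecolon> sub (case_nat e ?s) ?F"
      using app[OF 2[unfolded E2]] that[folded sE] by (rule app_sub)
    moreover have "sub (case_nat e ?s) ?F = is_equiv (Modal_Over i Om eta X) (Etale_Over i Om eta m X) (etmap i Om eta X e)"
      by (simp add: sub_obj eval_nat_numeral)
    ultimately show ?thesis by auto
  qed
  ultimately show ?thesis by blast
qed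

end
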